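(* Let $n\ge 2$, let $U\subset\mathbb{R}^n$ be a connected open set, let $X=(X_1,\dots,X_m)$ be smooth real vector fields on $U$ satisfying Hörmander's condition (H), and let $\Omega\subset\subset U$ be a bounded open subset with generalized Métivier index $\tilde\nu$. Then there exists a constant $C>0$ such that for every bounded open set $E\subset\subset\Omega$ with $C^1$ boundary $\partial E$, $$|E|^{\frac{\tilde\nu-1}{\tilde\nu}}\le C\,P_X(E;\Omega).$$
   Context: Condition (H): there is a (smallest) positive integer $s_0$ such that $X_1,\dots,X_m$ together with their commutators of length at most $s_0$ span $\mathbb{R}^n$ at each point of $U$. $A\subset\subset B$ means $\overline A$ is a compact subset of $B$; $|E|$ is Lebesgue measure. $X_j^*=-X_j-\mathrm{div}X_j$ is the formal adjoint of $X_j$. The $X$-perimeter of a measurable set $E\subset\mathbb{R}^n$ in $\Omega$ is $$P_X(E;\Omega)=\sup_{\varphi\in\mathcal{F}(\Omega;\mathbb{R}^m)}\int_{E}\sum_{j=1}^mX_j^*\varphi_j\,dx,$$ where $\mathcal{F}(\Omega;\mathbb{R}^m)=\{\varphi=(\varphi_1,\dots,\varphi_m)\in(C_0^1(\Omega))^m:\ \sup_{x\in\Omega}(\sum_{j=1}^m|\varphi_j(x)|^2)^{1/2}\le1\}$. For $x\in U$, let $V_j(x)\subset\mathbb{R}^n$ be the span of the values at $x$ of all iterated commutators $[X_{i_1},[\dots,[X_{i_{r-1}},X_{i_r}]\dots]]$ of length $r\le j$, $\nu_j(x)=\dim V_j(x)$, $\nu_0(x)=0$, and $s(x)$ the smallest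 integer with $V_{s(x)}(x)=\mathbb{R}^n$. Pointwise homogeneous dimension: $\nu(x)=\sum_{j=1}^{s(x)}j(\nu_j(x)-\nu_{j-1}(x))$. Generalized Métivier index: $\tilde\nu=\max_{x\in\overline\Omega}\nu(x)$. *)

theory Defs
  imports "HOL-Analysis.Analysis"
begin

text \<open>
  \<open>Ck_on k U f\<close>, meant for open \<open>U\<close>: \<open>f\<close> is \<open>k\<close> times continuously differentiable on \<open>U\<close>.
  In finite dimension, continuity of all directional derivatives is continuity of the derivative.
\<close>

primrec Ck_on ::
  "nat \<Rightarrow> 'a::euclidean_space set \<Rightarrow> ('a \<Rightarrow> 'b::euclidean_space) \<Rightarrow> bool" where
  "Ck_on 0 U f \<longleftrightarrow> continuous_on U f"
| "Ck_on (Suc k) U f \<longleftrightarrow>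
     (\<forall>x\<in>U. f differentiable (at x)) \<and> (\<forall>v. Ck_on k U (\<lambda>x. frechet_derivative f (at x) v))"

definition smooth_on ::
  "'a::euclidean_space set \<Rightarrow> ('a \<Rightarrow> 'b::euclidean_space) \<Rightarrow> bool" where
  "smooth_on U f \<longleftrightarrow> (\<forall>k. Ck_on k U f)"

definition compactly_contained ::
  "'a::topological_space set \<Rightarrow> 'a set \<Rightarrow> bool" (infix \<open>\<subset>\<subset>\<close> 50) where
  "A \<subset>\<subset> B \<longleftrightarrow> compact (closure A) \<and> closure A \<subseteq> B"

text \<open>
  A vector field \<open>\<Sum>\<^sub>k a\<^sub>k \<partial>\<^sub>k\<close> on an open set is represented by its coefficient map
  \<open>a :: real^'n \<Rightarrow> real^'n\<close>; values outside the open set are irrelevant, since all notions below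
  depend only on the germ of the field at the point considered.
\<close>

definition vf_apply :: "(real^'n \<Rightarrow> real^'n) \<Rightarrow> (real^'n \<Rightarrow> real) \<Rightarrow> real^'n \<Rightarrow> real" where
  "vf_apply Y f x = frechet_derivative f (at x) (Y x)"

definition divergence :: "(real^'n \<Rightarrow> real^'n) \<Rightarrow> real^'n \<Rightarrow> real" where
  "divergence Y x = (\<Sum>k\<in>UNIV. frechet_derivative (\<lambda>y. Y y $ k) (at x) (axis k 1))"

definition vf_adjoint :: "(real^'n \<Rightarrow> real^'n) \<Rightarrow> (real^'n \<Rightarrow> real) \<Rightarrow> real^'n \<Rightarrow> real" where
  "vf_adjoint Y f x = - vf_apply Y f x - divergence Y x * f x"

text \<open>The \<open>k\<close>-th coefficient of \<open>[Y, Z] = YZ - ZY\<close> is \<open>Y Z\<^sub>k - Z Y\<^sub>k\<close>.\<close>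

definition commutator ::
  "(real^'n \<Rightarrow> real^'n) \<Rightarrow> (real^'n \<Rightarrow> real^'n) \<Rightarrow> real^'n \<Rightarrow> real^'n" where
  "commutator Y Z x =
     (\<chi> k. vf_apply Y (\<lambda>y. Z y $ k) x - vf_apply Z (\<lambda>y. Y y $ k) x)"

text \<open>
  \<open>iter_commutator X [i\<^sub>1, \<dots>, i\<^sub>r] = [X\<^bsub>i\<^sub>1\<^esub>, [\<dots>, [X\<^bsub>i\<^sub>r\<^sub>-\<^sub>1\<^esub>, X\<^bsub>i\<^sub>r\<^esub>]\<dots>]]\<close>, of length \<open>r \<ge> 1\<close>;
  the value at the empty list is a dummy that is never used.
\<close>

fun iter_commutator ::
  "('m \<Rightarrow> real^'n \<Rightarrow> real^'n) \<Rightarrow> 'm list \<Rightarrow> real^'n \<Rightarrow> real^'n" where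
  "iter_commutator X [] = (\<lambda>x. 0)"
| "iter_commutator X [i] = X i"
| "iter_commutator X (i # j # js) = commutator (X i) (iter_commutator X (j # js))"

definition comm_span ::
  "('m \<Rightarrow> real^'n \<Rightarrow> real^'n) \<Rightarrow> nat \<Rightarrow> real^'n \<Rightarrow> (real^'n) set" where
  "comm_span X j x = span {iter_commutator X is x | is. is \<noteq> [] \<and> length is \<le> j}"

definition hormander_condition ::
  "('m \<Rightarrow> real^'n \<Rightarrow> real^'n) \<Rightarrow> (real^'n) set \<Rightarrow> bool" where
  "hormander_condition X U \<longleftrightarrow> (\<exists>s0>0. \<forall>x\<in>U. comm_span X s0 x = UNIV)"

definition comm_dim :: "('m \<Rightarrow> real^'n \<Rightarrow> real^'n) \<Rightarrow> nat \<Rightarrow> real^'n \<Rightarrow> nat" where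
  "comm_dim X j x = dim (comm_span X j x)"

definition comm_step :: "('m \<Rightarrow> real^'n \<Rightarrow> real^'n) \<Rightarrow> real^'n \<Rightarrow> nat" where
  "comm_step X x = (LEAST s. comm_span X s x = UNIV)"

text \<open>
  No truncation occurs in the subtraction, as \<open>comm_dim X j x\<close> is nondecreasing in \<open>j\<close>;
  \<open>comm_dim X 0 x = 0\<close> since \<open>comm_span X 0 x = span {}\<close>.
\<close>

definition pointwise_hom_dim :: "('m \<Rightarrow> real^'n \<Rightarrow> real^'n) \<Rightarrow> real^'n \<Rightarrow> nat" where
  "pointwise_hom_dim X x =
     (\<Sum>j = 1..comm_step X x. j * (comm_dim X j x - comm_dim X (j - 1) x))"

text \<open>
  Under Hoermander's condition on a neighbourhood of \<open>closure \<Omega>\<close> the set of values is finite,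
  being bounded by \<open>n s\<^sub>0\<close>, so \<open>Max\<close> is a true maximum whenever \<open>\<Omega> \<noteq> {}\<close>.
\<close>

definition metivier_index :: "('m \<Rightarrow> real^'n \<Rightarrow> real^'n) \<Rightarrow> (real^'n) set \<Rightarrow> nat" where
  "metivier_index X \<Omega> = Max (pointwise_hom_dim X ` closure \<Omega>)"

text \<open>
  \<open>C\<^sub>0\<^sup>1(\<Omega>)\<close>: continuously differentiable with compact support in \<open>\<Omega>\<close>. Such functions are
  represented on the whole space by their extension by zero.
\<close>

definition C01 :: "(real^'n) set \<Rightarrow> (real^'n \<Rightarrow> real) set" where
  "C01 \<Omega> = {f. Ck_on 1 \<Omega> f \<and> {x. f x \<noteq> 0} \<subset>\<subset> \<Omega>}"

definition test_fields :: "(real^'n) set \<Rightarrow> (real^'n \<Rightarrow> real^'m) set" where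
  "test_fields \<Omega> =
     {\<phi>. (\<forall>j. (\<lambda>x. \<phi> x $ j) \<in> C01 \<Omega>) \<and> (\<forall>x\<in>\<Omega>. sqrt (\<Sum>j\<in>UNIV. \<bar>\<phi> x $ j\<bar>\<^sup>2) \<le> 1)}"

text \<open>Extended-real valued, since the supremum is infinite for sets of infinite perimeter.\<close>

definition X_perimeter ::
  "('m::finite \<Rightarrow> real^'n \<Rightarrow> real^'n) \<Rightarrow> (real^'n) set \<Rightarrow> (real^'n) set \<Rightarrow> ereal" where
  "X_perimeter X E \<Omega> =
     (SUP \<phi> \<in> (test_fields \<Omega> :: (real^'n \<Rightarrow> real^'m) set).
        ereal (LINT x:E|lebesgue. (\<Sum>j\<in>UNIV. vf_adjoint (X j) (\<lambda>y. \<phi> y $ j) x)))"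

text \<open>
  An open set has \<open>C\<^sup>1\<close> boundary if, near each boundary point, it is the part of a ball lying
  strictly on one side (\<open>\<sigma> = 1\<close>: above, \<open>\<sigma> = -1\<close>: below) of the graph of a \<open>C\<^sup>1\<close> function
  \<open>\<gamma>\<close> of the \<open>n - 1\<close> coordinates other than some \<open>x\<^sub>k\<close>. Here \<open>\<gamma>\<close> is a function on the whole
  space that does not depend on the \<open>k\<close>-th coordinate.
\<close>

definition C1_boundary :: "(real^'n) set \<Rightarrow> bool" where
  "C1_boundary E \<longleftrightarrow>
     (\<forall>p\<in>frontier E. \<exists>r>0. \<exists>k. \<exists>\<sigma>\<in>{1, -1::real}. \<exists>\<gamma>::real^'n \<Rightarrow> real.
        Ck_on 1 UNIV \<gamma> \<and>
        (\<forall>x y. (\<forall>i. i \<noteq> k \<longrightarrow> x $ i = y $ i) \<longrightarrow> \<gamma> x = \<gamma> y) \<and>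
        E \<inter> ball p r = {x \<in> ball p r. \<sigma> * (x $ k - \<gamma> x) > 0})"

end

theory Submission
  imports Defs
begin

text \<open>
  Moving \<open>E\<close> along the flow of a horizontal field for a time \<open>t\<close> pushes out of \<open>E\<close> at most \<open>t P\<close> of its
  volume, where \<open>P = P\<^sub>X(E;\<Omega>)\<close>, up to a factor \<open>exp (C t)\<close>: test the perimeter with a cutoff function
  composed with the flow. The same holds for finite chains of flows.

  Near \<open>x\<^sub>0\<close> choose iterated commutators of lengths \<open>d\<^sub>1, \<dots>, d\<^sub>n\<close>, with \<open>d\<^sub>1 + \<dots> + d\<^sub>n = \<nu>(x\<^sub>0)\<close>, whose
  values at \<open>x\<^sub>0\<close> form a basis. Commutators of flows with all times but one equal to \<open>\<plusminus>r\<close> produce chains of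
  total time \<open>O(r)\<close>, depending on \<open>s\<close> in the box of sides \<open>r\<^bsup>d\<^sub>k\<^esup>\<close>, whose end points are bi-Lipschitz in \<open>s\<close>
  uniformly in \<open>r\<close>. So a random such chain lands in \<open>E\<close> with probability at most \<open>C |E| / r\<^bsup>\<nu>\<^esup>\<close>, and
  averaging gives \<open>|E \<inter> W| \<le> C (r P + |E|\<^sup>2 / r\<^bsup>\<nu>\<^esup>)\<close> for a neighbourhood \<open>W\<close> of \<open>x\<^sub>0\<close>. The same family shows that
  accessible sets are open, so every point can be moved out of \<open>\<Omega>\<close> and \<open>|E| \<le> C P\<close>. Both estimates
  sum over a finite cover of the closure of \<open>\<Omega>\<close>; choosing \<open>r\<close> with \<open>r\<^bsup>\<nu>\<^esup>\<close> a suitable multiple of \<open>|E|\<close> gives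
  the inequality for small \<open>|E|\<close>, and the second estimate covers the rest.
\<close>

section \<open>Calculus of \<open>C\<^sup>k\<close> functions\<close>

text \<open>The square of |E| arises from two ways of reading one double integral. For each
  parameter, the chain carries into \<open>E \<inter> W\<close> a part of E whose volume is almost
  that of \<open>E \<inter> W\<close>, up to rP. Each single point of E is carried into E only for
  parameters in a set of measure at most C |E|; integrating this over the points of E gives the
  second factor |E|. The exponent is a balance: r^nu comparable to |E| leaves |E| \<le> C |E|^(1/nu)
  P. Only radii below a fixed bound are available, so large |E| needs its own estimate; and r \<le>
  1 lets the maximal dimension replace the one at each point. The obstacle is uniformity as r tends
  to 0. Truncating the fields makes their flows global, but of finite class, and brackets can be
  iterated only near \<open>closure \<Omega>\<close>. Therefore the end points are differentiated in
  the parameters: the resulting velocities are push-forwards of fields, and these expand in brackets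
  with remainders that have to be small merely in size. For two starting points a Lipschitz
  comparison is enough. E itself enters through integrals over it of C^1 functions.\<close>

lemma frechet_derivative_eqI: "(f has_derivative f') (at x) \<Longrightarrow> frechet_derivative f (at x) = f'"
  using frechet_derivative_at by metis

lemma has_derivative_frechet: "f differentiable (at x) \<Longrightarrow> (f has_derivative frechet_derivative f (at x)) (at x)"
  by (simp add: frechet_derivative_works)

lemma frechet_derivative_cong_open:
  assumes "open S" "x \<in> S" "\<And>y. y \<in> S \<Longrightarrow> f y = g y"
  shows "frechet_derivative f (at x) = frechet_derivative g (at x)"
    and "f differentiable (at x) \<longleftrightarrow> g differentiable (at x)"
proof -
  have "(f has_derivative d) (at x) \<longleftrightarrow> (g has_derivative d) (at x)" for d
    using assms by (metis has_derivative_transform_within_open)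
  then show "frechet_derivative f (at x) = frechet_derivative g (at x)"
    and "f differentiable (at x) \<longleftrightarrow> g differentiable (at x)"
    by (simp_all add: frechet_derivative_def differentiable_def)
qed

text \<open>\<open>frechet_derivative\<close> is a choice operator, so its values have to be
  computed pointwise. This rule lets the inductions below replace it by the explicit sum or product
  formula that holds on the open set.\<close>

lemma Ck_on_cong_open:
  assumes "open S" "\<And>y. y \<in> S \<Longrightarrow> f y = g y" "Ck_on k S f"
  shows "Ck_on k S g"
  using assms(2,3)
proof (induction k arbitrary: f g)
  case 0
  then show ?case by (simp cong: continuous_on_cong)
next
  case (Suc k)
  have "Ck_on k S (\<lambda>x. frechet_derivative g (at x) v)" for v
    using Suc.IH[of "\<lambda>x. frechet_derivative f (at x) v" "\<lambda>x. frechet_derivative g (at x) v"]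
      frechet_derivative_cong_open(1)[OF assms(1), of _ f g] Suc.prems by auto
  then show ?case
    using Suc.prems frechet_derivative_cong_open(2)[OF assms(1), of _ f g] by auto
qed

lemma Ck_on_SucD:
  assumes "Ck_on (Suc k) S f"
  shows "Ck_on k S f"
  using assms
proof (induction k arbitrary: f)
  case 0
  then show ?case
    by (simp add: continuous_at_imp_continuous_on differentiable_imp_continuous_within)
next
  case (Suc k)
  then show ?case by (meson Ck_on.simps(2))
qed

lemma Ck_on_antimono: "Ck_on k S f \<Longrightarrow> j \<le> k \<Longrightarrow> Ck_on j S f"
  by (induction k) (auto simp: le_Suc_eq simp del: Ck_on.simps dest: Ck_on_SucD)

lemma Ck_on_continuous_on: "Ck_on k S f \<Longrightarrow> continuous_on S f"
  using Ck_on_antimono[of k S f 0] by simp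

lemma Ck_on_subset: "Ck_on k T f \<Longrightarrow> S \<subseteq> T \<Longrightarrow> Ck_on k S f"
  by (induction k arbitrary: f) (auto intro: continuous_on_subset)

text \<open>Glues the regularity of a truncated field, which is a product of C^k maps on one open
  set and zero on another.\<close>

lemma Ck_on_Un:
  assumes "open S" "open T" "Ck_on k S f" "Ck_on k T f"
  shows "Ck_on k (S \<union> T) f"
  using assms(3,4)
  by (induction k arbitrary: f) (auto intro: continuous_on_open_Un assms)

lemma Ck_on_const [simp]: "Ck_on k S (\<lambda>x. c)"
  by (induction k arbitrary: c) auto

lemma Ck_on_linear:
  assumes "open S" "bounded_linear h" "Ck_on k S f"
  shows "Ck_on k S (\<lambda>x. h (f x))"
  using assms(3)
proof (induction k arbitrary: f)
  case 0
  then show ?case by (simp add: bounded_linear.continuous_on[OF assms(2)])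
next
  case (Suc k)
  have d: "((\<lambda>x. h (f x)) has_derivative (\<lambda>v. h (frechet_derivative f (at x) v))) (at x)"
    if "x \<in> S" for x
    using Suc.prems that bounded_linear.has_derivative[OF assms(2) has_derivative_frechet] by auto
  have "Ck_on k S (\<lambda>x. h (frechet_derivative f (at x) v))" for v
    using Suc.prems by (intro Suc.IH) auto
  then have "Ck_on k S (\<lambda>x. frechet_derivative (\<lambda>x. h (f x)) (at x) v)" for v
    by (rule Ck_on_cong_open[OF assms(1), rotated]) (simp add: frechet_derivative_eqI[OF d])
  then show ?case using d by (auto simp: differentiable_def)
qed

lemma Ck_on_add:
  assumes "open S" "Ck_on k S f" "Ck_on k S g"
  shows "Ck_on k S (\<lambda>x. f x + g x)"
  using assms(2,3)
proof (induction k arbitrary: f g)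
  case 0
  then show ?case by (simp add: continuous_on_add)
next
  case (Suc k)
  have d: "((\<lambda>x. f x + g x) has_derivative
      (\<lambda>v. frechet_derivative f (at x) v + frechet_derivative g (at x) v)) (at x)"
    if "x \<in> S" for x
    using Suc.prems that by (intro has_derivative_add has_derivative_frechet) auto
  have "Ck_on k S (\<lambda>x. frechet_derivative f (at x) v + frechet_derivative g (at x) v)" for v
    using Suc.prems by (intro Suc.IH) auto
  then have "Ck_on k S (\<lambda>x. frechet_derivative (\<lambda>x. f x + g x) (at x) v)" for v
    by (rule Ck_on_cong_open[OF assms(1), rotated]) (simp add: frechet_derivative_eqI[OF d])
  then show ?case using d by (auto simp: differentiable_def)
qed

lemma Ck_on_sum:
  assumes "open S" "\<And>i. i \<in> I \<Longrightarrow> Ck_on k S (f i)"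
  shows "Ck_on k S (\<lambda>x. \<Sum>i\<in>I. f i x)"
  using assms(2)
  by (induction I rule: infinite_finite_induct) (auto intro: Ck_on_add assms(1))

text \<open>Done once for a general bilinear map, with products, scalings and inner products as
  instances. The induction hypothesis covers both terms of the product rule because a C^(k+1)
  function is also C^k.\<close>

lemma Ck_on_bilinear:
  assumes "open S" "bounded_bilinear h" "Ck_on k S f" "Ck_on k S g"
  shows "Ck_on k S (\<lambda>x. h (f x) (g x))"
  using assms(3,4)
proof (induction k arbitrary: f g)
  case 0
  then show ?case by (simp add: bounded_bilinear.continuous_on[OF assms(2)])
next
  case (Suc k)
  have d: "((\<lambda>x. h (f x) (g x)) has_derivative
      (\<lambda>v. h (f x) (frechet_derivative g (at x) v) + h (frechet_derivative f (at x) v) (g x))) (at x)"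
    if "x \<in> S" for x
    using Suc.prems that by (intro bounded_bilinear.FDERIV[OF assms(2)] has_derivative_frechet) auto
  have "Ck_on k S (\<lambda>x. h (f x) (frechet_derivative g (at x) v) + h (frechet_derivative f (at x) v) (g x))" for v
    using Suc.prems Suc.prems[THEN Ck_on_SucD] by (intro Ck_on_add Suc.IH assms(1)) auto
  then have "Ck_on k S (\<lambda>x. frechet_derivative (\<lambda>x. h (f x) (g x)) (at x) v)" for v
    by (rule Ck_on_cong_open[OF assms(1), rotated]) (simp add: frechet_derivative_eqI[OF d])
  then show ?case using d by (auto simp: differentiable_def)
qed

lemmas Ck_on_mult = Ck_on_bilinear[OF _ bounded_bilinear_mult]
lemmas Ck_on_scaleR = Ck_on_bilinear[OF _ bounded_bilinear_scaleR]
lemmas Ck_on_uminus = Ck_on_linear[OF _ bounded_linear_minus[OF bounded_linear_ident]]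

lemma Ck_on_diff:
  "open S \<Longrightarrow> Ck_on k S f \<Longrightarrow> Ck_on k S g \<Longrightarrow> Ck_on k S (\<lambda>x. f x - g x)"
  using Ck_on_add[of S k f "\<lambda>x. - g x"] Ck_on_uminus[of S k g] by simp

lemma Ck_on_ident: "open S \<Longrightarrow> Ck_on k S (\<lambda>x. x)"
  by (cases k) auto

text \<open>\<open>Ck_on\<close> controls derivatives in fixed directions only. Expanding in the
  basis reduces a direction that varies with the point to finitely many fixed ones.\<close>

lemma frechet_derivative_basis_sum:
  assumes "f differentiable (at x)"
  shows "frechet_derivative f (at x) v = (\<Sum>b\<in>Basis. (v \<bullet> b) *\<^sub>R frechet_derivative f (at x) b)"
proof -
  have l: "linear (frechet_derivative f (at x))"
    using assms linear_frechet_derivative by blast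
  have "frechet_derivative f (at x) v = frechet_derivative f (at x) (\<Sum>b\<in>Basis. (v \<bullet> b) *\<^sub>R b)"
    by (simp add: euclidean_representation)
  then show ?thesis by (simp add: linear_sum[OF l] linear_cmul[OF l])
qed

lemma Ck_on_frechet_derivative:
  assumes "open S" "Ck_on (Suc k) S f" "Ck_on k S v"
  shows "Ck_on k S (\<lambda>x. frechet_derivative f (at x) (v x))"
proof (rule Ck_on_cong_open[OF assms(1)])
  show "Ck_on k S (\<lambda>x. \<Sum>b\<in>Basis. (v x \<bullet> b) *\<^sub>R frechet_derivative f (at x) b)"
    using assms by (intro Ck_on_sum Ck_on_scaleR Ck_on_linear[OF _ bounded_linear_inner_left]) auto
  show "(\<Sum>b\<in>Basis. (v y \<bullet> b) *\<^sub>R frechet_derivative f (at y) b) = frechet_derivative f (at y) (v y)"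
    if "y \<in> S" for y
    using frechet_derivative_basis_sum[of f y "v y"] assms(2) that by simp
qed

lemma smooth_on_imp_Ck_on: "smooth_on S f \<Longrightarrow> Ck_on k S f"
  by (simp add: smooth_on_def)

lemma smooth_on_subset: "smooth_on T f \<Longrightarrow> S \<subseteq> T \<Longrightarrow> smooth_on S f"
  by (auto simp: smooth_on_def intro: Ck_on_subset)

lemma smooth_on_cong_open:
  "open S \<Longrightarrow> (\<And>y. y \<in> S \<Longrightarrow> f y = g y) \<Longrightarrow> smooth_on S f \<Longrightarrow> smooth_on S g"
  by (auto simp: smooth_on_def intro: Ck_on_cong_open)

lemma smooth_on_differentiable: "smooth_on S f \<Longrightarrow> x \<in> S \<Longrightarrow> f differentiable (at x)"
  using smooth_on_imp_Ck_on[of S f "Suc 0"] by simp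

lemma smooth_on_continuous_on: "smooth_on S f \<Longrightarrow> continuous_on S f"
  using smooth_on_imp_Ck_on[of S f 0] by simp

text \<open>Coordinate-free form of \<open>commutator\<close>, with the same sign convention, for
  maps on any Euclidean space; the two agree where both fields are differentiable.\<close>

definition lie_bracket :: "('a::euclidean_space \<Rightarrow> 'a) \<Rightarrow> ('a \<Rightarrow> 'a) \<Rightarrow> 'a \<Rightarrow> 'a" where
  "lie_bracket Y Z x = frechet_derivative Z (at x) (Y x) - frechet_derivative Y (at x) (Z x)"

lemma smooth_on_lie_bracket:
  assumes "open S" "smooth_on S Y" "smooth_on S Z"
  shows "smooth_on S (lie_bracket Y Z)"
  unfolding smooth_on_def
proof
  fix k
  show "Ck_on k S (lie_bracket Y Z)"
    unfolding lie_bracket_def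
    using assms by (intro Ck_on_diff Ck_on_frechet_derivative) (auto simp: smooth_on_def)
qed

lemma lie_bracket_cong_open:
  assumes "open S" "x \<in> S" "\<And>y. y \<in> S \<Longrightarrow> Y y = Y' y" "\<And>y. y \<in> S \<Longrightarrow> Z y = Z' y"
  shows "lie_bracket Y Z x = lie_bracket Y' Z' x"
  unfolding lie_bracket_def
  using frechet_derivative_cong_open(1)[OF assms(1,2), of Y Y'] frechet_derivative_cong_open(1)[OF assms(1,2), of Z Z'] assms
  by simp

lemma frechet_derivative_component:
  fixes f :: "'a::euclidean_space \<Rightarrow> real^'n"
  assumes "f differentiable (at x)"
  shows "frechet_derivative (\<lambda>y. f y $ k) (at x) v = frechet_derivative f (at x) v $ k"
  by (rule fun_cong[OF frechet_derivative_eqI])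
    (rule bounded_linear.has_derivative[OF bounded_linear_vec_nth has_derivative_frechet[OF assms]])

lemma commutator_eq_lie_bracket:
  assumes "Y differentiable (at x)" "Z differentiable (at x)"
  shows "commutator Y Z x = lie_bracket Y Z x"
  by (simp add: vec_eq_iff commutator_def lie_bracket_def vf_apply_def
      frechet_derivative_component[OF assms(1)] frechet_derivative_component[OF assms(2)])

lemma iter_commutator_Cons:
  "w \<noteq> [] \<Longrightarrow> iter_commutator X (i # w) = commutator (X i) (iter_commutator X w)"
  by (cases w) auto

lemma smooth_on_iter_commutator:
  assumes "open S" "\<And>j. smooth_on S (X j)"
  shows "smooth_on S (iter_commutator X w)"
proof (induction w)
  case Nil
  then show ?case by (simp add: smooth_on_def)
next
  case (Cons i w)
  show ?case
  proof (cases "w = []")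
    case False
    have "commutator (X i) (iter_commutator X w) x = lie_bracket (X i) (iter_commutator X w) x" if "x \<in> S" for x
      using that Cons assms by (intro commutator_eq_lie_bracket smooth_on_differentiable[of S]) auto
    then show ?thesis
      using smooth_on_lie_bracket[OF assms(1,2) Cons, of i] False
      by (auto simp: iter_commutator_Cons intro: smooth_on_cong_open[OF assms(1)])
  qed (simp add: assms)
qed

section \<open>Cutoff functions\<close>

text \<open>The truncated power is a bump ingredient of finite class whose derivative is again a
  truncated power, which suits induction on the class. At 0 the difference quotient is at most
  \<open>\<bar>h\<bar> ^ Suc m\<close>.\<close>

lemma DERIV_max_0_power:
  "((\<lambda>s. max 0 s ^ Suc (Suc m)) has_real_derivative real (Suc (Suc m)) * max 0 s ^ Suc m) (at s)"
proof -
  consider "s > 0" | "s < 0" | "s = 0" by linarith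
  then show ?thesis
  proof cases
    case 1
    have "((\<lambda>s. s ^ Suc (Suc m)) has_real_derivative real (Suc (Suc m)) * s ^ Suc m) (at s)"
      by (rule derivative_eq_intros refl | simp)+
    then have "((\<lambda>s. s ^ Suc (Suc m)) has_real_derivative real (Suc (Suc m)) * max 0 s ^ Suc m) (at s)"
      using 1 by (simp add: max_def)
    then show ?thesis
      by (rule has_field_derivative_transform_within_open[where S = "{0<..}"]) (use 1 in auto)
  next
    case 2
    have "((\<lambda>s. 0) has_real_derivative real (Suc (Suc m)) * max 0 s ^ Suc m) (at s)"
      using 2 by (simp add: max_def)
    then show ?thesis
      by (rule has_field_derivative_transform_within_open[where S = "{..<0}"]) (use 2 in auto)
  next
    case 3
    have "norm (max 0 h ^ Suc (Suc m) / h) \<le> \<bar>h\<bar> ^ Suc m" for h :: real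
    proof (cases "h > 0")
      case False
      then have "norm (max 0 h ^ Suc (Suc m) / h) = 0" by simp
      then show ?thesis by (metis abs_ge_zero zero_le_power)
    qed simp
    then have ev: "\<forall>\<^sub>F h in at 0. norm (max 0 h ^ Suc (Suc m) / h) \<le> \<bar>h\<bar> ^ Suc m"
      by (intro always_eventually allI)
    have "((\<lambda>h::real. \<bar>h\<bar> ^ Suc m) \<longlongrightarrow> \<bar>0\<bar> ^ Suc m) (at 0)"
      by (intro tendsto_intros)
    then have "((\<lambda>h::real. max 0 h ^ Suc (Suc m) / h) \<longlongrightarrow> 0) (at 0)"
      by (intro Lim_null_comparison[OF ev]) (simp only: abs_zero power_0_Suc)
    then show ?thesis using 3 by (simp add: DERIV_def)
  qed
qed

lemma Ck_on_max_0_power: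
  fixes f :: "'a::euclidean_space \<Rightarrow> real"
  assumes "open S" "Ck_on k S f" "k \<le> m"
  shows "Ck_on k S (\<lambda>x. max 0 (f x) ^ Suc m)"
  using assms(2,3)
proof (induction k arbitrary: m)
  case 0
  then show ?case by (auto intro!: continuous_intros simp del: power_Suc)
next
  case (Suc k)
  then obtain m' where m: "m = Suc m'" "k \<le> m'" by (cases m) auto
  have d: "((\<lambda>x. max 0 (f x) ^ Suc m) has_derivative
      (\<lambda>v. real (Suc m) * max 0 (f x) ^ m * frechet_derivative f (at x) v)) (at x)" if "x \<in> S" for x
  proof -
    have "(f has_derivative frechet_derivative f (at x)) (at x)"
      using Suc.prems that by (intro has_derivative_frechet) auto
    from has_derivative_compose[OF this DERIV_max_0_power[of m' "f x", unfolded has_field_derivative_def]]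
    show ?thesis by (simp only: m)
  qed
  have "Ck_on k S (\<lambda>x. real (Suc m) * max 0 (f x) ^ m * frechet_derivative f (at x) v)" for v
    using Suc.IH[OF Ck_on_SucD[OF Suc.prems(1)] m(2)] Suc.prems(1) m(1)
    by (intro Ck_on_mult Ck_on_const assms(1)) auto
  then have "Ck_on k S (\<lambda>x. frechet_derivative (\<lambda>x. max 0 (f x) ^ Suc m) (at x) v)" for v
    by (rule Ck_on_cong_open[OF assms(1), rotated]) (simp only: frechet_derivative_eqI[OF d])
  then show ?case using d by (auto simp: differentiable_def)
qed

text \<open>On finitely many balls covering \<open>K\<close>, truncated powers of squared radius
  minus squared distance add up to a function \<open>S\<close> that is positive on \<open>K\<close>.
  Truncating once more, at half the minimum of \<open>S\<close> over \<open>K\<close>, gives a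
  function equal to 1 near \<open>K\<close> that still vanishes wherever \<open>S\<close>
  does.\<close>

lemma Ck_on_cutoff:
  fixes K U :: "'a::euclidean_space set"
  assumes "compact K" "open U" "K \<subseteq> U"
  obtains \<rho> :: "'a \<Rightarrow> real" and V where "Ck_on k UNIV \<rho>" "\<And>x. 0 \<le> \<rho> x" "\<And>x. \<rho> x \<le> 1"
    "open V" "K \<subseteq> V" "V \<subseteq> U" "\<And>x. x \<in> V \<Longrightarrow> \<rho> x = 1" "{x. \<rho> x \<noteq> 0} \<subset>\<subset> U"
proof (cases "K = {}")
  case True
  show ?thesis
    by (rule that[of "\<lambda>x. 0" "{}"]) (use True in \<open>auto simp: compactly_contained_def\<close>)
next
  case False
  have "\<forall>a\<in>K. \<exists>r>0. cball a r \<subseteq> U"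
    using assms open_contains_cball by (metis subset_eq)
  then obtain r where r: "\<And>a. a \<in> K \<Longrightarrow> r a > 0 \<and> cball a (r a) \<subseteq> U" by metis
  obtain A where A: "A \<subseteq> K" "finite A" "K \<subseteq> (\<Union>a\<in>A. ball a (r a))"
    using compactE_image[OF assms(1), of K "\<lambda>a. ball a (r a)"] r by force
  define S where "S x = (\<Sum>a\<in>A. max 0 ((r a)\<^sup>2 - (x - a) \<bullet> (x - a)) ^ Suc k)" for x
  have CS: "Ck_on k UNIV S"
    unfolding S_def
    by (intro Ck_on_sum Ck_on_max_0_power Ck_on_diff Ck_on_const Ck_on_ident
        Ck_on_bilinear[OF _ bounded_bilinear_inner]) auto
  have Snn: "S x \<ge> 0" for x unfolding S_def by (intro sum_nonneg) auto
  have lt: "(r a)\<^sup>2 - (x - a) \<bullet> (x - a) > 0 \<longleftrightarrow> x \<in> ball a (r a)" if "a \<in> A" for a x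
  proof -
    have "r a > 0" using that A r by auto
    then show ?thesis
      unfolding power2_norm_eq_inner[symmetric] mem_ball dist_norm norm_minus_commute[of a]
      by (auto intro: power2_less_imp_less power_strict_mono)
  qed
  have Spos: "S x > 0" if "x \<in> K" for x
  proof -
    obtain a where a: "a \<in> A" "x \<in> ball a (r a)" using \<open>x \<in> K\<close> A(3) by blast
    then have "0 < max 0 ((r a)\<^sup>2 - (x - a) \<bullet> (x - a)) ^ Suc k" using lt[of a x] by simp
    then show ?thesis unfolding S_def using a A(2) by (intro sum_pos2[of A a]) auto
  qed
  have S0: "x \<in> (\<Union>a\<in>A. cball a (r a))" if Sx: "S x \<noteq> 0" for x
  proof -
    obtain a where "a \<in> A" "max 0 ((r a)\<^sup>2 - (x - a) \<bullet> (x - a)) ^ Suc k \<noteq> 0"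
      by (rule sum.not_neutral_contains_not_neutral[OF Sx[unfolded S_def]])
    then have "max 0 ((r a)\<^sup>2 - (x - a) \<bullet> (x - a)) \<noteq> 0" using power_0_Suc by fastforce
    then have "(r a)\<^sup>2 - (x - a) \<bullet> (x - a) > 0" by linarith
    then show ?thesis using \<open>a \<in> A\<close> lt[of a x] by (intro UN_I[of a]) auto
  qed
  obtain z where z: "z \<in> K" "\<And>x. x \<in> K \<Longrightarrow> S z \<le> S x"
    using continuous_attains_inf[OF assms(1) False continuous_on_subset[OF Ck_on_continuous_on[OF CS]]] by auto
  define c where "c = S z"
  have c: "c > 0" using z Spos by (simp add: c_def)
  define \<rho> where "\<rho> x = 1 - max 0 (1 - (2 / c) * S x) ^ Suc k" for x
  have "Ck_on k UNIV \<rho>"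
    unfolding \<rho>_def
    by (intro Ck_on_diff Ck_on_max_0_power Ck_on_const Ck_on_mult CS) auto
  moreover have "0 \<le> \<rho> x" "\<rho> x \<le> 1" for x
  proof -
    have "2 / c * S x \<ge> 0" using Snn c by simp
    then have "max 0 (1 - 2 / c * S x) \<le> 1" by linarith
    from power_le_one[OF _ this, of "Suc k"] show "0 \<le> \<rho> x" by (simp add: \<rho>_def)
    show "\<rho> x \<le> 1" unfolding \<rho>_def
      using zero_le_power[of "max 0 (1 - 2 / c * S x)" "Suc k"] by linarith
  qed
  moreover have "open {x. c / 2 < S x}"
    using Ck_on_continuous_on[OF CS] by (intro open_Collect_less) auto
  moreover have "K \<subseteq> {x. c / 2 < S x}" using z(2) c by (force simp: c_def)
  moreover have sub: "{x. c / 2 < S x} \<subseteq> U"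
  proof
    fix x assume "x \<in> {x. c / 2 < S x}"
    then have "S x \<noteq> 0" using c by auto
    from S0[OF this] show "x \<in> U" using A(1) r by blast
  qed
  moreover have "\<rho> x = 1" if "x \<in> {x. c / 2 < S x}" for x
  proof -
    have "1 - 2 / c * S x \<le> 0" using that c by (simp add: field_simps)
    then have "max 0 (1 - 2 / c * S x) = 0" by linarith
    then show ?thesis by (simp add: \<rho>_def)
  qed
  moreover have "{x. \<rho> x \<noteq> 0} \<subset>\<subset> U"
  proof -
    have cp: "compact (\<Union>a\<in>A. cball a (r a))" using A by (intro compact_UN) auto
    have "{x. \<rho> x \<noteq> 0} \<subseteq> (\<Union>a\<in>A. cball a (r a))"
    proof
      fix x assume "x \<in> {x. \<rho> x \<noteq> 0}"
      then have "S x \<noteq> 0" by (auto simp: \<rho>_def)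
      then show "x \<in> (\<Union>a\<in>A. cball a (r a))" by (rule S0)
    qed
    then have cl: "closure {x. \<rho> x \<noteq> 0} \<subseteq> (\<Union>a\<in>A. cball a (r a))"
      using closure_minimal compact_imp_closed[OF cp] by blast
    show ?thesis unfolding compactly_contained_def
    proof
      show "compact (closure {x. \<rho> x \<noteq> 0})"
        using cl cp compact_Int_closed[OF cp closed_closure] by (metis inf.absorb2)
      show "closure {x. \<rho> x \<noteq> 0} \<subseteq> U" using cl A(1) r by blast
    qed
  qed
  ultimately show ?thesis using that by blast
qed

lemma eq_0_off_closure: "x \<notin> closure {x. f x \<noteq> 0} \<Longrightarrow> f x = 0"
  by (meson closure_subset mem_Collect_eq subsetD)

lemma C1_comp:
  fixes f :: "'b::euclidean_space \<Rightarrow> 'c::euclidean_space" and g :: "'a::euclidean_space \<Rightarrow> 'b"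
  assumes f: "Ck_on 1 UNIV f"
    and g: "\<And>x. (g has_derivative g' x) (at x)" "\<And>h. continuous_on UNIV (\<lambda>x. g' x h)"
  shows "Ck_on 1 UNIV (\<lambda>x. f (g x))"
proof -
  have gc: "continuous_on UNIV g"
    using g(1) by (meson continuous_at_imp_continuous_on has_derivative_continuous)
  have d: "((\<lambda>x. f (g x)) has_derivative (\<lambda>v. frechet_derivative f (at (g x)) (g' x v))) (at x)" for x
    using f by (intro has_derivative_compose[OF g(1)] has_derivative_frechet) auto
  have "continuous_on UNIV (\<lambda>x. \<Sum>b\<in>Basis. (g' x v \<bullet> b) *\<^sub>R frechet_derivative f (at (g x)) b)" for v
    using f continuous_on_compose2[OF _ gc]
    by (intro continuous_intros g(2)) auto
  then have "continuous_on UNIV (\<lambda>x. frechet_derivative f (at (g x)) (g' x v))" for v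
    using f by (subst frechet_derivative_basis_sum) auto
  then show ?thesis using d by (auto simp: differentiable_def frechet_derivative_eqI[OF d])
qed

text \<open>Applied to a truncated field and then to its directional derivatives, this produces the
  bounds that \<open>C11_field\<close> asks for.\<close>

lemma C1_compact_support_bounds:
  fixes f :: "'a::euclidean_space \<Rightarrow> 'b::euclidean_space"
  assumes f: "Ck_on 1 UNIV f" and K: "compact K" "\<And>x. x \<notin> K \<Longrightarrow> f x = 0"
  obtains L where "L \<ge> 0" "\<And>x. norm (f x) \<le> L" "\<And>x h. norm (frechet_derivative f (at x) h) \<le> L * norm h"
    "\<And>x y. norm (f x - f y) \<le> L * norm (x - y)"
proof -
  have bd: "\<exists>B\<ge>0. \<forall>x. norm (g x) \<le> B" if "continuous_on UNIV g" "\<And>x. x \<notin> K \<Longrightarrow> g x = 0" for g :: "'a \<Rightarrow> 'b"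
  proof -
    have "bounded (g ` K)"
      using that K compact_continuous_image compact_imp_bounded continuous_on_subset by (metis subset_UNIV)
    then obtain B where "\<forall>x\<in>K. norm (g x) \<le> B" by (auto simp: bounded_iff)
    then show ?thesis using that(2) by (intro exI[of _ "max 0 B"]) (metis max.cobounded1 max.coboundedI2 norm_zero)
  qed
  have z: "frechet_derivative f (at x) h = 0" if "x \<notin> K" for x h
    using frechet_derivative_cong_open(1)[of "-K" x f "\<lambda>x. 0"] that K by (simp add: open_Compl compact_imp_closed)
  obtain B0 where B0: "B0 \<ge> 0" "\<And>x. norm (f x) \<le> B0"
    using bd[of f] K f Ck_on_continuous_on by metis
  have "\<forall>b. \<exists>B\<ge>0. \<forall>x. norm (frechet_derivative f (at x) b) \<le> B"
    using f z by (auto intro!: bd)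
  then obtain B where B: "\<And>b. B b \<ge> 0" "\<And>b x. norm (frechet_derivative f (at x) b) \<le> B b" by metis
  define L where "L = B0 + (\<Sum>b\<in>Basis. B b)"
  have s: "(\<Sum>b\<in>Basis. B b) \<ge> 0" using B by (intro sum_nonneg) auto
  have d: "norm (frechet_derivative f (at x) h) \<le> L * norm h" for x h
  proof -
    have "norm (frechet_derivative f (at x) h) = norm (\<Sum>b\<in>Basis. (h \<bullet> b) *\<^sub>R frechet_derivative f (at x) b)"
      using f by (subst frechet_derivative_basis_sum) auto
    also have "\<dots> \<le> (\<Sum>b\<in>Basis. norm h * B b)"
      using B Basis_le_norm[of _ h] by (intro sum_norm_le) (auto intro!: mult_mono)
    also have "\<dots> \<le> L * norm h" using B0(1) by (simp add: L_def sum_distrib_left[symmetric] distrib_right)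
    finally show ?thesis .
  qed
  have lip: "norm (f x - f y) \<le> L * norm (x - y)" for x y
  proof (rule differentiable_bound[of UNIV f "\<lambda>x. frechet_derivative f (at x)"])
    show "onorm (frechet_derivative f (at x)) \<le> L" for x
      using d by (intro onorm_bound) (use B0 s in \<open>auto simp: L_def\<close>)
  qed (use f in \<open>auto intro!: has_derivative_frechet\<close>)
  show ?thesis by (rule that[of L]) (use d lip B0 s in \<open>auto simp: L_def intro: add_increasing2\<close>)
qed

text \<open>Stands in for the indicator function, with which the perimeter cannot be tested: inner
  regularity gives a compact subset of almost full measure, and a cutoff function is 1
  there.\<close>

lemma C1_approx_indicator:
  fixes S :: "'a::euclidean_space set"
  assumes "open S" "bounded S" "\<epsilon> > 0"
  obtains \<psi> :: "'a \<Rightarrow> real" where "Ck_on 1 UNIV \<psi>" "\<And>x. 0 \<le> \<psi> x" "\<And>x. \<psi> x \<le> 1" "\<And>x. x \<notin> S \<Longrightarrow> \<psi> x = 0"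
    "measure lebesgue S - \<epsilon> \<le> (LINT x:S|lebesgue. \<psi> x)"
proof -
  have lm: "S \<in> lmeasurable" using assms by (simp add: lmeasurable_open)
  obtain K where K: "closed K" "K \<subseteq> S" "S - K \<in> lmeasurable" "emeasure lebesgue (S - K) < ennreal \<epsilon>"
    using sets_lebesgue_inner_closed[of S \<epsilon>] lm assms(3) by (metis fmeasurableD)
  then have cK: "compact K" using assms(2) bounded_subset compact_eq_bounded_closed by blast
  obtain \<psi> :: "'a \<Rightarrow> real" and V where \<psi>: "Ck_on 1 UNIV \<psi>" "\<And>x. 0 \<le> \<psi> x" "\<And>x. \<psi> x \<le> 1"
    "open V" "K \<subseteq> V" "V \<subseteq> S" "\<And>x. x \<in> V \<Longrightarrow> \<psi> x = 1" "{x. \<psi> x \<noteq> 0} \<subset>\<subset> S"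
    by (rule Ck_on_cutoff[OF cK assms(1) K(2), where k = 1]) (rule that)
  have lK: "K \<in> lmeasurable" using cK by (simp add: lmeasurable_compact)
  have "measure lebesgue S - \<epsilon> \<le> measure lebesgue K"
  proof -
    have "measure lebesgue (S - K) = measure lebesgue S - measure lebesgue K"
      using measurable_measure_Diff[of S lebesgue K] lm lK K(2) by auto
    moreover have "measure lebesgue (S - K) < \<epsilon>"
      using K(3,4) assms(3) by (simp add: emeasure_eq_measure2 ennreal_less_iff)
    ultimately show ?thesis by simp
  qed
  also have "\<dots> = (LINT x:K|lebesgue. 1)" using lK by (simp add: set_lebesgue_integral_def)
  also have "\<dots> \<le> (LINT x:S|lebesgue. \<psi> x)"
    unfolding set_lebesgue_integral_def
  proof (rule integral_mono)
    show "integrable lebesgue (\<lambda>x. indicat_real K x *\<^sub>R 1)"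
    proof -
      have "integrable lebesgue (indicat_real K)"
        using lK by (intro integrable_real_indicator) (auto simp: fmeasurable_def)
      then show ?thesis by simp
    qed
    have "continuous_on S \<psi>" using \<psi>(1) Ck_on_continuous_on continuous_on_subset by blast
    then have "(\<lambda>x. indicat_real S x *\<^sub>R \<psi> x) \<in> borel_measurable lborel"
      using borel_measurable_continuous_on_indicator[of S \<psi>] assms(1) by simp
    then have m: "set_borel_measurable lebesgue S \<psi>"
      unfolding set_borel_measurable_def by (rule measurable_completion)
    show "integrable lebesgue (\<lambda>x. indicat_real S x *\<^sub>R \<psi> x)"
      by (rule Bochner_Integration.integrable_bound[of _ "indicat_real S"])
        (use lm m \<psi>(2,3) in \<open>auto simp: fmeasurable_def set_borel_measurable_def indicator_def\<close>)
    show "indicat_real K x *\<^sub>R 1 \<le> indicat_real S x *\<^sub>R \<psi> x" for x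
      using \<psi>(2)[of x] \<psi>(7)[of x] \<psi>(5) K(2) by (auto simp: indicator_def)
  qed
  finally have "measure lebesgue S - \<epsilon> \<le> (LINT x:S|lebesgue. \<psi> x)" .
  moreover have "\<psi> x = 0" if "x \<notin> S" for x
    using that \<psi>(8) by (intro eq_0_off_closure) (auto simp: compactly_contained_def)
  ultimately show ?thesis using that \<psi> by blast
qed

section \<open>Ordinary differential equations\<close>

text \<open>The oriented integral from 0 to \<open>t\<close>, so that one integral equation serves
  both time directions.\<close>

definition int0 :: "(real \<Rightarrow> 'a::euclidean_space) \<Rightarrow> real \<Rightarrow> 'a" where
  "int0 f t = (if 0 \<le> t then integral {0..t} f else - integral {t..0} f)"

lemma int0_0 [simp]: "int0 f 0 = 0"
  by (simp add: int0_def)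

lemma int0_has_vector_derivative:
  assumes "continuous_on UNIV f"
  shows "(int0 f has_vector_derivative f t) (at t)"
proof -
  define N where "N = \<bar>t\<bar> + 1"
  have c: "continuous_on {a..b} f" for a b using assms continuous_on_subset by blast
  have i: "f integrable_on {a..b}" for a b using c by (rule integrable_continuous_real)
  have eq: "integral {-N..s} f - integral {-N..0} f = int0 f s" if "s \<in> {-N<..<N}" for s
  proof (cases "0 \<le> s")
    case True
    then show ?thesis
      using Henstock_Kurzweil_Integration.integral_combine[where a = "-N" and c = 0 and b = s, OF _ True i]
      by (auto simp: int0_def N_def algebra_simps)
  next
    case False
    then show ?thesis
      using that Henstock_Kurzweil_Integration.integral_combine[where a = "-N" and c = s and b = 0, OF _ _ i]
      by (auto simp: int0_def algebra_simps)
  qed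
  have "t \<in> interior {-N..N}" by (auto simp: N_def)
  then have w: "at t within {-N..N} = at t" by (rule at_within_interior)
  have mem: "t \<in> {-N..N}" by (auto simp: N_def)
  have "((\<lambda>u. integral {-N..u} f) has_vector_derivative f t) (at t)"
    using integral_has_vector_derivative[OF c[of "-N" N] mem] unfolding w .
  from has_vector_derivative_diff[OF this has_vector_derivative_const[of "integral {-N..0} f"]]
  have "((\<lambda>u. integral {-N..u} f - integral {-N..0} f) has_vector_derivative f t) (at t)"
    by simp
  then show ?thesis
    by (rule has_vector_derivative_transform_within_open[of _ _ _ "{-N<..<N}"]) (use eq in \<open>auto simp: N_def\<close>)
qed

lemma has_vector_derivative_reflect:
  assumes "(g has_vector_derivative g') (at (- t))"
  shows "((\<lambda>s. g (- s)) has_vector_derivative - g') (at (t::real))"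
proof -
  have "(uminus has_vector_derivative (- 1::real)) (at t)"
    by (auto intro!: derivative_eq_intros)
  from vector_diff_chain_at[OF this assms] show ?thesis by (simp add: o_def)
qed

lemma has_vector_derivative_continuous_on:
  "(\<And>t. (g has_vector_derivative g' t) (at t)) \<Longrightarrow> continuous_on S g"
  by (meson continuous_at_imp_continuous_on has_vector_derivative_continuous)

lemma exp_growth_bound_aux:
  assumes "\<And>t. (g has_vector_derivative g' t) (at t)" "\<And>t. norm (g' t) \<le> C * exp (K * \<bar>t\<bar>)"
    and "K > 0" "C \<ge> 0" "t \<ge> 0"
  shows "norm (g t - g 0) \<le> C / K * exp (K * \<bar>t\<bar>)"
proof (cases "t = 0")
  case False
  have "norm (g t - g 0) \<le> C / K * exp (K * t) - C / K * exp (K * 0)"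
  proof (rule differentiable_bound_general[where f' = g' and \<phi>' = "\<lambda>t. C * exp (K * t)"])
    show "((\<lambda>x. C / K * exp (K * x)) has_vector_derivative C * exp (K * x)) (at x)" for x
      using assms(3) unfolding has_real_derivative_iff_has_vector_derivative[symmetric]
      by (auto intro!: derivative_eq_intros)
    show "continuous_on {0..t} (\<lambda>x. C / K * exp (K * x))" using assms(3) by (intro continuous_intros) auto
    show "norm (g' x) \<le> C * exp (K * x)" if "0 < x" for x using assms(2)[of x] that by simp
  qed (use assms False in \<open>auto intro: has_vector_derivative_continuous_on\<close>)
  also have "\<dots> \<le> C / K * exp (K * \<bar>t\<bar>)" using assms by simp
  finally show ?thesis .
qed (use assms in simp)

lemma exp_growth_bound:
  assumes "\<And>t. (g has_vector_derivative g' t) (at t)" "\<And>t. norm (g' t) \<le> C * exp (K * \<bar>t\<bar>)"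
    and "K > 0" "C \<ge> 0"
  shows "norm (g t - g 0) \<le> C / K * exp (K * \<bar>t\<bar>)"
proof (cases "t \<ge> 0")
  case True
  then show ?thesis using exp_growth_bound_aux[OF assms] by simp
next
  case False
  have "norm (g' (- t)) \<le> C * exp (K * \<bar>t\<bar>)" for t using assms(2)[of "-t"] by simp
  then show ?thesis
    using exp_growth_bound_aux[of "\<lambda>s. g (- s)" "\<lambda>s. - g' (- s)" C K "- t",
        OF has_vector_derivative_reflect[OF assms(1)]] assms False by simp
qed

text \<open>The squared norm is differentiable even where \<open>g\<close> vanishes. The mixed term
  is absorbed by 2 |g| c \<le> |g|^2 + c^2, which accounts for the 1 in \<open>2 * L + 1\<close> and
  for the quantity |g|^2 + c^2 whose damped version decreases.\<close>

lemma gronwall_aux: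
  fixes g :: "real \<Rightarrow> 'a::euclidean_space"
  assumes "\<And>t. (g has_vector_derivative g' t) (at t)"
    and "\<And>s. 0 \<le> s \<Longrightarrow> s \<le> t \<Longrightarrow> norm (g' s) \<le> L * norm (g s) + c"
    and "L \<ge> 0" "c \<ge> 0" "t \<ge> 0"
  shows "(norm (g t))\<^sup>2 \<le> exp ((2 * L + 1) * t) * ((norm (g 0))\<^sup>2 + c\<^sup>2)"
proof -
  define K where "K = 2 * L + 1"
  have "exp (- K * t) * (g t \<bullet> g t + c\<^sup>2) \<le> exp (- K * 0) * (g 0 \<bullet> g 0 + c\<^sup>2)"
  proof (rule DERIV_nonpos_imp_nonincreasing[OF assms(5)])
    fix s assume s: "0 \<le> s" "s \<le> t"
    have "((\<lambda>s. g s \<bullet> g s) has_vector_derivative g s \<bullet> g' s + g' s \<bullet> g s) (at s)"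
      using bounded_bilinear.has_vector_derivative[OF bounded_bilinear_inner assms(1) assms(1)] .
    then have "((\<lambda>s. g s \<bullet> g s) has_real_derivative 2 * (g s \<bullet> g' s)) (at s)"
      by (simp add: has_real_derivative_iff_has_vector_derivative inner_commute)
    then have d: "((\<lambda>s. exp (- K * s) * (g s \<bullet> g s + c\<^sup>2)) has_real_derivative
        exp (- K * s) * (2 * (g s \<bullet> g' s) - K * (g s \<bullet> g s + c\<^sup>2))) (at s)"
      by (auto intro!: derivative_eq_intros simp: algebra_simps)
    have "g s \<bullet> g' s \<le> norm (g s) * (L * norm (g s) + c)"
      using norm_cauchy_schwarz[of "g s" "g' s"] assms(2)[OF s] by (meson mult_left_mono norm_ge_zero order_trans)
    moreover have "2 * (norm (g s) * c) \<le> (norm (g s))\<^sup>2 + c\<^sup>2"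
      using sum_squares_bound[of "norm (g s)" c] by simp
    ultimately have "2 * (g s \<bullet> g' s) \<le> 2 * L * (norm (g s))\<^sup>2 + (norm (g s))\<^sup>2 + c\<^sup>2"
      by (simp add: algebra_simps power2_eq_square)
    moreover have "0 \<le> 2 * L * c\<^sup>2" using assms by simp
    ultimately have "2 * (g s \<bullet> g' s) - K * (g s \<bullet> g s + c\<^sup>2) \<le> 0"
      by (simp add: K_def power2_norm_eq_inner[symmetric] algebra_simps)
    then have "exp (- K * s) * (2 * (g s \<bullet> g' s) - K * (g s \<bullet> g s + c\<^sup>2)) \<le> 0"
      by (simp add: mult_le_0_iff)
    with d show "\<exists>y. ((\<lambda>s. exp (- K * s) * (g s \<bullet> g s + c\<^sup>2)) has_real_derivative y) (at s) \<and> y \<le> 0"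
      by blast
  qed
  then have "g t \<bullet> g t + c\<^sup>2 \<le> exp (K * t) * (g 0 \<bullet> g 0 + c\<^sup>2)"
    by (simp add: exp_minus field_simps)
  then show ?thesis using zero_le_power2[of c] unfolding K_def power2_norm_eq_inner by linarith
qed

lemma gronwall:
  fixes g :: "real \<Rightarrow> 'a::euclidean_space"
  assumes "\<And>t. (g has_vector_derivative g' t) (at t)"
    and "\<And>s. \<bar>s\<bar> \<le> \<bar>t\<bar> \<Longrightarrow> norm (g' s) \<le> L * norm (g s) + c"
    and "L \<ge> 0" "c \<ge> 0"
  shows "norm (g t) \<le> exp ((L + 1) * \<bar>t\<bar>) * (norm (g 0) + c)"
proof -
  have "(norm (g t))\<^sup>2 \<le> exp ((2 * L + 1) * \<bar>t\<bar>) * ((norm (g 0))\<^sup>2 + c\<^sup>2)"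
  proof (cases "t \<ge> 0")
    case True
    then show ?thesis using gronwall_aux[of g g' t L c] assms by simp
  next
    case False
    then show ?thesis
      using gronwall_aux[of "\<lambda>s. g (- s)" "\<lambda>s. - g' (- s)" "- t" L c,
          OF has_vector_derivative_reflect[OF assms(1)]] assms by simp
  qed
  also have "\<dots> \<le> (exp ((L + 1) * \<bar>t\<bar>))\<^sup>2 * (norm (g 0) + c)\<^sup>2"
  proof (rule mult_mono)
    show "exp ((2 * L + 1) * \<bar>t\<bar>) \<le> (exp ((L + 1) * \<bar>t\<bar>))\<^sup>2"
      by (simp add: exp_double[symmetric] algebra_simps)
    show "(norm (g 0))\<^sup>2 + c\<^sup>2 \<le> (norm (g 0) + c)\<^sup>2"
      using assms(4) by (simp add: power2_sum)
  qed auto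
  finally have "(norm (g t))\<^sup>2 \<le> (exp ((L + 1) * \<bar>t\<bar>) * (norm (g 0) + c))\<^sup>2"
    by (simp add: power_mult_distrib)
  then show ?thesis by (rule power2_le_imp_le) (simp add: assms(4))
qed

text \<open>Time-dependent, to cover three equations at once: the flow, its variational equation,
  and the adjoint of the latter. The Lipschitz constant is global and the bound at 0 uniform in
  time, so solutions exist for all times.\<close>

locale lipschitz_ode =
  fixes f :: "real \<Rightarrow> 'a::euclidean_space \<Rightarrow> 'a" and L B :: real
  assumes cont: "continuous_on UNIV (\<lambda>t. f t x)"
    and lip: "norm (f t x - f t y) \<le> L * norm (x - y)"
    and bd: "norm (f t 0) \<le> B"
    and L_pos: "L > 0"
begin

lemma B_nonneg: "B \<ge> 0"
  using bd[of 0] norm_ge_zero order_trans by blast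

lemma continuous_along:
  assumes "continuous_on UNIV \<gamma>"
  shows "continuous_on UNIV (\<lambda>t. f t (\<gamma> t))"
  unfolding continuous_on_def
proof
  fix t0
  have g: "(\<gamma> \<longlongrightarrow> \<gamma> t0) (at t0)" using assms by (simp add: continuous_on_def)
  have "((\<lambda>t. f t (\<gamma> t) - f t (\<gamma> t0)) \<longlongrightarrow> 0) (at t0)"
  proof (rule Lim_null_comparison)
    show "\<forall>\<^sub>F t in at t0. norm (f t (\<gamma> t) - f t (\<gamma> t0)) \<le> L * norm (\<gamma> t - \<gamma> t0)"
      using lip by (intro always_eventually) auto
    show "((\<lambda>t. L * norm (\<gamma> t - \<gamma> t0)) \<longlongrightarrow> 0) (at t0)"
      using g by (auto intro!: tendsto_eq_intros)
  qed
  moreover have "((\<lambda>t. f t (\<gamma> t0)) \<longlongrightarrow> f t0 (\<gamma> t0)) (at t0)"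
    using cont[of "\<gamma> t0"] by (simp add: continuous_on_def)
  ultimately show "((\<lambda>t. f t (\<gamma> t)) \<longlongrightarrow> f t0 (\<gamma> t0)) (at t0)"
    using tendsto_add by fastforce
qed

lemma unique:
  assumes "\<And>t. (\<gamma> has_vector_derivative f t (\<gamma> t)) (at t)"
    and "\<And>t. (\<delta> has_vector_derivative f t (\<delta> t)) (at t)" and "\<gamma> 0 = \<delta> 0"
  shows "\<gamma> t = \<delta> t"
proof -
  have "((\<lambda>t. \<gamma> t - \<delta> t) has_vector_derivative f t (\<gamma> t) - f t (\<delta> t)) (at t)" for t
    by (intro has_vector_derivative_diff assms)
  from gronwall[OF this, of t L 0] show ?thesis using lip L_pos assms(3) by simp
qed

text \<open>Picard iteration for \<open>g t = exp (-2 L \<bar>t\<bar>) (\<gamma> t - x0)\<close>; the weight makes it a contraction for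
  all times at once.\<close>

lemma exists_solution: "\<exists>\<gamma>. \<gamma> 0 = x0 \<and> (\<forall>t. (\<gamma> has_vector_derivative f t (\<gamma> t)) (at t))"
proof -
  \<comment> \<open>The integral gains a factor \<open>L / K\<close> in the norm weighted by
    \<open>exp (K * \<bar>t\<bar>)\<close>, hence the contraction constant 1/2.\<close>
  define K where "K = 2 * L"
  have K: "K > 0" using L_pos by (simp add: K_def)
  define P where "P g t = int0 (\<lambda>s. f s (x0 + exp (K * \<bar>s\<bar>) *\<^sub>R g s)) t" for g :: "real \<Rightarrow> 'a" and t
  have Pd: "(P g has_vector_derivative f t (x0 + exp (K * \<bar>t\<bar>) *\<^sub>R g t)) (at t)"
    if "continuous_on UNIV g" for g t
    unfolding P_def by (intro int0_has_vector_derivative continuous_along continuous_intros that)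
  have P0: "P g 0 = 0" for g by (simp add: P_def)
  have e1: "1 \<le> exp (K * \<bar>t\<bar>)" for t using K by simp
  have ib: "norm (f t (x0 + exp (K * \<bar>t\<bar>) *\<^sub>R g t)) \<le> (B + L * norm x0 + L * M) * exp (K * \<bar>t\<bar>)"
    if "\<And>t. norm (g t) \<le> M" for g t M
  proof -
    have M: "M \<ge> 0" using that[of 0] norm_ge_zero order_trans by blast
    have "norm (f t (x0 + exp (K * \<bar>t\<bar>) *\<^sub>R g t)) \<le> B + L * norm (x0 + exp (K * \<bar>t\<bar>) *\<^sub>R g t)"
      using lip[of t "x0 + exp (K * \<bar>t\<bar>) *\<^sub>R g t" 0] bd[of t] norm_triangle_sub[of "f t (x0 + exp (K * \<bar>t\<bar>) *\<^sub>R g t)" "f t 0"]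
      by simp
    also have "\<dots> \<le> B + L * (norm x0 + exp (K * \<bar>t\<bar>) * M)"
      using that[of t] L_pos norm_triangle_ineq[of x0 "exp (K * \<bar>t\<bar>) *\<^sub>R g t"]
      by (intro add_left_mono mult_left_mono) (auto intro: order_trans)
    also have "\<dots> \<le> B * exp (K * \<bar>t\<bar>) + (L * norm x0) * exp (K * \<bar>t\<bar>) + (L * M) * exp (K * \<bar>t\<bar>)"
      using mult_left_mono[OF e1[of t] B_nonneg] mult_left_mono[OF e1[of t], of "L * norm x0"] L_pos
      by (simp add: distrib_left mult.assoc mult.left_commute) (simp add: add_mono mult.commute)
    finally show ?thesis by (simp add: algebra_simps)
  qed
  have Pb: "norm (exp (- K * \<bar>t\<bar>) *\<^sub>R P g t) \<le> (B + L * norm x0 + L * M) / K"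
    if "continuous_on UNIV g" "\<And>t. norm (g t) \<le> M" for g t M
  proof -
    have M: "M \<ge> 0" using that(2)[of 0] norm_ge_zero order_trans by blast
    have "norm (P g t - P g 0) \<le> (B + L * norm x0 + L * M) / K * exp (K * \<bar>t\<bar>)"
      using B_nonneg L_pos M
      by (intro exp_growth_bound[where g' = "\<lambda>t. f t (x0 + exp (K * \<bar>t\<bar>) *\<^sub>R g t)"] Pd[OF that(1)] ib that(2) K)
        auto
    then show ?thesis using K by (simp add: P0 exp_minus field_simps)
  qed
  define T where "T g = Bcontfun (\<lambda>t. exp (- K * \<bar>t\<bar>) *\<^sub>R P (apply_bcontfun g) t)" for g
  have gb: "norm (apply_bcontfun g t) \<le> norm g" for g :: "real \<Rightarrow>\<^sub>C 'a" and t by (rule norm_bounded)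
  have Tin: "(\<lambda>t. exp (- K * \<bar>t\<bar>) *\<^sub>R P (apply_bcontfun g) t) \<in> bcontfun" for g :: "real \<Rightarrow>\<^sub>C 'a"
  proof (rule bcontfun_normI[OF _ Pb[OF _ gb]])
    show "continuous_on UNIV (\<lambda>t. exp (- K * \<bar>t\<bar>) *\<^sub>R P (apply_bcontfun g) t)"
      using has_vector_derivative_continuous_on[OF Pd[of "apply_bcontfun g"]]
      by (intro continuous_intros) auto
  qed auto
  have T: "apply_bcontfun (T g) t = exp (- K * \<bar>t\<bar>) *\<^sub>R P (apply_bcontfun g) t" for g t
    using Bcontfun_inverse[OF Tin[of g]] by (simp add: T_def)
  have "\<exists>!g. T g = g"
  proof (rule banach_fix_type[of "1/2"])
    show "\<forall>g h. dist (T g) (T h) \<le> 1/2 * dist g h"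
    proof (intro allI dist_bound)
      fix g h :: "real \<Rightarrow>\<^sub>C 'a" and t
      let ?g = "apply_bcontfun g" and ?h = "apply_bcontfun h"
      have d: "((\<lambda>t. P ?g t - P ?h t) has_vector_derivative
          f t (x0 + exp (K * \<bar>t\<bar>) *\<^sub>R ?g t) - f t (x0 + exp (K * \<bar>t\<bar>) *\<^sub>R ?h t)) (at t)" for t
        by (intro has_vector_derivative_diff Pd) auto
      have b: "norm (f t (x0 + exp (K * \<bar>t\<bar>) *\<^sub>R ?g t) - f t (x0 + exp (K * \<bar>t\<bar>) *\<^sub>R ?h t))
          \<le> (L * dist g h) * exp (K * \<bar>t\<bar>)" for t
      proof -
        have "norm (f t (x0 + exp (K * \<bar>t\<bar>) *\<^sub>R ?g t) - f t (x0 + exp (K * \<bar>t\<bar>) *\<^sub>R ?h t))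
            \<le> L * norm (exp (K * \<bar>t\<bar>) *\<^sub>R (?g t - ?h t))"
          using lip[of t "x0 + exp (K * \<bar>t\<bar>) *\<^sub>R ?g t" "x0 + exp (K * \<bar>t\<bar>) *\<^sub>R ?h t"]
          by (simp add: scaleR_diff_right)
        also have "\<dots> \<le> L * (exp (K * \<bar>t\<bar>) * dist g h)"
          using dist_bounded[of g t h] L_pos by (simp add: dist_norm)
        finally show ?thesis by (simp add: algebra_simps)
      qed
      have "norm ((P ?g t - P ?h t) - (P ?g 0 - P ?h 0)) \<le> L * dist g h / K * exp (K * \<bar>t\<bar>)"
        using L_pos by (intro exp_growth_bound[OF d b K]) auto
      then have "norm (P ?g t - P ?h t) \<le> 1/2 * dist g h * exp (K * \<bar>t\<bar>)"
        using L_pos by (simp add: P0 K_def)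
      then show "dist (apply_bcontfun (T g) t) (apply_bcontfun (T h) t) \<le> 1/2 * dist g h"
        unfolding T dist_norm scaleR_diff_right[symmetric] norm_scaleR
        using mult_left_mono[of _ _ "exp (- K * \<bar>t\<bar>)"] by (simp add: exp_minus divide_simps)
    qed
  qed auto
  then obtain g where g: "T g = g" by auto
  define \<gamma> where "\<gamma> t = x0 + P (apply_bcontfun g) t" for t
  have eq: "P (apply_bcontfun g) t = exp (K * \<bar>t\<bar>) *\<^sub>R apply_bcontfun g t" for t
    using T[of g t] g by (simp add: exp_minus)
  have "(\<gamma> has_vector_derivative f t (\<gamma> t)) (at t)" for t
  proof -
    have "(\<gamma> has_vector_derivative 0 + f t (x0 + exp (K * \<bar>t\<bar>) *\<^sub>R apply_bcontfun g t)) (at t)"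
      unfolding \<gamma>_def by (intro has_vector_derivative_add has_vector_derivative_const Pd) auto
    then show ?thesis by (simp add: \<gamma>_def eq)
  qed
  moreover have "\<gamma> 0 = x0" by (simp add: \<gamma>_def P0)
  ultimately show ?thesis by blast
qed

end

section \<open>Flows and their derivatives\<close>

lemma differentiable_bound_real:
  fixes g :: "real \<Rightarrow> 'a::euclidean_space"
  assumes "\<And>s. (g has_vector_derivative g' s) (at s)"
    and "\<And>s. \<bar>s\<bar> \<le> \<bar>t\<bar> \<Longrightarrow> norm (g' s) \<le> M"
  shows "norm (g t - g 0) \<le> M * \<bar>t\<bar>"
proof -
  have "norm (g t - g 0) \<le> M * norm (t - 0)"
  proof (rule differentiable_bound[where S = "cball 0 \<bar>t\<bar>" and f' = "\<lambda>s h. h *\<^sub>R g' s"])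
    show "(g has_derivative (\<lambda>h. h *\<^sub>R g' s)) (at s within cball 0 \<bar>t\<bar>)" for s
      using assms(1)[of s] by (simp add: has_vector_derivative_def has_derivative_at_withinI)
    show "onorm (\<lambda>h. h *\<^sub>R g' s) \<le> M" if "s \<in> cball 0 \<bar>t\<bar>" for s
      using assms(2)[of s] that
      by (intro onorm_le) (auto simp: mult.commute[of M] intro: mult_left_mono)
  qed auto
  then show ?thesis by simp
qed

text \<open>Bounded, with bounded and Lipschitz derivative: enough for a global flow that is
  differentiable in space with continuous derivative. A single constant serves all bounds, so that
  finitely many fields can later share it.\<close>

locale C11_field =
  fixes X :: "'a::euclidean_space \<Rightarrow> 'a" and B :: real
  assumes differentiable: "X differentiable (at x)"
    and bound: "norm (X x) \<le> B"
    and deriv_bound: "norm (frechet_derivative X (at x) h) \<le> B * norm h"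
    and deriv_lipschitz:
      "norm (frechet_derivative X (at x) h - frechet_derivative X (at y) h) \<le> B * norm (x - y) * norm h"
    and B_pos: "B > 0"
begin

abbreviation "X' x \<equiv> frechet_derivative X (at x)"

lemma X'_deriv: "(X has_derivative X' x) (at x)"
  using differentiable by (rule has_derivative_frechet)

lemma X'_linear: "bounded_linear (X' x)"
  using X'_deriv has_derivative_bounded_linear by blast

lemma X_lipschitz: "norm (X x - X y) \<le> B * norm (x - y)"
proof (rule differentiable_bound[of UNIV X X'])
  show "onorm (X' x) \<le> B" for x using deriv_bound by (intro onorm_le)
qed (auto intro: X'_deriv)

lemma X'_continuous: "continuous_on UNIV (\<lambda>x. X' x h)"
proof (rule lipschitz_on_continuous_on[of "B * norm h"])
  show "(B * norm h)-lipschitz_on UNIV (\<lambda>x. X' x h)"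
    using deriv_lipschitz[of _ h] B_pos
    by (intro lipschitz_onI) (auto simp: dist_norm algebra_simps)
qed

lemma X_taylor: "norm (X y - X x - X' x (y - x)) \<le> B * (norm (y - x))\<^sup>2"
proof -
  have "norm ((\<lambda>z. X z - X' x z) y - (\<lambda>z. X z - X' x z) x) \<le> (B * norm (y - x)) * norm (y - x)"
  proof (rule differentiable_bound[of "closed_segment x y" _ "\<lambda>z h. X' z h - X' x h"])
    show "((\<lambda>z. X z - X' x z) has_derivative (\<lambda>h. X' z h - X' x h)) (at z within closed_segment x y)" for z
      by (intro has_derivative_diff has_derivative_at_withinI[OF X'_deriv]
          bounded_linear_imp_has_derivative X'_linear)
    show "onorm (\<lambda>h. X' z h - X' x h) \<le> B * norm (y - x)" if "z \<in> closed_segment x y" for z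
    proof (rule onorm_le)
      fix h :: 'a
      have "norm (z - x) \<le> norm (y - x)"
        using that segment_bound(1) by (metis norm_minus_commute)
      then have "B * norm (z - x) * norm h \<le> B * norm (y - x) * norm h"
        using B_pos by (intro mult_right_mono mult_left_mono) auto
      then show "norm (X' z h - X' x h) \<le> B * norm (y - x) * norm h"
        using deriv_lipschitz[of z h x] by linarith
    qed
  qed auto
  moreover have "X y - X' x y - (X x - X' x x) = X y - X x - X' x (y - x)"
    using bounded_linear.linear[OF X'_linear] by (simp add: linear_diff)
  ultimately show ?thesis by (simp add: power2_eq_square mult.assoc)
qed

lemma flow_ode: "lipschitz_ode (\<lambda>t. X) B B"
  using X_lipschitz bound B_pos by unfold_locales auto

definition \<phi> :: "real \<Rightarrow> 'a \<Rightarrow> 'a" where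
  "\<phi> t x = (SOME \<gamma>. \<gamma> 0 = x \<and> (\<forall>t. (\<gamma> has_vector_derivative X (\<gamma> t)) (at t))) t"

lemma \<phi>_0 [simp]: "\<phi> 0 x = x"
  and \<phi>_deriv: "((\<lambda>t. \<phi> t x) has_vector_derivative X (\<phi> t x)) (at t)"
  using someI_ex[OF lipschitz_ode.exists_solution[OF flow_ode, of x]] by (simp_all add: \<phi>_def)

lemma \<phi>_eqI:
  assumes "\<And>t. (\<gamma> has_vector_derivative X (\<gamma> t)) (at t)"
  shows "\<gamma> t = \<phi> t (\<gamma> 0)"
  by (rule lipschitz_ode.unique[OF flow_ode]) (auto intro: assms \<phi>_deriv)

lemma has_vector_derivative_shift:
  fixes g :: "real \<Rightarrow> 'b::real_normed_vector"
  shows "(g has_vector_derivative d) (at (t + s)) \<Longrightarrow> ((\<lambda>t. g (t + s)) has_vector_derivative d) (at t)"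
proof -
  assume d: "(g has_vector_derivative d) (at (t + s))"
  have "((\<lambda>t. t + s) has_vector_derivative 1) (at t)"
    using has_vector_derivative_add[OF has_vector_derivative_id has_vector_derivative_const[of s]] by simp
  from vector_diff_chain_at[OF this d] show ?thesis by (simp add: o_def)
qed

lemma \<phi>_add: "\<phi> (t + s) x = \<phi> t (\<phi> s x)"
  using \<phi>_eqI[of "\<lambda>t. \<phi> (t + s) x", OF has_vector_derivative_shift[OF \<phi>_deriv]] by simp

lemma \<phi>_minus [simp]: "\<phi> (- t) (\<phi> t x) = x" "\<phi> t (\<phi> (- t) x) = x"
  using \<phi>_add[of "-t" t x] \<phi>_add[of t "-t" x] by simp_all

lemma \<phi>_lipschitz: "norm (\<phi> t x - \<phi> t y) \<le> exp ((B + 1) * \<bar>t\<bar>) * norm (x - y)"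
  using gronwall[OF has_vector_derivative_diff[OF \<phi>_deriv \<phi>_deriv], of t x y B 0]
    X_lipschitz B_pos by simp

lemma \<phi>_near: "norm (\<phi> t x - x) \<le> B * \<bar>t\<bar>"
  using differentiable_bound_real[OF \<phi>_deriv, of t x B] bound by simp

text \<open>Two flow lines separate at a speed of at most \<open>B\<close> times their distance. So
  a flow for a short time is the identity up to a perturbation whose Lipschitz constant is of the
  order of the time.\<close>

lemma \<phi>_near_diff:
  "norm (\<phi> t x - \<phi> t y - (x - y)) \<le> B * exp ((B + 1) * \<bar>t\<bar>) * norm (x - y) * \<bar>t\<bar>"
proof -
  have "((\<lambda>t. \<phi> t x - \<phi> t y) has_vector_derivative X (\<phi> s x) - X (\<phi> s y)) (at s)" for s
    by (intro has_vector_derivative_diff \<phi>_deriv)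
  moreover have "norm (X (\<phi> s x) - X (\<phi> s y)) \<le> B * exp ((B + 1) * \<bar>t\<bar>) * norm (x - y)"
    if "\<bar>s\<bar> \<le> \<bar>t\<bar>" for s
  proof -
    have "norm (X (\<phi> s x) - X (\<phi> s y)) \<le> B * (exp ((B + 1) * \<bar>s\<bar>) * norm (x - y))"
      by (rule order_trans[OF X_lipschitz]) (use \<phi>_lipschitz[of s x y] B_pos in \<open>auto intro: mult_left_mono\<close>)
    also have "\<dots> \<le> B * (exp ((B + 1) * \<bar>t\<bar>) * norm (x - y))"
      using that B_pos by (intro mult_left_mono mult_right_mono) auto
    finally show ?thesis by (simp add: mult.assoc)
  qed
  ultimately show ?thesis using differentiable_bound_real[of "\<lambda>t. \<phi> t x - \<phi> t y"] by force
qed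

lemma \<phi>_continuous_t: "continuous_on S (\<lambda>t. \<phi> t x)"
  using \<phi>_deriv by (rule has_vector_derivative_continuous_on)

lemma \<phi>_continuous_x: "continuous_on S (\<phi> t)"
proof (rule lipschitz_on_continuous_on[of "exp ((B + 1) * \<bar>t\<bar>)"])
  show "(exp ((B + 1) * \<bar>t\<bar>))-lipschitz_on S (\<phi> t)"
    using \<phi>_lipschitz by (intro lipschitz_onI) (auto simp: dist_norm)
qed

lemma \<phi>_dist: "norm (\<phi> t x - \<phi> s y) \<le> B * \<bar>t - s\<bar> + exp ((B + 1) * \<bar>s\<bar>) * norm (x - y)"
proof -
  have "\<phi> t x = \<phi> (t - s) (\<phi> s x)" using \<phi>_add[of "t - s" s x] by simp
  then have "norm (\<phi> t x - \<phi> s x) \<le> B * \<bar>t - s\<bar>" using \<phi>_near[of "t - s" "\<phi> s x"] by simp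
  then show ?thesis using \<phi>_lipschitz[of s x y] norm_triangle_ineq[of "\<phi> t x - \<phi> s x" "\<phi> s x - \<phi> s y"] by simp
qed

lemma \<phi>_continuous: "continuous_on UNIV (\<lambda>p. \<phi> (fst p) (snd p))"
  unfolding continuous_on_def
proof
  fix p :: "real \<times> 'a"
  have "((\<lambda>q. \<phi> (fst q) (snd q) - \<phi> (fst p) (snd p)) \<longlongrightarrow> 0) (at p)"
  proof (rule Lim_null_comparison)
    show "\<forall>\<^sub>F q in at p. norm (\<phi> (fst q) (snd q) - \<phi> (fst p) (snd p)) \<le>
        B * \<bar>fst q - fst p\<bar> + exp ((B + 1) * \<bar>fst p\<bar>) * norm (snd q - snd p)"
      by (intro always_eventually allI \<phi>_dist)
    have "((\<lambda>q. B * \<bar>fst q - fst p\<bar> + exp ((B + 1) * \<bar>fst p\<bar>) * norm (snd q - snd p)) \<longlongrightarrow>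
        B * \<bar>fst p - fst p\<bar> + exp ((B + 1) * \<bar>fst p\<bar>) * norm (snd p - snd p)) (at p)"
      by (intro tendsto_intros)
    then show "((\<lambda>q. B * \<bar>fst q - fst p\<bar> + exp ((B + 1) * \<bar>fst p\<bar>) * norm (snd q - snd p)) \<longlongrightarrow> 0) (at p)"
      by simp
  qed
  then show "((\<lambda>p. \<phi> (fst p) (snd p)) \<longlongrightarrow> \<phi> (fst p) (snd p)) (at p within UNIV)"
    by (simp add: LIM_zero_iff)
qed

lemma var_ode: "lipschitz_ode (\<lambda>t h. X' (\<phi> t x) h) B B"
proof unfold_locales
  fix t :: real and h k :: 'a
  show "continuous_on UNIV (\<lambda>t. X' (\<phi> t x) h)"
    using continuous_on_compose2[OF X'_continuous \<phi>_continuous_t] by auto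
  show "norm (X' (\<phi> t x) h - X' (\<phi> t x) k) \<le> B * norm (h - k)"
    using deriv_bound[of "\<phi> t x" "h - k"] linear_diff[OF bounded_linear.linear[OF X'_linear]] by metis
  show "norm (X' (\<phi> t x) 0) \<le> B"
    using B_pos linear_0[OF bounded_linear.linear[OF X'_linear]] by simp
qed (rule B_pos)

text \<open>The solution of the variational equation along a flow line;
  \<open>\<phi>_has_derivative\<close> identifies it with the derivative of the flow in
  space.\<close>

definition D :: "real \<Rightarrow> 'a \<Rightarrow> 'a \<Rightarrow> 'a" where
  "D t x h = (SOME p. p 0 = h \<and> (\<forall>t. (p has_vector_derivative X' (\<phi> t x) (p t)) (at t))) t"

lemma D_0 [simp]: "D 0 x h = h"
  and D_deriv: "((\<lambda>t. D t x h) has_vector_derivative X' (\<phi> t x) (D t x h)) (at t)"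
  using someI_ex[OF lipschitz_ode.exists_solution[OF var_ode[of x], of h]] by (simp_all add: D_def)

lemma D_eqI:
  assumes "\<And>t. (p has_vector_derivative X' (\<phi> t x) (p t)) (at t)"
  shows "p t = D t x (p 0)"
  by (rule lipschitz_ode.unique[OF var_ode]) (auto intro: assms D_deriv)

lemma D_bound: "norm (D t x h) \<le> exp ((B + 1) * \<bar>t\<bar>) * norm h"
  using gronwall[of "\<lambda>t. D t x h" "\<lambda>t. X' (\<phi> t x) (D t x h)" t B 0]
    deriv_bound B_pos D_deriv by auto

lemma D_linear: "bounded_linear (D t x)"
proof -
  have lin: "linear (X' y)" for y using X'_linear bounded_linear.linear by blast
  have "D t x (h + k) = D t x h + D t x k" for h k
  proof -
    have "((\<lambda>t. D t x h + D t x k) has_vector_derivative X' (\<phi> t x) (D t x h + D t x k)) (at t)" for t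
      unfolding linear_add[OF lin] by (intro has_vector_derivative_add D_deriv)
    from D_eqI[of "\<lambda>t. D t x h + D t x k", OF this] show ?thesis by simp
  qed
  moreover have "D t x (c *\<^sub>R h) = c *\<^sub>R D t x h" for c h
  proof -
    have "((\<lambda>t. c *\<^sub>R D t x h) has_vector_derivative X' (\<phi> t x) (c *\<^sub>R D t x h)) (at t)" for t
      unfolding linear_cmul[OF lin]
      by (intro bounded_linear.has_vector_derivative[OF bounded_linear_scaleR_right] D_deriv)
    from D_eqI[of "\<lambda>t. c *\<^sub>R D t x h", OF this] show ?thesis by simp
  qed
  ultimately show ?thesis
    by (intro bounded_linear_intro[of _ "exp ((B + 1) * \<bar>t\<bar>)"]) (use D_bound in \<open>simp_all add: mult.commute\<close>)
qed

lemma D_add: "D (t + s) x h = D t (\<phi> s x) (D s x h)"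
proof -
  have "((\<lambda>t. D (t + s) x h) has_vector_derivative X' (\<phi> t (\<phi> s x)) (D (t + s) x h)) (at t)" for t
    using has_vector_derivative_shift[OF D_deriv[of x h "t + s"]] by (simp add: \<phi>_add)
  from D_eqI[of "\<lambda>t. D (t + s) x h", OF this] show ?thesis by simp
qed

text \<open>The field along its own flow line solves the variational equation, so the flow
  transports it to itself. This turns the time derivative of a function composed with the flow into
  a derivative along the field.\<close>

lemma X_along: "X (\<phi> t x) = D t x (X x)"
proof -
  have "((\<lambda>t. X (\<phi> t x)) has_vector_derivative X' (\<phi> t x) (X (\<phi> t x))) (at t)" for t
    using has_derivative_compose[OF \<phi>_deriv[unfolded has_vector_derivative_def] X'_deriv, of x t]
      linear_cmul[OF bounded_linear.linear[OF X'_linear]]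
    by (simp add: has_vector_derivative_def)
  from D_eqI[of "\<lambda>t. X (\<phi> t x)", OF this] show ?thesis by simp
qed

text \<open>The linearization error solves the variational equation with a forcing term that is
  quadratic in \<open>y - x\<close> by \<open>X_taylor\<close>; Gronwall keeps it quadratic.\<close>

lemma \<phi>_has_derivative: "(\<phi> t has_derivative D t x) (at x)"
proof -
  define M where "M = exp ((B + 1) * \<bar>t\<bar>) * (B * (exp ((B + 1) * \<bar>t\<bar>))\<^sup>2)"
  have err: "norm (\<phi> t y - \<phi> t x - D t x (y - x)) \<le> M * (norm (y - x))\<^sup>2" for y
  proof -
    define c where "c = B * (exp ((B + 1) * \<bar>t\<bar>) * norm (y - x))\<^sup>2"
    define g where "g s = \<phi> s y - \<phi> s x - D s x (y - x)" for s
    have gd: "(g has_vector_derivative X (\<phi> s y) - X (\<phi> s x) - X' (\<phi> s x) (D s x (y - x))) (at s)" for s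
      unfolding g_def by (intro has_vector_derivative_diff \<phi>_deriv D_deriv)
    have "norm (X (\<phi> s y) - X (\<phi> s x) - X' (\<phi> s x) (D s x (y - x))) \<le> B * norm (g s) + c"
      if "\<bar>s\<bar> \<le> \<bar>t\<bar>" for s
    proof -
      have "X (\<phi> s y) - X (\<phi> s x) - X' (\<phi> s x) (D s x (y - x)) =
          X' (\<phi> s x) (g s) + (X (\<phi> s y) - X (\<phi> s x) - X' (\<phi> s x) (\<phi> s y - \<phi> s x))"
        unfolding g_def using linear_diff[OF bounded_linear.linear[OF X'_linear]] by simp
      moreover have "norm (X (\<phi> s y) - X (\<phi> s x) - X' (\<phi> s x) (\<phi> s y - \<phi> s x)) \<le> c"
      proof -
        have "norm (\<phi> s y - \<phi> s x) \<le> exp ((B + 1) * \<bar>t\<bar>) * norm (y - x)"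
        proof (rule order_trans[OF \<phi>_lipschitz])
          show "exp ((B + 1) * \<bar>s\<bar>) * norm (y - x) \<le> exp ((B + 1) * \<bar>t\<bar>) * norm (y - x)"
            using that B_pos by (intro mult_right_mono) auto
        qed
        then have "B * (norm (\<phi> s y - \<phi> s x))\<^sup>2 \<le> c"
          unfolding c_def using B_pos by (intro mult_left_mono power_mono) auto
        then show ?thesis using X_taylor order_trans by blast
      qed
      ultimately show ?thesis
        using deriv_bound[of "\<phi> s x" "g s"] norm_triangle_le[OF add_mono] by metis
    qed
    from gronwall[OF gd this, of t] show ?thesis
      using B_pos by (simp add: g_def c_def M_def power_mult_distrib mult.assoc)
  qed
  have M: "M \<ge> 0" using B_pos by (simp add: M_def)
  show ?thesis
  proof (rule has_derivativeI[OF D_linear], rule Lim_null_comparison)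
    show "\<forall>\<^sub>F y in at x. norm ((\<phi> t y - \<phi> t x - D t x (y - x)) /\<^sub>R norm (y - x)) \<le> M * norm (y - x)"
    proof (intro always_eventually allI)
      fix y
      show "norm ((\<phi> t y - \<phi> t x - D t x (y - x)) /\<^sub>R norm (y - x)) \<le> M * norm (y - x)"
        using err[of y] M by (cases "y = x") (auto simp: divide_simps power2_eq_square mult.assoc)
    qed
    have "((\<lambda>y. M * norm (y - x)) \<longlongrightarrow> M * norm (x - x)) (at x)" by (intro tendsto_intros)
    then show "((\<lambda>y. M * norm (y - x)) \<longlongrightarrow> 0) (at x)" by simp
  qed
qed

text \<open>Makes the derivative of the flow continuous in space, so that C^1 test functions remain
  C^1 when composed with a flow.\<close>

lemma D_lipschitz:
  "norm (D t x h - D t y h) \<le> (exp ((B + 1) * \<bar>t\<bar>))^3 * B * norm h * norm (x - y)"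
proof -
  define e where "e = exp ((B + 1) * \<bar>t\<bar>)"
  define c where "c = B * (e * norm (x - y)) * (e * norm h)"
  define g where "g s = D s x h - D s y h" for s
  have gd: "(g has_vector_derivative X' (\<phi> s x) (D s x h) - X' (\<phi> s y) (D s y h)) (at s)" for s
    unfolding g_def by (intro has_vector_derivative_diff D_deriv)
  have "norm (X' (\<phi> s x) (D s x h) - X' (\<phi> s y) (D s y h)) \<le> B * norm (g s) + c"
    if "\<bar>s\<bar> \<le> \<bar>t\<bar>" for s
  proof -
    have es: "exp ((B + 1) * \<bar>s\<bar>) \<le> e" unfolding e_def using that B_pos by simp
    have "X' (\<phi> s x) (D s x h) - X' (\<phi> s y) (D s y h) =
        X' (\<phi> s x) (g s) + (X' (\<phi> s x) (D s y h) - X' (\<phi> s y) (D s y h))"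
      unfolding g_def using linear_diff[OF bounded_linear.linear[OF X'_linear]] by simp
    moreover have "norm (X' (\<phi> s x) (D s y h) - X' (\<phi> s y) (D s y h)) \<le> c"
    proof -
      have "norm (\<phi> s x - \<phi> s y) \<le> e * norm (x - y)"
        using \<phi>_lipschitz[of s x y] mult_right_mono[OF es, of "norm (x - y)"] by simp
      moreover have "norm (D s y h) \<le> e * norm h"
        using D_bound[of s y h] mult_right_mono[OF es, of "norm h"] by simp
      ultimately have "B * norm (\<phi> s x - \<phi> s y) * norm (D s y h) \<le> c"
        unfolding c_def using B_pos by (intro mult_mono) (auto simp: e_def)
      then show ?thesis using deriv_lipschitz order_trans by blast
    qed
    ultimately show ?thesis
      using deriv_bound[of "\<phi> s x" "g s"] norm_triangle_le[OF add_mono] by metis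
  qed
  from gronwall[OF gd this, of t] show ?thesis
    using B_pos by (simp add: g_def c_def e_def power3_eq_cube mult_ac)
qed

lemma D_continuous_x: "continuous_on UNIV (\<lambda>x. D t x h)"
proof (rule lipschitz_on_continuous_on[of "(exp ((B + 1) * \<bar>t\<bar>))^3 * B * norm h"])
  show "((exp ((B + 1) * \<bar>t\<bar>))^3 * B * norm h)-lipschitz_on UNIV (\<lambda>x. D t x h)"
    using D_lipschitz B_pos by (intro lipschitz_onI) (auto simp: dist_norm)
qed

lemma C1_comp_\<phi>:
  fixes f :: "'a \<Rightarrow> 'b::euclidean_space"
  shows "Ck_on 1 UNIV f \<Longrightarrow> Ck_on 1 UNIV (\<lambda>x. f (\<phi> t x))"
  by (rule C1_comp[OF _ \<phi>_has_derivative D_continuous_x])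

lemma \<phi>_joint_derivative:
  "((\<lambda>(x, t). \<phi> t x) has_derivative (\<lambda>(h, \<tau>). D t x h + \<tau> *\<^sub>R X (\<phi> t x))) (at (x, t))"
proof -
  have "continuous_on UNIV (\<lambda>p::'a \<times> real. \<phi> (snd p) (fst p))"
    using continuous_on_compose2[OF \<phi>_continuous, of UNIV "\<lambda>p. (snd p, fst p)"]
      continuous_on_swap[of UNIV] by (simp add: prod.swap_def)
  moreover have "continuous_on UNIV X"
    by (intro continuous_at_imp_continuous_on ballI has_derivative_continuous[OF X'_deriv])
  ultimately have "continuous_on UNIV (\<lambda>p::'a \<times> real. X (\<phi> (snd p) (fst p)))"
    by (auto intro: continuous_on_compose2)
  then have c: "continuous_on UNIV (\<lambda>p::'a \<times> real. blinfun_scaleR_left (X (\<phi> (snd p) (fst p))))"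
    by (intro bounded_linear.continuous_on[OF bounded_linear_blinfun_scaleR_left])
  have "((\<lambda>(x, t). \<phi> t x) has_derivative (\<lambda>(h, \<tau>). D t x h + blinfun_scaleR_left (X (\<phi> t x)) \<tau>)) (at (x, t) within UNIV \<times> UNIV)"
  proof (rule has_derivative_partialsI[where fy = "\<lambda>x t. blinfun_scaleR_left (X (\<phi> t x))"])
    show "continuous (at (x, t) within UNIV \<times> UNIV) (\<lambda>(x, y). blinfun_scaleR_left (X (\<phi> y x)))"
      using c by (simp add: continuous_on_eq_continuous_within case_prod_unfold)
  qed (use \<phi>_has_derivative \<phi>_deriv[unfolded has_vector_derivative_def] in auto)
  then show ?thesis by simp
qed

lemma \<phi>_chain:
  assumes "(\<tau> has_vector_derivative a) (at u)" "(g has_vector_derivative v) (at u)"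
  shows "((\<lambda>u. \<phi> (\<tau> u) (g u)) has_vector_derivative a *\<^sub>R X (\<phi> (\<tau> u) (g u)) + D (\<tau> u) (g u) v) (at u)"
proof -
  have "((\<lambda>u. (g u, \<tau> u)) has_derivative (\<lambda>h. (h *\<^sub>R v, h *\<^sub>R a))) (at u)"
    using assms unfolding has_vector_derivative_def by (rule has_derivative_Pair[rotated])
  from has_derivative_compose[OF this \<phi>_joint_derivative]
  have "((\<lambda>u. \<phi> (\<tau> u) (g u)) has_derivative (\<lambda>h. D (\<tau> u) (g u) (h *\<^sub>R v) + (h *\<^sub>R a) *\<^sub>R X (\<phi> (\<tau> u) (g u)))) (at u)"
    by simp
  then show ?thesis
    unfolding has_vector_derivative_def
    by (simp add: linear_cmul[OF bounded_linear.linear[OF D_linear]] scaleR_add_right add.commute)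
qed

end

section \<open>Push-forward of vector fields along a flow and its expansion in brackets\<close>

context C11_field
begin

text \<open>The push-forward of the field \<open>V\<close> under the flow map at time
  \<open>t\<close>. Only values of \<open>V\<close> enter, so it is defined for fields without any
  regularity.\<close>

definition Ad :: "real \<Rightarrow> ('a \<Rightarrow> 'a) \<Rightarrow> 'a \<Rightarrow> 'a" where
  "Ad t V y = D t (\<phi> (- t) y) (V (\<phi> (- t) y))"

lemma Ad_add: "Ad t (\<lambda>y. V y + W y) y = Ad t V y + Ad t W y"
  and Ad_diff: "Ad t (\<lambda>y. V y - W y) y = Ad t V y - Ad t W y"
  and Ad_minus: "Ad t (\<lambda>y. - V y) y = - Ad t V y"
  and Ad_scaleR: "Ad t (\<lambda>y. c *\<^sub>R V y) y = c *\<^sub>R Ad t V y"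
  and Ad_zero: "Ad t (\<lambda>y. 0) y = 0"
  using bounded_linear.linear[OF D_linear]
  by (simp_all add: Ad_def linear_add linear_diff linear_neg linear_cmul linear_0)

lemma Ad_self: "Ad t X y = X y"
  using X_along[of t "\<phi> (- t) y"] by (simp add: Ad_def)

lemma Ad_inverse: "Ad (- t) (Ad t V) y = V y"
  using D_add[of "- t" t y "V y"] by (simp add: Ad_def)

lemma Ad_norm: "norm (Ad t V y) \<le> exp ((B + 1) * \<bar>t\<bar>) * norm (V (\<phi> (- t) y))"
  unfolding Ad_def by (rule D_bound)

lemma adjoint_bound: "norm (adjoint (X' x) w) \<le> B * norm w"
proof -
  have "(norm (adjoint (X' x) w))\<^sup>2 = X' x (adjoint (X' x) w) \<bullet> w"
    using adjoint_works[OF bounded_linear.linear[OF X'_linear], of "adjoint (X' x) w" x w]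
    by (simp add: power2_norm_eq_inner)
  also have "\<dots> \<le> (B * norm (adjoint (X' x) w)) * norm w"
    using norm_cauchy_schwarz[of "X' x (adjoint (X' x) w)" w] deriv_bound[of x "adjoint (X' x) w"]
    by (meson mult_right_mono norm_ge_zero order_trans)
  finally have "norm (adjoint (X' x) w) * norm (adjoint (X' x) w) \<le> norm (adjoint (X' x) w) * (B * norm w)"
    by (simp add: power2_eq_square mult_ac)
  then show ?thesis using B_pos by (cases "adjoint (X' x) w = 0") auto
qed

lemma adj_linear: "linear (adjoint (X' x))"
  by (rule adjoint_linear[OF bounded_linear.linear[OF X'_linear]])

lemma adj_continuous: "continuous_on UNIV (\<lambda>x. adjoint (X' x) w)"
  using X'_continuous
  by (subst continuous_on_componentwise)
    (auto simp: inner_commute[of "adjoint _ _"] adjoint_works[OF bounded_linear.linear[OF X'_linear]]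
      intro!: continuous_intros)

lemma adj_ode: "lipschitz_ode (\<lambda>t w. adjoint (X' (\<phi> (- t) y)) w) B B"
proof unfold_locales
  fix t :: real and h k :: 'a
  have "continuous_on UNIV (\<lambda>t. \<phi> (- t) y)"
    by (rule continuous_on_compose2[OF \<phi>_continuous_t[of UNIV]]) (auto intro!: continuous_intros)
  then show "continuous_on UNIV (\<lambda>t. adjoint (X' (\<phi> (- t) y)) h)"
    using continuous_on_compose2[OF adj_continuous] by auto
  show "norm (adjoint (X' (\<phi> (- t) y)) h - adjoint (X' (\<phi> (- t) y)) k) \<le> B * norm (h - k)"
    using adjoint_bound[of "\<phi> (- t) y" "h - k"] linear_diff[OF adj_linear] by metis
  show "norm (adjoint (X' (\<phi> (- t) y)) 0) \<le> B"
    using B_pos linear_0[OF adj_linear] by simp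
qed (rule B_pos)

text \<open>The covector \<open>w\<close> at \<open>y\<close> pulled back along the flow to \<open>\<phi> (-t) y\<close>; it solves the adjoint of the
  variational equation, so that \<open>Ad\<close> can be differentiated without differentiating \<open>D\<close> in space.\<close>

definition pull :: "'a \<Rightarrow> 'a \<Rightarrow> real \<Rightarrow> 'a" where
  "pull y w = (SOME n. n 0 = w \<and> (\<forall>t. (n has_vector_derivative adjoint (X' (\<phi> (- t) y)) (n t)) (at t)))"

lemma pull_0: "pull y w 0 = w"
  and pull_deriv: "(pull y w has_vector_derivative adjoint (X' (\<phi> (- t) y)) (pull y w t)) (at t)"
  using someI_ex[OF lipschitz_ode.exists_solution[OF adj_ode[of y], of w]] by (simp_all add: pull_def)

lemma pull_bound: "norm (pull y w t) \<le> exp ((B + 1) * \<bar>t\<bar>) * norm w"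
  using gronwall[OF pull_deriv, where L = B and c = 0] adjoint_bound B_pos by (simp add: pull_0)

text \<open>The variational equation and its adjoint preserve the pairing:
  \<open>pull y w (t - s) \<bullet> D s x v\<close>, with \<open>x = \<phi> (- t) y\<close>, is
  constant in \<open>s\<close>. The two sides are its values at \<open>s = 0\<close> and
  \<open>s = t\<close>.\<close>

lemma pull_D: "pull y w t \<bullet> v = w \<bullet> D t (\<phi> (- t) y) v"
proof -
  let ?x = "\<phi> (- t) y"
  have d: "((\<lambda>s. pull y w (t - s) \<bullet> D s ?x v) has_vector_derivative 0) (at s within UNIV)" for s
  proof -
    have "((\<lambda>s. t - s) has_vector_derivative - 1) (at s)"
      using has_vector_derivative_diff[OF has_vector_derivative_const[of t] has_vector_derivative_id] by simp
    from vector_diff_chain_at[OF this pull_deriv[of y w "t - s"]]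
    have "((\<lambda>s. pull y w (t - s)) has_vector_derivative - adjoint (X' (\<phi> s ?x)) (pull y w (t - s))) (at s)"
      using \<phi>_add[of s "- t" y] by (simp add: o_def)
    from bounded_bilinear.has_vector_derivative[OF bounded_bilinear_inner this D_deriv[of ?x v s]]
    show ?thesis
      using adjoint_works[OF bounded_linear.linear[OF X'_linear], of "D s ?x v" "\<phi> s ?x" "pull y w (t - s)"]
      by (simp add: inner_commute)
  qed
  obtain c where "\<And>s. pull y w (t - s) \<bullet> D s ?x v = c"
    using has_vector_derivative_zero_constant[OF convex_UNIV d] by auto
  from this[of 0] this[of t] show ?thesis by (simp add: pull_0)
qed

lemma pull_Ad: "w \<bullet> Ad t V y = pull y w t \<bullet> V (\<phi> (- t) y)"
  by (simp add: Ad_def pull_D)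

text \<open>The covector contributes the derivative of \<open>X\<close> applied to \<open>V\<close>,
  the moving base point minus the derivative of \<open>V\<close> applied to \<open>X\<close>;
  together these are minus the bracket.\<close>

lemma pull_V_deriv:
  assumes "V differentiable (at (\<phi> (- t) y))"
  shows "((\<lambda>t. pull y w t \<bullet> V (\<phi> (- t) y)) has_vector_derivative
    - (pull y w t \<bullet> lie_bracket X V (\<phi> (- t) y))) (at t)"
proof -
  let ?x = "\<phi> (- t) y"
  have "((\<lambda>t. \<phi> (- t) y) has_vector_derivative - X ?x) (at t)"
    by (rule has_vector_derivative_reflect[OF \<phi>_deriv])
  from has_derivative_compose[OF this[unfolded has_vector_derivative_def] has_derivative_frechet[OF assms]]
  have "((\<lambda>t. V (\<phi> (- t) y)) has_vector_derivative - frechet_derivative V (at ?x) (X ?x)) (at t)"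
    using linear_frechet_derivative[OF assms]
    by (simp add: has_vector_derivative_def linear_cmul linear_neg)
  from bounded_bilinear.has_vector_derivative[OF bounded_bilinear_inner pull_deriv this, of y w]
  show ?thesis
    using adjoint_works[OF bounded_linear.linear[OF X'_linear], of "V ?x" ?x "pull y w t"]
    by (simp add: lie_bracket_def inner_diff_right inner_commute)
qed

lemma smooth_on_lie_bracket_pow:
  assumes "open G" "smooth_on G X" "smooth_on G V"
  shows "smooth_on G ((lie_bracket X ^^ k) V)"
  by (induction k) (auto intro: assms smooth_on_lie_bracket)

text \<open>Paired with a basis vector, the push-forward is a scalar function of time whose
  successive derivatives each bring in one more bracket with \<open>X\<close> and a sign.
  Maclaurin's formula applies to each component, and adding the components gives the factor
  \<open>DIM('a)\<close>.\<close>

lemma Ad_taylor: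
  assumes G: "open G" "smooth_on G X" "smooth_on G V"
    and y: "\<And>s. \<bar>s\<bar> \<le> \<bar>t\<bar> \<Longrightarrow> \<phi> (- s) y \<in> G"
    and M: "\<And>s. \<bar>s\<bar> \<le> \<bar>t\<bar> \<Longrightarrow> norm ((lie_bracket X ^^ K) V (\<phi> (- s) y)) \<le> M"
  shows "norm (Ad t V y - (\<Sum>l<K. ((- t) ^ l / fact l) *\<^sub>R (lie_bracket X ^^ l) V y))
    \<le> DIM('a) * exp ((B + 1) * \<bar>t\<bar>) * M * \<bar>t\<bar> ^ K"
proof -
  let ?R = "Ad t V y - (\<Sum>l<K. ((- t) ^ l / fact l) *\<^sub>R (lie_bracket X ^^ l) V y)"
  have "\<bar>?R \<bullet> b\<bar> \<le> exp ((B + 1) * \<bar>t\<bar>) * M * \<bar>t\<bar> ^ K" if b: "b \<in> Basis" for b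
  proof -
    define q where "q m s = (- 1) ^ m * (pull y b s \<bullet> (lie_bracket X ^^ m) V (\<phi> (- s) y))" for m s
    have "(q m has_real_derivative q (Suc m) s) (at s)" if "\<bar>s\<bar> \<le> \<bar>t\<bar>" for m s
    proof -
      have "(lie_bracket X ^^ m) V differentiable (at (\<phi> (- s) y))"
        using smooth_on_lie_bracket_pow[OF G] y[OF that] by (rule smooth_on_differentiable)
      from pull_V_deriv[OF this, of b]
      have "((\<lambda>s. (- 1) ^ m * (pull y b s \<bullet> (lie_bracket X ^^ m) V (\<phi> (- s) y))) has_real_derivative
          (- 1) ^ m * - (pull y b s \<bullet> lie_bracket X ((lie_bracket X ^^ m) V) (\<phi> (- s) y))) (at s)"
        unfolding has_real_derivative_iff_has_vector_derivative[symmetric] by (rule DERIV_cmult)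
      then show ?thesis unfolding q_def by simp
    qed
    then obtain s where s: "\<bar>s\<bar> \<le> \<bar>t\<bar>"
      "q 0 t = (\<Sum>m<K. q m 0 / fact m * t ^ m) + q K s / fact K * t ^ K"
      using Maclaurin_bi_le[of q "q 0" K t] by auto
    have "q 0 t = Ad t V y \<bullet> b" by (simp add: q_def pull_Ad[symmetric] inner_commute)
    moreover have "(\<Sum>m<K. q m 0 / fact m * t ^ m) =
        (\<Sum>l<K. ((- t) ^ l / fact l) *\<^sub>R (lie_bracket X ^^ l) V y) \<bullet> b"
      unfolding inner_sum_left
      by (intro sum.cong) (auto simp: q_def pull_0 inner_commute power_minus[of t] field_simps)
    ultimately have "?R \<bullet> b = q K s / fact K * t ^ K" using s(2) by (simp add: inner_diff_left)
    then have "\<bar>?R \<bullet> b\<bar> = \<bar>q K s\<bar> / fact K * \<bar>t\<bar> ^ K" by (simp add: abs_mult power_abs)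
    also have "\<bar>q K s\<bar> / fact K \<le> \<bar>q K s\<bar>" by (simp add: divide_le_eq fact_ge_1 mult_le_cancel_left1)
    also have "\<bar>q K s\<bar> \<le> exp ((B + 1) * \<bar>t\<bar>) * M"
    proof -
      have "\<bar>q K s\<bar> \<le> norm (pull y b s) * norm ((lie_bracket X ^^ K) V (\<phi> (- s) y))"
        using Cauchy_Schwarz_ineq2 by (simp add: q_def abs_mult)
      also have "\<dots> \<le> exp ((B + 1) * \<bar>t\<bar>) * M"
      proof (intro mult_mono M s(1))
        have "exp ((B + 1) * \<bar>s\<bar>) \<le> exp ((B + 1) * \<bar>t\<bar>)" using s(1) B_pos by simp
        then show "norm (pull y b s) \<le> exp ((B + 1) * \<bar>t\<bar>)"
          using order_trans[OF pull_bound[of y b s, unfolded norm_Basis[OF b] mult_1_right]] by blast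
      qed auto
      finally show ?thesis .
    qed
    finally show ?thesis by (simp add: mult_right_mono)
  qed
  then have "(\<Sum>b\<in>Basis. \<bar>?R \<bullet> b\<bar>) \<le> (\<Sum>b\<in>(Basis::'a set). exp ((B + 1) * \<bar>t\<bar>) * M * \<bar>t\<bar> ^ K)"
    by (intro sum_mono)
  then show ?thesis using norm_le_l1[of ?R] by (simp add: mult.assoc)
qed

end

section \<open>Chains of flows\<close>

locale C11_fields =
  fixes Y :: "'m \<Rightarrow> 'a::euclidean_space \<Rightarrow> 'a" and B :: real
  assumes field: "C11_field (Y i) B"
begin

sublocale F: C11_field "Y i" B for i
  by (rule field)

abbreviation \<Phi> :: "'m \<Rightarrow> real \<Rightarrow> 'a \<Rightarrow> 'a" where "\<Phi> i \<equiv> C11_field.\<phi> (Y i)"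
abbreviation AD :: "'m \<Rightarrow> real \<Rightarrow> ('a \<Rightarrow> 'a) \<Rightarrow> 'a \<Rightarrow> 'a" where "AD i \<equiv> C11_field.Ad (Y i)"

text \<open>The counterpart of \<open>iter_commutator\<close> built from \<open>lie_bracket\<close>,
  with the same nesting to the right.\<close>

fun nest :: "'m list \<Rightarrow> 'a \<Rightarrow> 'a" where
  "nest [] = (\<lambda>x. 0)"
| "nest [i] = Y i"
| "nest (i # j # js) = lie_bracket (Y i) (nest (j # js))"

lemma nest_Cons: "w \<noteq> [] \<Longrightarrow> nest (i # w) = lie_bracket (Y i) (nest w)"
  by (cases w) auto

text \<open>A step \<open>(i, b, a)\<close> follows \<open>Y i\<close> for the time
  \<open>b * r + a * u\<close>, where \<open>r\<close> is the scale and \<open>u\<close> the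
  parameter to be varied. The head of the list acts last.\<close>

fun app :: "('m \<times> real \<times> real) list \<Rightarrow> real \<Rightarrow> real \<Rightarrow> 'a \<Rightarrow> 'a" where
  "app [] r u x = x"
| "app ((i, b, a) # l) r u x = \<Phi> i (b * r + a * u) (app l r u x)"

text \<open>The velocity of the end point in \<open>u\<close>, written as a vector field evaluated
  at the end point. Each later step pushes forward the velocity collected so far and adds its own;
  the starting point has disappeared.\<close>

fun vel :: "('m \<times> real \<times> real) list \<Rightarrow> real \<Rightarrow> real \<Rightarrow> 'a \<Rightarrow> 'a" where
  "vel [] r u y = 0"
| "vel ((i, b, a) # l) r u y = a *\<^sub>R Y i y + AD i (b * r + a * u) (vel l r u) y"

text \<open>Push-forward under the whole chain, in the order in which \<open>app\<close>
  composes.\<close>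

fun Adl :: "('m \<times> real \<times> real) list \<Rightarrow> real \<Rightarrow> real \<Rightarrow> ('a \<Rightarrow> 'a) \<Rightarrow> 'a \<Rightarrow> 'a" where
  "Adl [] r u V y = V y"
| "Adl ((i, b, a) # l) r u V y = AD i (b * r + a * u) (Adl l r u V) y"

lemma Adl_Nil_fun: "Adl [] r u V = V"
  and Adl_Cons_fun: "Adl ((i, b, a) # l) r u V = AD i (b * r + a * u) (Adl l r u V)"
  and vel_Nil_fun: "vel [] r u = (\<lambda>y. 0)"
  and vel_Cons_fun:
    "vel ((i, b, a) # l) r u = (\<lambda>y. a *\<^sub>R Y i y + AD i (b * r + a * u) (vel l r u) y)"
  by (rule ext, simp)+

lemma Ad_fun:
  "AD i t (\<lambda>y. V y + W y) = (\<lambda>y. AD i t V y + AD i t W y)"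
  "AD i t (\<lambda>y. V y - W y) = (\<lambda>y. AD i t V y - AD i t W y)"
  "AD i t (\<lambda>y. - V y) = (\<lambda>y. - AD i t V y)"
  "AD i t (\<lambda>y. c *\<^sub>R V y) = (\<lambda>y. c *\<^sub>R AD i t V y)"
  "AD i t (\<lambda>y. 0) = (\<lambda>y. 0)"
  "AD i t (Y i) = Y i"
  "AD i (- t) (AD i t V) = V"
  by (rule ext, simp add: F.Ad_add F.Ad_diff F.Ad_minus F.Ad_scaleR F.Ad_zero F.Ad_self F.Ad_inverse)+

definition inv_steps :: "('m \<times> real \<times> real) list \<Rightarrow> ('m \<times> real \<times> real) list" where
  "inv_steps l = rev (map (\<lambda>(i, b, a). (i, - b, - a)) l)"

lemma inv_steps_simps [simp]:
  "inv_steps [] = []" "inv_steps ((i, b, a) # l) = inv_steps l @ [(i, - b, - a)]"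
  by (simp_all add: inv_steps_def)

text \<open>For \<open>u = r\<close> this is the usual commutator of flows; keeping all times but one equal to \<open>\<plusminus>r\<close>
  makes its velocity in \<open>u\<close> comparable to \<open>r\<close> raised to the length of the word minus one.\<close>

fun chain :: "'m list \<Rightarrow> ('m \<times> real \<times> real) list" where
  "chain [] = []"
| "chain [i] = [(i, 0, 1)]"
| "chain (i # j # js) =
     (i, 1, 0) # inv_steps (chain (j # js)) @ (i, - 1, 0) # chain (j # js)"

lemma chain_Cons: "w \<noteq> [] \<Longrightarrow> chain (i # w) = (i, 1, 0) # inv_steps (chain w) @ (i, - 1, 0) # chain w"
  by (cases w) auto

text \<open>For \<open>\<bar>u\<bar> \<le> r\<close> this keeps every single step within time
  \<open>r\<close>.\<close>

definition good_steps :: "('m \<times> real \<times> real) list \<Rightarrow> bool" where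
  "good_steps l \<longleftrightarrow> (\<forall>(i, b, a)\<in>set l. \<bar>b\<bar> + \<bar>a\<bar> \<le> 1)"

lemma good_steps_simps [simp]:
  "good_steps []" "good_steps ((i, b, a) # l) \<longleftrightarrow> \<bar>b\<bar> + \<bar>a\<bar> \<le> 1 \<and> good_steps l"
  "good_steps (l @ l') \<longleftrightarrow> good_steps l \<and> good_steps l'"
  by (auto simp: good_steps_def ball_Un)

lemma good_inv_steps [simp]: "good_steps (inv_steps l) \<longleftrightarrow> good_steps l"
  by (induction l) auto

lemma good_chain: "good_steps (chain w)"
  by (induction w rule: chain.induct) auto

lemma step_time:
  assumes "\<bar>b\<bar> + \<bar>a\<bar> \<le> (1::real)" "\<bar>u\<bar> \<le> r"
  shows "\<bar>b * r + a * u\<bar> \<le> r"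
proof -
  have "\<bar>b * r + a * u\<bar> \<le> \<bar>b\<bar> * r + \<bar>a\<bar> * r"
    using assms abs_triangle_ineq[of "b * r" "a * u"] mult_left_mono[OF assms(2), of "\<bar>a\<bar>"]
    by (simp add: abs_mult)
  also have "\<dots> = (\<bar>b\<bar> + \<bar>a\<bar>) * r" by (simp add: algebra_simps)
  also have "\<dots> \<le> 1 * r" using assms by (intro mult_right_mono) auto
  finally show ?thesis by simp
qed

lemma Adl_append: "Adl (l @ l') r u V = Adl l r u (Adl l' r u V)"
proof (induction l)
  case (Cons s l)
  then show ?case by (cases s) (simp add: Adl_Cons_fun)
qed (simp add: Adl_Nil_fun)

lemma Adl_linear:
  "Adl l r u (\<lambda>y. V y + W y) = (\<lambda>y. Adl l r u V y + Adl l r u W y)"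
  "Adl l r u (\<lambda>y. V y - W y) = (\<lambda>y. Adl l r u V y - Adl l r u W y)"
  "Adl l r u (\<lambda>y. - V y) = (\<lambda>y. - Adl l r u V y)"
proof (induction l)
  case (Cons s l)
  obtain i b a where s: "s = (i, b, a)" by (cases s) auto
  show "Adl (s # l) r u (\<lambda>y. V y + W y) = (\<lambda>y. Adl (s # l) r u V y + Adl (s # l) r u W y)"
    "Adl (s # l) r u (\<lambda>y. V y - W y) = (\<lambda>y. Adl (s # l) r u V y - Adl (s # l) r u W y)"
    "Adl (s # l) r u (\<lambda>y. - V y) = (\<lambda>y. - Adl (s # l) r u V y)"
    unfolding s Adl_Cons_fun Cons Ad_fun by (rule refl)+
qed (simp_all add: Adl_Nil_fun)

lemma vel_append: "vel (l @ l') r u = (\<lambda>y. vel l r u y + Adl l r u (vel l' r u) y)"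
proof (induction l)
  case (Cons s l)
  obtain i b a where s: "s = (i, b, a)" by (cases s) auto
  show ?case unfolding s append_Cons vel_Cons_fun Adl_Cons_fun Cons Ad_fun by (simp add: add.assoc)
qed (simp add: vel_Nil_fun Adl_Nil_fun)

text \<open>This is the derivative in \<open>u\<close> of the identity that the reversed chain
  undoes the chain: the velocities of the two parts cancel after push-forward.\<close>

lemma vel_inv_steps: "vel (inv_steps l) r u = (\<lambda>y. - Adl (inv_steps l) r u (vel l r u) y)"
proof (induction l)
  case (Cons s l)
  obtain i b a where s: "s = (i, b, a)" by (cases s) auto
  have e: "- b * r + - a * u = - (b * r + a * u)" by simp
  have 1: "Adl [(i, - b, - a)] r u (vel ((i, b, a) # l) r u) = (\<lambda>y. a *\<^sub>R Y i y + vel l r u y)"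
    unfolding Adl_Cons_fun Adl_Nil_fun e vel_Cons_fun Ad_fun ..
  have 2: "vel [(i, - b, - a)] r u = (\<lambda>y. - (a *\<^sub>R Y i y))"
    unfolding vel_Cons_fun vel_Nil_fun Ad_fun by simp
  show ?case
    unfolding s inv_steps_simps vel_append Adl_append 1 2 Cons Adl_linear by (rule ext) simp
qed (simp add: vel_Nil_fun Adl_Nil_fun)

text \<open>The two outer steps have fixed times \<open>\<plusminus>r\<close> and contribute no
  velocity of their own. What remains is the difference between the velocity pushed forward by
  \<open>AD i (- r)\<close> and the velocity itself; this difference is where one bracket with
  \<open>Y i\<close> and one power of \<open>r\<close> are gained.\<close>

lemma vel_chain_Cons:
  assumes "w \<noteq> []"
  shows "vel (chain (i # w)) r u =
    AD i r (Adl (inv_steps (chain w)) r u (\<lambda>y. AD i (- r) (vel (chain w) r u) y - vel (chain w) r u y))"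
proof -
  let ?c = "chain w"
  have 1: "vel ((i, - 1, 0) # ?c) r u = AD i (- r) (vel ?c r u)"
    unfolding vel_Cons_fun by simp
  have "vel (inv_steps ?c @ (i, - 1, 0) # ?c) r u =
      Adl (inv_steps ?c) r u (\<lambda>y. AD i (- r) (vel ?c r u) y - vel ?c r u y)"
    unfolding vel_append vel_inv_steps 1 Adl_linear by simp
  then show ?thesis unfolding chain_Cons[OF assms] vel_Cons_fun by simp
qed

lemma app_deriv:
  "((\<lambda>u. app l r u x) has_vector_derivative vel l r u (app l r u x)) (at u)"
proof (induction l)
  case (Cons s l)
  obtain i b a where s: "s = (i, b, a)" by (cases s) auto
  have "((\<lambda>u. b * r + a * u) has_vector_derivative a) (at u)"
    unfolding has_real_derivative_iff_has_vector_derivative[symmetric]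
    by (auto intro!: derivative_eq_intros)
  from F.\<phi>_chain[OF this Cons, of i] show ?case
    unfolding s app.simps vel.simps F.Ad_def F.\<phi>_minus(1) .
qed simp

lemma B_nonneg: "B \<ge> 0"
  using F.B_pos by simp

lemma app_near:
  assumes "good_steps l" "\<bar>u\<bar> \<le> r"
  shows "norm (app l r u x - x) \<le> length l * (B * r)"
  using assms(1)
proof (induction l)
  case (Cons s l)
  obtain i b a where s: "s = (i, b, a)" by (cases s) auto
  have "\<bar>b * r + a * u\<bar> \<le> r" using Cons.prems assms(2) by (intro step_time) (auto simp: s)
  then have "norm (\<Phi> i (b * r + a * u) (app l r u x) - app l r u x) \<le> B * r"
    using F.\<phi>_near[of i "b * r + a * u" "app l r u x"] mult_left_mono[OF _ B_nonneg] order_trans by blast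
  moreover have "norm (app l r u x - x) \<le> length l * (B * r)" using Cons by (simp add: s)
  ultimately have "norm (app (s # l) r u x - x) \<le> B * r + length l * (B * r)"
    using norm_triangle_ineq[of "app (s # l) r u x - app l r u x" "app l r u x - x"] by (simp add: s)
  then show ?case by (simp add: algebra_simps)
qed simp

lemma app_near_diff:
  assumes "good_steps l"
  shows "\<exists>C\<ge>0. \<forall>r u x y. \<bar>u\<bar> \<le> r \<longrightarrow> r \<le> 1 \<longrightarrow>
    norm (app l r u x - app l r u y - (x - y)) \<le> C * r * norm (x - y)"
  using assms
proof (induction l)
  case Nil
  then show ?case by (auto intro!: exI[of _ 0])
next
  case (Cons s l)
  obtain i b a where s: "s = (i, b, a)" by (cases s) auto
  obtain C where C: "C \<ge> 0" "\<And>r u x y. \<bar>u\<bar> \<le> r \<Longrightarrow> r \<le> 1 \<Longrightarrow>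
      norm (app l r u x - app l r u y - (x - y)) \<le> C * r * norm (x - y)"
    using Cons by (auto simp: s)
  define E where "E = B * exp (B + 1)"
  have E: "E \<ge> 0" using B_nonneg by (simp add: E_def)
  have "norm (app (s # l) r u x - app (s # l) r u y - (x - y)) \<le> (C + E * (1 + C)) * r * norm (x - y)"
    if r: "\<bar>u\<bar> \<le> r" "r \<le> 1" for r u x y
  proof -
    let ?p = "app l r u x" and ?q = "app l r u y" and ?t = "b * r + a * u"
    have t: "\<bar>?t\<bar> \<le> r" using Cons.prems r by (intro step_time) (auto simp: s)
    have r0: "0 \<le> r" using r by simp
    have pq: "norm (?p - ?q) \<le> (1 + C) * norm (x - y)"
    proof -
      have "norm (?p - ?q) \<le> norm (?p - ?q - (x - y)) + norm (x - y)"
        using norm_triangle_ineq[of "?p - ?q - (x - y)" "x - y"] by simp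
      also have "norm (?p - ?q - (x - y)) \<le> C * r * norm (x - y)" using C r by simp
      also have "C * r * norm (x - y) \<le> C * 1 * norm (x - y)"
        using C r by (intro mult_right_mono mult_left_mono) auto
      finally show ?thesis by (simp add: algebra_simps)
    qed
    have "norm (\<Phi> i ?t ?p - \<Phi> i ?t ?q - (?p - ?q)) \<le> B * exp ((B + 1) * \<bar>?t\<bar>) * norm (?p - ?q) * \<bar>?t\<bar>"
      by (rule F.\<phi>_near_diff)
    also have "\<dots> \<le> (B * exp (B + 1)) * ((1 + C) * norm (x - y)) * r"
    proof (intro mult_mono pq t)
      have "(B + 1) * \<bar>?t\<bar> \<le> (B + 1) * 1" using t r B_nonneg by (intro mult_left_mono) auto
      then show "exp ((B + 1) * \<bar>?t\<bar>) \<le> exp (B + 1)" by simp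
    qed (use B_nonneg C r0 in auto)
    finally have "norm (\<Phi> i ?t ?p - \<Phi> i ?t ?q - (?p - ?q)) \<le> E * (1 + C) * r * norm (x - y)"
      by (simp add: E_def mult_ac)
    moreover have "norm (?p - ?q - (x - y)) \<le> C * r * norm (x - y)" using C r by simp
    ultimately have "norm ((\<Phi> i ?t ?p - \<Phi> i ?t ?q - (?p - ?q)) + (?p - ?q - (x - y))) \<le>
        E * (1 + C) * r * norm (x - y) + C * r * norm (x - y)"
      by (rule norm_triangle_le[OF add_mono])
    then show ?thesis by (simp add: s algebra_simps)
  qed
  then show ?case using C(1) E by (intro exI[of _ "C + E * (1 + C)"]) auto
qed

end

section \<open>Expansions in iterated brackets\<close>

text \<open>The truncated fields are known to be smooth only on \<open>G\<close>. Brackets are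
  expanded there, and every estimate is local at \<open>x0\<close>.\<close>

locale smooth_near = C11_fields Y B for Y :: "'m \<Rightarrow> 'a::euclidean_space \<Rightarrow> 'a" and B +
  fixes G :: "'a set" and x0 :: 'a
  assumes open_G: "open G" and x0_G: "x0 \<in> G" and smooth_Y: "smooth_on G (Y i)"
begin

text \<open>As \<open>r\<close> tends to 0 and \<open>y\<close> to \<open>x0\<close>, uniformly in
  \<open>\<bar>u\<bar> \<le> r\<close>. A whole neighbourhood of \<open>x0\<close> is required
  because flows displace the point at which a field is evaluated.\<close>

definition ev :: "(real \<Rightarrow> real \<Rightarrow> 'a \<Rightarrow> bool) \<Rightarrow> bool" where
  "ev P \<longleftrightarrow> (\<exists>\<delta>>0. \<forall>r u y. 0 < r \<longrightarrow> r < \<delta> \<longrightarrow> \<bar>u\<bar> \<le> r \<longrightarrow> norm (y - x0) < \<delta> \<longrightarrow> P r u y)"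

lemma evI:
  assumes "\<delta> > 0" "\<And>r u y. 0 < r \<Longrightarrow> r < \<delta> \<Longrightarrow> \<bar>u\<bar> \<le> r \<Longrightarrow> norm (y - x0) < \<delta> \<Longrightarrow> P r u y"
  shows "ev P"
  using assms unfolding ev_def by blast

lemma ev_conj: "ev P \<Longrightarrow> ev Q \<Longrightarrow> ev (\<lambda>r u y. P r u y \<and> Q r u y)"
  unfolding ev_def
proof (elim exE conjE)
  fix \<delta> \<delta>'
  assume "0 < \<delta>" "0 < \<delta>'"
    and "\<forall>r u y. 0 < r \<longrightarrow> r < \<delta> \<longrightarrow> \<bar>u\<bar> \<le> r \<longrightarrow> norm (y - x0) < \<delta> \<longrightarrow> P r u y"
    and "\<forall>r u y. 0 < r \<longrightarrow> r < \<delta>' \<longrightarrow> \<bar>u\<bar> \<le> r \<longrightarrow> norm (y - x0) < \<delta>' \<longrightarrow> Q r u y"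
  then show "\<exists>\<delta>>0. \<forall>r u y. 0 < r \<longrightarrow> r < \<delta> \<longrightarrow> \<bar>u\<bar> \<le> r \<longrightarrow> norm (y - x0) < \<delta> \<longrightarrow> P r u y \<and> Q r u y"
    by (intro exI[of _ "min \<delta> \<delta>'"]) auto
qed

lemma ev_mono: "ev P \<Longrightarrow> (\<And>r u y. 0 < r \<Longrightarrow> r \<le> 1 \<Longrightarrow> \<bar>u\<bar> \<le> r \<Longrightarrow> P r u y \<Longrightarrow> Q r u y) \<Longrightarrow> ev Q"
  unfolding ev_def
proof (elim exE conjE)
  fix \<delta>
  assume "0 < \<delta>" and "\<And>r u y. 0 < r \<Longrightarrow> r \<le> 1 \<Longrightarrow> \<bar>u\<bar> \<le> r \<Longrightarrow> P r u y \<Longrightarrow> Q r u y"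
    and "\<forall>r u y. 0 < r \<longrightarrow> r < \<delta> \<longrightarrow> \<bar>u\<bar> \<le> r \<longrightarrow> norm (y - x0) < \<delta> \<longrightarrow> P r u y"
  then show "\<exists>\<delta>>0. \<forall>r u y. 0 < r \<longrightarrow> r < \<delta> \<longrightarrow> \<bar>u\<bar> \<le> r \<longrightarrow> norm (y - x0) < \<delta> \<longrightarrow> Q r u y"
    by (intro exI[of _ "min \<delta> 1"]) auto
qed

definition small_times :: "(real \<Rightarrow> real \<Rightarrow> real) \<Rightarrow> bool" where
  "small_times \<tau> \<longleftrightarrow> (\<forall>r u. \<bar>u\<bar> \<le> r \<longrightarrow> \<bar>\<tau> r u\<bar> \<le> r)"

lemma small_timesD: "small_times \<tau> \<Longrightarrow> \<bar>u\<bar> \<le> r \<Longrightarrow> \<bar>\<tau> r u\<bar> \<le> r"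
  by (simp add: small_times_def)

text \<open>A flow for a time of at most \<open>r\<close> displaces points by at most
  \<open>B * r\<close>, so shrinking the neighbourhood by the factor \<open>B + 1\<close> is
  enough.\<close>

lemma ev_flow:
  assumes "ev P"
  shows "ev (\<lambda>r u y. \<forall>s. \<bar>s\<bar> \<le> r \<longrightarrow> P r u (\<Phi> i s y))"
proof -
  obtain \<delta> where \<delta>: "\<delta> > 0" "\<And>r u y. 0 < r \<Longrightarrow> r < \<delta> \<Longrightarrow> \<bar>u\<bar> \<le> r \<Longrightarrow> norm (y - x0) < \<delta> \<Longrightarrow> P r u y"
    using assms unfolding ev_def by blast
  show ?thesis
  proof (rule evI[of "\<delta> / (B + 1)"])
    show "\<delta> / (B + 1) > 0" using \<delta>(1) B_nonneg by simp
    fix r u y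
    assume r: "0 < r" "r < \<delta> / (B + 1)" "\<bar>u\<bar> \<le> r" and y: "norm (y - x0) < \<delta> / (B + 1)"
    show "\<forall>s. \<bar>s\<bar> \<le> r \<longrightarrow> P r u (\<Phi> i s y)"
    proof (intro allI impI \<delta>(2) r(1,3))
      have "\<delta> / (B + 1) \<le> \<delta>" using \<delta>(1) B_nonneg by (simp add: field_simps)
      then show "r < \<delta>" using r by simp
      fix s assume s: "\<bar>s\<bar> \<le> r"
      have "norm (\<Phi> i s y - x0) \<le> norm (\<Phi> i s y - y) + norm (y - x0)"
        using norm_triangle_ineq[of "\<Phi> i s y - y" "y - x0"] by simp
      also have "norm (\<Phi> i s y - y) \<le> B * r"
        using F.\<phi>_near[of i s y] mult_left_mono[OF s B_nonneg] by simp
      also have "B * r + norm (y - x0) < B * (\<delta> / (B + 1)) + \<delta> / (B + 1)"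
        using r y B_nonneg by (intro add_le_less_mono mult_left_mono) auto
      also have "\<dots> = (B + 1) * (\<delta> / (B + 1))" by (simp only: distrib_right mult_1_left)
      also have "\<dots> = \<delta>" using B_nonneg by simp
      finally show "norm (\<Phi> i s y - x0) < \<delta>" by simp
    qed
  qed
qed

lemma ev_G: "ev (\<lambda>r u y. y \<in> G)"
proof -
  obtain e where "e > 0" "ball x0 e \<subseteq> G" using open_G x0_G open_contains_ball by blast
  then show ?thesis by (intro evI[of e]) (auto simp: subset_eq dist_norm norm_minus_commute)
qed

lemma ev_bounded:
  assumes "smooth_on G Z"
  shows "\<exists>C\<ge>0. ev (\<lambda>r u y. norm (Z y) \<le> C)"
proof -
  have "continuous (at x0) Z"
    using smooth_on_continuous_on[OF assms] open_G x0_G continuous_on_eq_continuous_at by blast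
  then obtain d where d: "d > 0" "\<And>y. dist y x0 < d \<Longrightarrow> dist (Z y) (Z x0) < 1"
    unfolding continuous_at_eps_delta by (metis dist_norm zero_less_one)
  have "norm (Z y) \<le> norm (Z x0) + 1" if "norm (y - x0) < d" for y
    using d(2)[of y] that norm_triangle_ineq[of "Z y - Z x0" "Z x0"] by (simp add: dist_norm)
  then show ?thesis using d(1) by (intro exI[of _ "norm (Z x0) + 1"] conjI evI[of d]) auto
qed

definition ordO :: "nat \<Rightarrow> (real \<Rightarrow> real \<Rightarrow> 'a \<Rightarrow> 'a) \<Rightarrow> bool" where
  "ordO K V \<longleftrightarrow> (\<exists>C\<ge>0. ev (\<lambda>r u y. norm (V r u y) \<le> C * r ^ K))"

lemma ordO_add:
  assumes "ordO K V" "ordO K W"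
  shows "ordO K (\<lambda>r u y. V r u y + W r u y)"
proof -
  obtain C D where C: "C \<ge> 0" "ev (\<lambda>r u y. norm (V r u y) \<le> C * r ^ K)"
    and D: "D \<ge> 0" "ev (\<lambda>r u y. norm (W r u y) \<le> D * r ^ K)"
    using assms unfolding ordO_def by blast
  have "ev (\<lambda>r u y. norm (V r u y + W r u y) \<le> (C + D) * r ^ K)"
    by (rule ev_mono[OF ev_conj[OF C(2) D(2)]]) (auto simp: distrib_right intro!: norm_triangle_le add_mono)
  then show ?thesis using C D unfolding ordO_def by (intro exI[of _ "C + D"]) auto
qed

lemma ordO_minus: "ordO K V \<Longrightarrow> ordO K (\<lambda>r u y. - V r u y)"
  by (simp add: ordO_def)

lemma ordO_Ad:
  assumes "ordO K V" "small_times \<tau>"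
  shows "ordO K (\<lambda>r u y. AD i (\<tau> r u) (V r u) y)"
proof -
  obtain C where C: "C \<ge> 0" "ev (\<lambda>r u y. norm (V r u y) \<le> C * r ^ K)"
    using assms unfolding ordO_def by blast
  have "ev (\<lambda>r u y. norm (AD i (\<tau> r u) (V r u) y) \<le> exp (B + 1) * C * r ^ K)"
  proof (rule ev_mono[OF ev_flow[OF C(2), of i]])
    fix r u :: real and y
    assume r: "0 < r" "r \<le> 1" "\<bar>u\<bar> \<le> r" and le: "\<forall>s. \<bar>s\<bar> \<le> r \<longrightarrow> norm (V r u (\<Phi> i s y)) \<le> C * r ^ K"
    have t: "\<bar>\<tau> r u\<bar> \<le> r" using small_timesD[OF assms(2) r(3)] .
    have "norm (AD i (\<tau> r u) (V r u) y) \<le> exp ((B + 1) * \<bar>\<tau> r u\<bar>) * norm (V r u (\<Phi> i (- \<tau> r u) y))"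
      by (rule F.Ad_norm)
    also have "\<dots> \<le> exp (B + 1) * (C * r ^ K)"
    proof (intro mult_mono)
      have "(B + 1) * \<bar>\<tau> r u\<bar> \<le> (B + 1) * 1" using t r B_nonneg by (intro mult_left_mono) auto
      then show "exp ((B + 1) * \<bar>\<tau> r u\<bar>) \<le> exp (B + 1)" by simp
    qed (use le t in auto)
    finally show "norm (AD i (\<tau> r u) (V r u) y) \<le> exp (B + 1) * C * r ^ K" by simp
  qed
  then show ?thesis using C(1) unfolding ordO_def by (intro exI[of _ "exp (B + 1) * C"]) auto
qed

text \<open>Finite sums of smooth fields with scalar coefficients of order r^k. The dependence on
  \<open>r\<close> and \<open>u\<close> sits in the coefficients, so a bracket acts on the fields
  and leaves the order alone.\<close>

inductive poly :: "nat \<Rightarrow> (real \<Rightarrow> real \<Rightarrow> 'a \<Rightarrow> 'a) \<Rightarrow> bool" for k where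
  zero: "poly k (\<lambda>r u y. 0)"
| step: "smooth_on G Z \<Longrightarrow> C \<ge> 0 \<Longrightarrow>
    (\<And>r u. 0 < r \<Longrightarrow> r \<le> 1 \<Longrightarrow> \<bar>u\<bar> \<le> r \<Longrightarrow> \<bar>c r u\<bar> \<le> C * r ^ k) \<Longrightarrow>
    poly k V \<Longrightarrow> poly k (\<lambda>r u y. c r u *\<^sub>R Z y + V r u y)"

lemma poly_add: "poly k V \<Longrightarrow> poly k W \<Longrightarrow> poly k (\<lambda>r u y. V r u y + W r u y)"
proof (induction rule: poly.induct)
  case (step Z C c V)
  from poly.step[OF step.hyps(1-3) step.IH[OF step.prems]] show ?case by (simp add: add.assoc)
qed simp

lemma poly_single:
  assumes "smooth_on G Z" "C \<ge> 0" "\<And>r u. 0 < r \<Longrightarrow> r \<le> 1 \<Longrightarrow> \<bar>u\<bar> \<le> r \<Longrightarrow> \<bar>c r u\<bar> \<le> C * r ^ k"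
  shows "poly k (\<lambda>r u y. c r u *\<^sub>R Z y)"
  using poly.step[OF assms zero] by simp

lemma poly_mono: "poly k V \<Longrightarrow> k' \<le> k \<Longrightarrow> poly k' V"
proof (induction rule: poly.induct)
  case (step Z C c V)
  have "\<bar>c r u\<bar> \<le> C * r ^ k'" if "0 < r" "r \<le> 1" "\<bar>u\<bar> \<le> r" for r u
  proof -
    have "C * r ^ k \<le> C * r ^ k'" using that step.hyps step.prems by (intro mult_left_mono power_decreasing) auto
    then show ?thesis using step.hyps(3)[OF that] by simp
  qed
  then show ?case using step by (intro poly.step) auto
qed (simp add: poly.zero)

lemma ordO_single:
  assumes "smooth_on G Z" "C \<ge> 0" "\<And>r u. 0 < r \<Longrightarrow> r \<le> 1 \<Longrightarrow> \<bar>u\<bar> \<le> r \<Longrightarrow> \<bar>c r u\<bar> \<le> C * r ^ k"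
  shows "ordO k (\<lambda>r u y. c r u *\<^sub>R Z y)"
proof -
  obtain M where M: "M \<ge> 0" "ev (\<lambda>r u y. norm (Z y) \<le> M)" using ev_bounded[OF assms(1)] by blast
  have "ev (\<lambda>r u y. norm (c r u *\<^sub>R Z y) \<le> (C * M) * r ^ k)"
  proof (rule ev_mono[OF M(2)])
    fix r u :: real and y
    assume r: "0 < r" "r \<le> 1" "\<bar>u\<bar> \<le> r" and le: "norm (Z y) \<le> M"
    have "\<bar>c r u\<bar> * norm (Z y) \<le> (C * r ^ k) * M"
      using assms(2) assms(3)[OF r] le r by (intro mult_mono) auto
    then show "norm (c r u *\<^sub>R Z y) \<le> (C * M) * r ^ k" by (simp add: mult_ac)
  qed
  then show ?thesis using M assms(2) unfolding ordO_def by (intro exI[of _ "C * M"]) auto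
qed

lemma poly_ordO: "poly k V \<Longrightarrow> ordO k V"
proof (induction rule: poly.induct)
  case zero
  show ?case unfolding ordO_def by (auto intro!: exI[of _ 0] evI[of 1])
next
  case (step Z C c V)
  then show ?case by (intro ordO_add ordO_single) auto
qed

text \<open>Remainders are only required to be bounded, not differentiable: \<open>Ad\<close> preserves their size, and brackets
  are only taken of the smooth part.\<close>

definition MM :: "nat \<Rightarrow> (real \<Rightarrow> real \<Rightarrow> 'a \<Rightarrow> 'a) \<Rightarrow> bool" where
  "MM k V \<longleftrightarrow> (\<forall>K. \<exists>W. poly k W \<and> ordO K (\<lambda>r u y. V r u y - W r u y))"

text \<open>Approximation to every order by members of \<open>MM\<close> suffices. The push-forward
  of such a field is reached only in this way, since each order \<open>K\<close> has its own smooth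
  part.\<close>

lemma MM_I:
  assumes "\<And>K. \<exists>V'. MM k V' \<and> ordO K (\<lambda>r u y. V r u y - V' r u y)"
  shows "MM k V"
  unfolding MM_def
proof
  fix K
  obtain V' W where "poly k W" "ordO K (\<lambda>r u y. V r u y - V' r u y)" "ordO K (\<lambda>r u y. V' r u y - W r u y)"
    using assms[of K] unfolding MM_def by meson
  with ordO_add[OF this(2,3)] show "\<exists>W. poly k W \<and> ordO K (\<lambda>r u y. V r u y - W r u y)" by auto
qed

lemma ordO_zero: "ordO K (\<lambda>r u y. 0)"
  unfolding ordO_def by (auto intro!: exI[of _ 0] evI[of 1])

lemma MM_poly: "poly k V \<Longrightarrow> MM k V"
  unfolding MM_def using ordO_zero by (auto intro!: exI[of _ V])

lemma MM_add:
  assumes "MM k V" "MM k W"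
  shows "MM k (\<lambda>r u y. V r u y + W r u y)"
  unfolding MM_def
proof
  fix K
  obtain V' W' where "poly k V'" "ordO K (\<lambda>r u y. V r u y - V' r u y)" "poly k W'" "ordO K (\<lambda>r u y. W r u y - W' r u y)"
    using assms unfolding MM_def by meson
  with poly_add[OF this(1,3)] ordO_add[OF this(2,4)]
  show "\<exists>Z. poly k Z \<and> ordO K (\<lambda>r u y. V r u y + W r u y - Z r u y)"
    by (intro exI[of _ "\<lambda>r u y. V' r u y + W' r u y"]) (simp add: algebra_simps)
qed

lemma MM_mono: "MM k V \<Longrightarrow> k' \<le> k \<Longrightarrow> MM k' V"
  unfolding MM_def using poly_mono by blast

lemma MM_ordO: 
  assumes "MM k V"
  shows "ordO k V"
proof -
  obtain W where "poly k W" "ordO k (\<lambda>r u y. V r u y - W r u y)" using assms unfolding MM_def by meson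
  with ordO_add[OF this(2) poly_ordO[OF this(1)]] show ?thesis by simp
qed

lemma MM_zero: "MM k (\<lambda>r u y. 0)"
  by (intro MM_poly poly.zero)

definition br :: "'m \<Rightarrow> nat \<Rightarrow> ('a \<Rightarrow> 'a) \<Rightarrow> 'a \<Rightarrow> 'a" where
  "br i l Z = (lie_bracket (Y i) ^^ l) Z"

lemma smooth_br: "smooth_on G Z \<Longrightarrow> smooth_on G (br i l Z)"
  unfolding br_def by (induction l) (auto intro: smooth_on_lie_bracket open_G smooth_Y)

lemma poly_sum:
  "finite I \<Longrightarrow> (\<And>l. l \<in> I \<Longrightarrow> poly k (V l)) \<Longrightarrow> poly k (\<lambda>r u y. \<Sum>l\<in>I. V l r u y)"
  by (induction I rule: finite_induct) (auto intro: poly.zero poly_add)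

text \<open>Taylor expansion to order \<open>K0 + K\<close>. The terms below \<open>K0\<close> are
  subtracted in the statement, the next \<open>K\<close> terms form the smooth part, and the
  remainder is of order \<open>K\<close>.\<close>

lemma Ad_single:
  assumes Z: "smooth_on G Z" and C: "C \<ge> 0"
    and c: "\<And>r u. 0 < r \<Longrightarrow> r \<le> 1 \<Longrightarrow> \<bar>u\<bar> \<le> r \<Longrightarrow> \<bar>c r u\<bar> \<le> C * r ^ k"
    and \<tau>: "small_times \<tau>"
  shows "MM (k + K0) (\<lambda>r u y. AD i (\<tau> r u) (\<lambda>y. c r u *\<^sub>R Z y) y
    - (\<Sum>l<K0. (c r u * (- \<tau> r u) ^ l / fact l) *\<^sub>R br i l Z y))"
  unfolding MM_def
proof
  fix K
  define W where "W r u y = (\<Sum>l\<in>{K0..<K0+K}. (c r u * (- \<tau> r u) ^ l / fact l) *\<^sub>R br i l Z y)" for r u y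
  have pw: "\<bar>\<tau> r u\<bar> ^ l \<le> r ^ l" if "0 < r" "\<bar>u\<bar> \<le> r" for r u l
    using small_timesD[OF \<tau> that(2)] by (intro power_mono) auto
  have "poly (k + K0) W"
    unfolding W_def
  proof (intro poly_sum poly_single[OF smooth_br[OF Z] C])
    fix l r u assume l: "l \<in> {K0..<K0+K}" and r: "0 < r" "r \<le> (1::real)" "\<bar>u\<bar> \<le> r"
    have "\<bar>c r u * (- \<tau> r u) ^ l / fact l\<bar> \<le> \<bar>c r u\<bar> * \<bar>\<tau> r u\<bar> ^ l"
      using mult_left_mono[OF fact_ge_1[of l], of "\<bar>c r u\<bar> * \<bar>\<tau> r u\<bar> ^ l"]
      by (simp add: abs_mult power_abs divide_le_eq)
    also have "\<dots> \<le> (C * r ^ k) * r ^ l" using c[OF r] pw[OF r(1,3)] C r by (intro mult_mono) auto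
    also have "\<dots> \<le> (C * r ^ k) * r ^ K0"
      using l r C by (intro mult_left_mono power_decreasing) auto
    finally show "\<bar>c r u * (- \<tau> r u) ^ l / fact l\<bar> \<le> C * r ^ (k + K0)" by (simp add: power_add)
  qed simp
  moreover have "ordO K (\<lambda>r u y. AD i (\<tau> r u) (\<lambda>y. c r u *\<^sub>R Z y) y
    - (\<Sum>l<K0. (c r u * (- \<tau> r u) ^ l / fact l) *\<^sub>R br i l Z y) - W r u y)"
  proof -
    obtain M where M: "M \<ge> 0" "ev (\<lambda>r u y. norm (br i (K0 + K) Z y) \<le> M)"
      using ev_bounded[OF smooth_br[OF Z]] by blast
    define D where "D = C * (DIM('a) * exp (B + 1) * M)"
    have "ev (\<lambda>r u y. norm (AD i (\<tau> r u) (\<lambda>y. c r u *\<^sub>R Z y) y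
      - (\<Sum>l<K0. (c r u * (- \<tau> r u) ^ l / fact l) *\<^sub>R br i l Z y) - W r u y) \<le> D * r ^ K)"
    proof (rule ev_mono[OF ev_flow[OF ev_conj[OF ev_G M(2)], of i]])
      fix r u :: real and y
      assume r: "0 < r" "r \<le> 1" "\<bar>u\<bar> \<le> r"
        and le: "\<forall>s. \<bar>s\<bar> \<le> r \<longrightarrow> \<Phi> i s y \<in> G \<and> norm (br i (K0 + K) Z (\<Phi> i s y)) \<le> M"
      let ?t = "\<tau> r u"
      have t: "\<bar>?t\<bar> \<le> r" using small_timesD[OF \<tau> r(3)] .
      let ?R = "AD i ?t Z y - (\<Sum>l<K0+K. ((- ?t) ^ l / fact l) *\<^sub>R br i l Z y)"
      have R: "norm ?R \<le> DIM('a) * exp ((B + 1) * \<bar>?t\<bar>) * M * \<bar>?t\<bar> ^ (K0 + K)"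
        unfolding br_def
      proof (rule F.Ad_taylor[OF open_G smooth_Y Z])
        fix s assume "\<bar>s\<bar> \<le> \<bar>?t\<bar>"
        then have "\<bar>- s\<bar> \<le> r" using t by simp
        with le show "\<Phi> i (- s) y \<in> G" "norm ((lie_bracket (Y i) ^^ (K0 + K)) Z (\<Phi> i (- s) y)) \<le> M"
          unfolding br_def by blast+
      qed
      have eq: "AD i ?t (\<lambda>y. c r u *\<^sub>R Z y) y - (\<Sum>l<K0. (c r u * (- ?t) ^ l / fact l) *\<^sub>R br i l Z y) - W r u y
          = c r u *\<^sub>R ?R"
      proof -
        have "(\<Sum>l<K0+K. (c r u * (- ?t) ^ l / fact l) *\<^sub>R br i l Z y) =
            (\<Sum>l<K0. (c r u * (- ?t) ^ l / fact l) *\<^sub>R br i l Z y) + W r u y"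
          unfolding W_def atLeast0LessThan[symmetric] by (rule sum.atLeastLessThan_concat[symmetric]) auto
        moreover have "c r u *\<^sub>R (\<Sum>l<K0+K. ((- ?t) ^ l / fact l) *\<^sub>R br i l Z y) =
            (\<Sum>l<K0+K. (c r u * (- ?t) ^ l / fact l) *\<^sub>R br i l Z y)"
          by (simp add: scaleR_sum_right)
        ultimately show ?thesis by (simp add: F.Ad_scaleR scaleR_diff_right)
      qed
      have "norm (c r u *\<^sub>R ?R) \<le> (C * r ^ k) * (DIM('a) * exp ((B + 1) * \<bar>?t\<bar>) * M * \<bar>?t\<bar> ^ (K0 + K))"
        unfolding norm_scaleR using c[OF r] R C r by (intro mult_mono) auto
      also have "\<dots> \<le> (C * 1) * (DIM('a) * exp (B + 1) * M * r ^ K)"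
      proof (intro mult_mono)
        have "(B + 1) * \<bar>?t\<bar> \<le> (B + 1) * 1" using t r B_nonneg by (intro mult_left_mono) auto
        then show "exp ((B + 1) * \<bar>?t\<bar>) \<le> exp (B + 1)" by simp
        have "\<bar>?t\<bar> ^ (K0 + K) \<le> r ^ (K0 + K)" using pw[OF r(1,3)] .
        also have "\<dots> \<le> r ^ K" using r by (intro power_decreasing) auto
        finally show "\<bar>?t\<bar> ^ (K0 + K) \<le> r ^ K" .
        show "r ^ k \<le> 1" using r by (intro power_le_one) auto
      qed (use C M r in auto)
      finally show "norm (AD i ?t (\<lambda>y. c r u *\<^sub>R Z y) y
          - (\<Sum>l<K0. (c r u * (- ?t) ^ l / fact l) *\<^sub>R br i l Z y) - W r u y) \<le> D * r ^ K"
        unfolding eq by (simp add: D_def mult_ac)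
    qed
    then show ?thesis using C M(1) unfolding ordO_def by (intro exI[of _ D]) (auto simp: D_def)
  qed
  ultimately show "\<exists>W. poly (k + K0) W \<and> ordO K (\<lambda>r u y. AD i (\<tau> r u) (\<lambda>y. c r u *\<^sub>R Z y) y
    - (\<Sum>l<K0. (c r u * (- \<tau> r u) ^ l / fact l) *\<^sub>R br i l Z y) - W r u y)" by blast
qed

lemma Ad_poly:
  assumes "small_times \<tau>"
  shows "poly k V \<Longrightarrow> MM (k + 1) (\<lambda>r u y. AD i (\<tau> r u) (V r u) y - V r u y)"
proof (induction rule: poly.induct)
  case zero
  show ?case by (simp add: F.Ad_zero MM_zero)
next
  case (step Z C c V)
  have "MM (k + 1) (\<lambda>r u y. AD i (\<tau> r u) (\<lambda>y. c r u *\<^sub>R Z y) y - c r u *\<^sub>R Z y)"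
    using Ad_single[OF step.hyps(1-3) assms, where ?K0.0 = 1 and i = i] by (simp add: br_def)
  from MM_add[OF this step.IH] show ?case by (simp add: F.Ad_add algebra_simps)
qed

text \<open>Split \<open>V\<close> into a smooth part and a remainder of order \<open>K\<close>. On
  the smooth part the difference gains one order by Taylor expansion; on the remainder push-forward
  only preserves the order, which suffices because \<open>K\<close> is arbitrary.\<close>

lemma Ad_MM:
  assumes "small_times \<tau>" "MM k V"
  shows "MM (k + 1) (\<lambda>r u y. AD i (\<tau> r u) (V r u) y - V r u y)"
proof (rule MM_I)
  fix K
  obtain W where W: "poly k W" "ordO K (\<lambda>r u y. V r u y - W r u y)" using assms(2) unfolding MM_def by meson
  have "ordO K (\<lambda>r u y. AD i (\<tau> r u) (\<lambda>y. V r u y - W r u y) y + - (V r u y - W r u y))"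
    by (intro ordO_add ordO_minus ordO_Ad W assms(1))
  then have "ordO K (\<lambda>r u y. AD i (\<tau> r u) (V r u) y - V r u y - (AD i (\<tau> r u) (W r u) y - W r u y))"
    by (simp add: F.Ad_diff algebra_simps)
  then show "\<exists>V'. MM (k + 1) V' \<and> ordO K (\<lambda>r u y. AD i (\<tau> r u) (V r u) y - V r u y - V' r u y)"
    using Ad_poly[OF assms(1) W(1), of i] by blast
qed

lemma Adl_MM:
  assumes "good_steps l" "MM k V"
  shows "MM (k + 1) (\<lambda>r u y. Adl l r u (V r u) y - V r u y)"
  using assms(1)
proof (induction l)
  case Nil
  show ?case by (simp add: MM_zero)
next
  case (Cons s l)
  obtain i b a where s: "s = (i, b, a)" by (cases s) auto
  have t: "small_times (\<lambda>r u. b * r + a * u)" using Cons.prems step_time by (auto simp: small_times_def s)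
  have IH: "MM (k + 1) (\<lambda>r u y. Adl l r u (V r u) y - V r u y)" using Cons by (simp add: s)
  have "MM k (\<lambda>r u y. (Adl l r u (V r u) y - V r u y) + V r u y)"
    by (intro MM_add assms(2) MM_mono[OF IH]) simp
  then have "MM k (\<lambda>r u. Adl l r u (V r u))" by simp
  from MM_add[OF Ad_MM[OF t this, of i] IH] show ?case by (simp add: s)
qed

lemma smooth_nest: "smooth_on G (nest w)"
proof (induction w)
  case Nil
  then show ?case by (simp add: smooth_on_def)
next
  case (Cons i w)
  then show ?case by (cases w) (auto intro: smooth_Y smooth_on_lie_bracket open_G)
qed

text \<open>Induction on the word. The difference in \<open>vel_chain_Cons\<close> turns the leading
  term r^(d-1) Z of the inner chain into r^d [Y_i, Z], with an error of order d+1; the push-forwards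
  outside it change a field of order d only at order d+1.\<close>

lemma vel_chain:
  assumes "w \<noteq> []"
  shows "MM (length w) (\<lambda>r u y. vel (chain w) r u y - r ^ (length w - 1) *\<^sub>R nest w y)"
  using assms
proof (induction w)
  case (Cons i w)
  show ?case
  proof (cases "w = []")
    case True
    then show ?thesis by (simp add: vel_Nil_fun F.Ad_zero MM_zero)
  next
    case False
    define d where "d = length w"
    have d: "d \<ge> 1" using False by (cases w) (auto simp: d_def)
    let ?v = "vel (chain w)" and ?c = "\<lambda>r::real. r ^ (d - 1)"
    have IH: "MM d (\<lambda>r u y. ?v r u y - ?c r *\<^sub>R nest w y)" using Cons False by (simp add: d_def)
    have tm: "small_times (\<lambda>r u. - r)" "small_times (\<lambda>r u. r)" by (auto simp: small_times_def)
    \<comment> \<open>Two Taylor terms are split off: the zeroth cancels in the difference, the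
      first is the new bracket. The time \<open>- r\<close> makes its sign positive.\<close>
    have "MM (d - 1 + 2) (\<lambda>r u y. AD i (- r) (\<lambda>y. ?c r *\<^sub>R nest w y) y
        - (\<Sum>l<2. (?c r * (- (- r)) ^ l / fact l) *\<^sub>R br i l (nest w) y))"
      by (rule Ad_single[OF smooth_nest, of 1]) (use tm in auto)
    then have A: "MM (d + 1) (\<lambda>r u y. AD i (- r) (\<lambda>y. ?c r *\<^sub>R nest w y) y
        - ?c r *\<^sub>R nest w y - r ^ d *\<^sub>R nest (i # w) y)"
      using d by (simp add: numeral_2_eq_2 br_def nest_Cons[OF False] power_eq_if[of _ d] algebra_simps)
    define P where "P r u y = AD i (- r) (?v r u) y - ?v r u y" for r u y
    have B: "MM (d + 1) (\<lambda>r u y. P r u y - r ^ d *\<^sub>R nest (i # w) y)"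
    proof -
      have "MM (d + 1) (\<lambda>r u y. AD i (- r) (\<lambda>y. ?v r u y - ?c r *\<^sub>R nest w y) y
          - (?v r u y - ?c r *\<^sub>R nest w y))"
        using Ad_MM[OF tm(1) IH] .
      from MM_add[OF this A] show ?thesis unfolding P_def by (simp add: F.Ad_diff algebra_simps)
    qed
    have "poly d (\<lambda>r u y. r ^ d *\<^sub>R nest (i # w) y)"
      by (rule poly_single[OF smooth_nest, of 1]) auto
    from MM_add[OF MM_mono[OF B] MM_poly[OF this]] have P: "MM d P" by (simp add: eta_contract_eq)
    let ?l = "inv_steps (chain w)"
    define Q where "Q r u = Adl ?l r u (P r u)" for r u
    have C: "MM (d + 1) (\<lambda>r u y. Q r u y - P r u y)"
      using Adl_MM[OF _ P, of ?l] good_chain by (simp add: Q_def)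
    from MM_add[OF MM_mono[OF C] P] have Q: "MM d Q" by simp
    have "MM (d + 1) (\<lambda>r u y. AD i r (Q r u) y - Q r u y)" using Ad_MM[OF tm(2) Q] .
    from MM_add[OF MM_add[OF this C] B]
    have "MM (d + 1) (\<lambda>r u y. AD i r (Q r u) y - r ^ d *\<^sub>R nest (i # w) y)" by simp
    moreover have "vel (chain (i # w)) r u = AD i r (Q r u)" for r u
      unfolding vel_chain_Cons[OF False] Q_def P_def ..
    ultimately show ?thesis by (simp add: d_def)
  qed
qed simp

lemma vel_chain_ordO:
  "w \<noteq> [] \<Longrightarrow> ordO (length w) (\<lambda>r u y. vel (chain w) r u y - r ^ (length w - 1) *\<^sub>R nest w y)"
  by (rule MM_ordO[OF vel_chain])

end

section \<open>Families of chains attached to a basis\<close>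

context C11_fields
begin

text \<open>Chains with all times fixed. The perimeter estimates see such a chain only through its
  \<open>total_time\<close>.\<close>

definition flows :: "('m \<times> real) list \<Rightarrow> 'a \<Rightarrow> 'a" where
  "flows ts x = foldr (\<lambda>(i, t). \<Phi> i t) ts x"

definition total_time :: "('m \<times> real) list \<Rightarrow> real" where
  "total_time ts = (\<Sum>(i, t)\<leftarrow>ts. \<bar>t\<bar>)"

lemma flows_simps [simp]:
  "flows [] x = x" "flows ((i, t) # ts) x = \<Phi> i t (flows ts x)"
  "flows (ts @ ts') x = flows ts (flows ts' x)"
  by (simp_all add: flows_def)

lemma total_time_simps [simp]:
  "total_time [] = 0" "total_time ((i, t) # ts) = \<bar>t\<bar> + total_time ts"
  "total_time (ts @ ts') = total_time ts + total_time ts'"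
  by (simp_all add: total_time_def)

lemma total_time_nonneg: "total_time ts \<ge> 0"
  by (induction ts) auto

definition rev_flows :: "('m \<times> real) list \<Rightarrow> ('m \<times> real) list" where
  "rev_flows ts = rev (map (\<lambda>(i, t). (i, - t)) ts)"

lemma rev_flows_simps [simp]: "rev_flows [] = []" "rev_flows ((i, t) # ts) = rev_flows ts @ [(i, - t)]"
  by (simp_all add: rev_flows_def)

lemma flows_rev_flows: "flows (rev_flows ts) (flows ts x) = x"
  by (induction ts arbitrary: x) auto

lemma flows_flows_rev: "flows ts (flows (rev_flows ts) x) = x"
  by (induction ts arbitrary: x) auto

lemma flows_continuous: "continuous_on S (flows ts)"
proof (induction ts)
  case (Cons p ts)
  obtain i t where "p = (i, t)" by (cases p)
  then show ?case
    using continuous_on_compose2[OF F.\<phi>_continuous_x[of UNIV i t] Cons] by simp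
qed simp

text \<open>One commutator chain for each word. The scaling makes the velocity in \<open>s k\<close>
  close to the bracket itself, independently of \<open>r\<close>, and for
  \<open>\<bar>s k\<bar> \<le> r ^ length (w k)\<close> the inner parameter stays within
  \<open>[- r, r]\<close>.\<close>

fun multi :: "('k \<Rightarrow> 'm list) \<Rightarrow> 'k list \<Rightarrow> real \<Rightarrow> ('k \<Rightarrow> real) \<Rightarrow> 'a \<Rightarrow> 'a" where
  "multi w [] r s y = y"
| "multi w (k # ks) r s y = app (chain (w k)) r (s k / r ^ (length (w k) - 1)) (multi w ks r s y)"

definition steps_number :: "('k \<Rightarrow> 'm list) \<Rightarrow> 'k list \<Rightarrow> nat" where
  "steps_number w ks = (\<Sum>k\<leftarrow>ks. length (chain (w k)))"

lemma scaled_time: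
  fixes r s :: real
  assumes "r > 0" "\<bar>s\<bar> \<le> r ^ d" "d > 0"
  shows "\<bar>s / r ^ (d - 1)\<bar> \<le> r"
  using assms by (cases d) (auto simp: field_simps abs_mult)

lemma app_flows:
  fixes r :: real
  assumes "good_steps l" "\<bar>u\<bar> \<le> r"
  shows "\<exists>ts. app l r u = flows ts \<and> total_time ts \<le> length l * r"
  using assms(1)
proof (induction l)
  case Nil
  show ?case by (intro exI[of _ "[]"]) auto
next
  case (Cons s l)
  obtain i b a where s: "s = (i, b, a)" by (cases s) auto
  obtain ts where ts: "app l r u = flows ts" "total_time ts \<le> length l * r" using Cons by (auto simp: s)
  have "\<bar>b * r + a * u\<bar> \<le> r" using Cons.prems assms(2) by (intro step_time) (auto simp: s)
  then show ?case using ts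
    by (intro exI[of _ "(i, b * r + a * u) # ts"]) (auto simp: s fun_eq_iff algebra_simps)
qed

text \<open>For every admissible \<open>s\<close> the map is a single chain whose total time is
  \<open>O(r)\<close>, with a constant independent of \<open>s\<close>. This bounds the cost of all
  members of the family together.\<close>

lemma multi_flows:
  fixes r :: real
  assumes "\<And>k. w k \<noteq> []" "r > 0" "\<And>k. \<bar>s k\<bar> \<le> r ^ length (w k)"
  shows "\<exists>ts. multi w ks r s = flows ts \<and> total_time ts \<le> steps_number w ks * r"
proof (induction ks)
  case Nil
  show ?case by (intro exI[of _ "[]"]) (auto simp: steps_number_def)
next
  case (Cons k ks)
  obtain ts where ts: "multi w ks r s = flows ts" "total_time ts \<le> steps_number w ks * r"
    using Cons by auto
  have "\<bar>s k / r ^ (length (w k) - 1)\<bar> \<le> r" using assms by (intro scaled_time) auto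
  from app_flows[OF good_chain this, of "w k"] obtain ts' where
    "app (chain (w k)) r (s k / r ^ (length (w k) - 1)) = flows ts'" "total_time ts' \<le> length (chain (w k)) * r"
    by blast
  then show ?case using ts
    by (intro exI[of _ "ts' @ ts"]) (auto simp: fun_eq_iff steps_number_def algebra_simps)
qed

lemma multi_near:
  assumes "\<And>k. w k \<noteq> []" "r > 0" "\<And>k. \<bar>s k\<bar> \<le> r ^ length (w k)"
  shows "norm (multi w ks r s y - y) \<le> steps_number w ks * (B * r)"
proof (induction ks)
  case (Cons k ks)
  have "\<bar>s k / r ^ (length (w k) - 1)\<bar> \<le> r" using assms by (intro scaled_time) auto
  from app_near[OF good_chain this, of "w k" "multi w ks r s y"] Cons
  have "norm (multi w (k # ks) r s y - multi w ks r s y + (multi w ks r s y - y)) \<le>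
      length (chain (w k)) * (B * r) + steps_number w ks * (B * r)"
    by (intro norm_triangle_le add_mono) auto
  then show ?case by (simp add: steps_number_def algebra_simps)
qed (simp add: steps_number_def)

lemma app_continuous:
  fixes f :: "'b::topological_space \<Rightarrow> 'a"
  assumes "continuous_on UNIV u" "continuous_on UNIV f"
  shows "continuous_on UNIV (\<lambda>p. app l r (u p) (f p))"
proof (induction l)
  case (Cons s l)
  obtain i b a where s: "s = (i, b, a)" by (cases s) auto
  have "continuous_on UNIV (\<lambda>p. (b * r + a * u p, app l r (u p) (f p)))"
    by (intro continuous_intros assms Cons)
  from continuous_on_compose2[OF F.\<phi>_continuous this, of i] show ?case by (simp add: s)
qed (simp add: assms)

lemma multi_continuous:
  fixes f :: "'b::topological_space \<Rightarrow> 'a"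
  assumes "\<And>k. continuous_on UNIV (\<lambda>p. s p k)" "continuous_on UNIV f"
  shows "continuous_on UNIV (\<lambda>p. multi w ks r (s p) (f p))"
proof (induction ks)
  case (Cons k ks)
  have "continuous_on UNIV (\<lambda>p. s p k / r ^ (length (w k) - 1))"
    unfolding divide_inverse by (intro continuous_intros assms)
  then show ?case by (simp add: app_continuous Cons)
qed (simp add: assms)

end

section \<open>Strict differentiability of the chain maps, uniformly in the scale\<close>

context smooth_near
begin

text \<open>Strict differentiability in \<open>(s, z)\<close>, with a neighbourhood that works for
  all small scales. In \<open>s\<close> it is the mean value inequality: the rescaled velocity is
  within \<open>C2 * r\<close> of the bracket at the end point, which is close to the bracket at
  \<open>x0\<close>. In \<open>z\<close> the chain is the identity up to
  \<open>C1 * r\<close>.\<close>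

lemma chain_strict:
  assumes w: "w \<noteq> []" and \<epsilon>: "\<epsilon> > 0"
  shows "\<exists>\<delta>>0. \<forall>r s s' z z'. 0 < r \<longrightarrow> r < \<delta> \<longrightarrow> \<bar>s\<bar> \<le> r ^ length w \<longrightarrow> \<bar>s'\<bar> \<le> r ^ length w \<longrightarrow>
    norm (z - x0) < \<delta> \<longrightarrow> norm (z' - x0) < \<delta> \<longrightarrow>
    norm (app (chain w) r (s / r ^ (length w - 1)) z - app (chain w) r (s' / r ^ (length w - 1)) z'
      - (z - z') - (s - s') *\<^sub>R nest w x0) \<le> \<epsilon> * (norm (z - z') + \<bar>s - s'\<bar>)"
proof -
  define d where "d = length w"
  have d: "d > 0" using w by (simp add: d_def)
  let ?A = "\<lambda>r s z. app (chain w) r (s / r ^ (d - 1)) z"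
  define N where "N = real (length (chain w))"
  have N: "N \<ge> 0" by (simp add: N_def)
  obtain C1 where C1: "C1 \<ge> 0" "\<And>r u x y. \<bar>u\<bar> \<le> r \<Longrightarrow> r \<le> 1 \<Longrightarrow>
      norm (app (chain w) r u x - app (chain w) r u y - (x - y)) \<le> C1 * r * norm (x - y)"
    using app_near_diff[OF good_chain] by blast
  obtain C2 \<delta>2 where C2: "C2 \<ge> 0" "\<delta>2 > 0" "\<And>r u y. 0 < r \<Longrightarrow> r < \<delta>2 \<Longrightarrow> \<bar>u\<bar> \<le> r \<Longrightarrow> norm (y - x0) < \<delta>2 \<Longrightarrow>
      norm (vel (chain w) r u y - r ^ (d - 1) *\<^sub>R nest w y) \<le> C2 * r ^ d"
    using vel_chain_ordO[OF w] unfolding ordO_def ev_def d_def by blast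
  have "continuous (at x0) (nest w)"
    using smooth_on_continuous_on[OF smooth_nest] open_G x0_G continuous_on_eq_continuous_at by blast
  then obtain \<delta>3 where d3: "\<delta>3 > 0" "\<And>y. dist y x0 < \<delta>3 \<Longrightarrow> dist (nest w y) (nest w x0) < \<epsilon> / 2"
    using \<epsilon> unfolding continuous_at_eps_delta by (metis dist_norm half_gt_zero)
  \<comment> \<open>The entries ensure \<open>r \<le> 1\<close>, the range of the velocity
    expansion, an end point close enough to \<open>x0\<close> after a displacement of at most
    \<open>N * B * r\<close>, and the bounds \<open>C1 * \<delta> \<le> \<epsilon>\<close> and
    \<open>C2 * \<delta> \<le> \<epsilon> / 2\<close>.\<close>
  define \<delta> where "\<delta> = Min {1, \<delta>2, min \<delta>2 \<delta>3 / (1 + N * B), \<epsilon> / (C1 + 1), \<epsilon> / (2 * (C2 + 1))}"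
  have NB: "N * B \<ge> 0" using N B_nonneg by simp
  have \<delta>: "\<delta> > 0" using C1(1) C2(1,2) d3(1) \<epsilon> NB unfolding \<delta>_def by (subst Min_gr_iff) auto
  have le: "\<delta> \<le> 1" "\<delta> \<le> \<delta>2" "\<delta> \<le> min \<delta>2 \<delta>3 / (1 + N * B)" "\<delta> \<le> \<epsilon> / (C1 + 1)" "\<delta> \<le> \<epsilon> / (2 * (C2 + 1))"
    unfolding \<delta>_def by (intro Min_le; simp)+
  have dN: "\<delta> * (1 + N * B) \<le> min \<delta>2 \<delta>3" using le(3) NB by (simp add: pos_le_divide_eq)
  have dC1: "C1 * \<delta> \<le> \<epsilon>" using le(4) C1(1) \<delta> by (simp add: field_simps)
  have dC2: "C2 * \<delta> \<le> \<epsilon> / 2" using le(5) C2(1) \<delta> by (simp add: field_simps)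
  have main: "norm (?A r s z - ?A r s' z' - (z - z') - (s - s') *\<^sub>R nest w x0) \<le> \<epsilon> * (norm (z - z') + \<bar>s - s'\<bar>)"
    if r: "0 < r" "r < \<delta>" and s: "\<bar>s\<bar> \<le> r ^ d" "\<bar>s'\<bar> \<le> r ^ d" and z: "norm (z - x0) < \<delta>"
    for r s s' z z'
  proof -
    let ?S = "cball 0 (r ^ d) :: real set"
    have "norm ((\<lambda>s. ?A r s z - s *\<^sub>R nest w x0) s - (\<lambda>s. ?A r s z - s *\<^sub>R nest w x0) s') \<le> \<epsilon> * norm (s - s')"
    proof (rule differentiable_bound[where S = ?S
          and f' = "\<lambda>s h. h *\<^sub>R ((1 / r ^ (d - 1)) *\<^sub>R vel (chain w) r (s / r ^ (d - 1)) (?A r s z) - nest w x0)"])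
      fix s assume "s \<in> ?S"
      then have sr: "\<bar>s\<bar> \<le> r ^ d" by simp
      let ?u = "s / r ^ (d - 1)"
      have u: "\<bar>?u\<bar> \<le> r" by (rule scaled_time[OF r(1) sr d])
      have "((\<lambda>s. s / r ^ (d - 1)) has_vector_derivative 1 / r ^ (d - 1)) (at s)"
        unfolding has_real_derivative_iff_has_vector_derivative[symmetric]
        by (rule DERIV_cdivide[OF DERIV_ident])
      from vector_diff_chain_at[OF this app_deriv]
      have "((\<lambda>s. ?A r s z) has_vector_derivative (1 / r ^ (d - 1)) *\<^sub>R vel (chain w) r ?u (?A r s z)) (at s)"
        by (simp add: o_def)
      moreover have "((\<lambda>s. s *\<^sub>R nest w x0) has_vector_derivative nest w x0) (at s)"
        by (auto intro!: derivative_eq_intros)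
      ultimately have "((\<lambda>s. ?A r s z - s *\<^sub>R nest w x0) has_vector_derivative
          ((1 / r ^ (d - 1)) *\<^sub>R vel (chain w) r ?u (?A r s z) - nest w x0)) (at s)"
        by (rule has_vector_derivative_diff)
      then show "((\<lambda>s. ?A r s z - s *\<^sub>R nest w x0) has_derivative
          (\<lambda>h. h *\<^sub>R ((1 / r ^ (d - 1)) *\<^sub>R vel (chain w) r ?u (?A r s z) - nest w x0))) (at s within ?S)"
        unfolding has_vector_derivative_def by (rule has_derivative_at_withinI)
      have "norm (?A r s z - x0) < min \<delta>2 \<delta>3"
      proof -
        have "norm (?A r s z - x0) \<le> norm (?A r s z - z) + norm (z - x0)"
          using norm_triangle_ineq[of "?A r s z - z" "z - x0"] by simp
        also have "\<dots> < N * (B * \<delta>) + \<delta>"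
        proof (rule add_le_less_mono[OF order_trans[OF app_near[OF good_chain u]] z])
          show "length (chain w) * (B * r) \<le> N * (B * \<delta>)"
            unfolding N_def using r B_nonneg by (intro mult_left_mono) auto
        qed
        finally show ?thesis using dN by (simp add: algebra_simps)
      qed
      then have n1: "norm (vel (chain w) r ?u (?A r s z) - r ^ (d - 1) *\<^sub>R nest w (?A r s z)) \<le> C2 * r ^ d"
        and n2: "norm (nest w (?A r s z) - nest w x0) \<le> \<epsilon> / 2"
        using C2(3)[OF r(1) _ u] r(2) le(2) d3(2)[of "?A r s z"] by (auto simp: dist_norm)
      have p: "r ^ (d - 1) > 0" using r by simp
      have "norm ((1 / r ^ (d - 1)) *\<^sub>R (vel (chain w) r ?u (?A r s z) - r ^ (d - 1) *\<^sub>R nest w (?A r s z)))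
          \<le> (1 / r ^ (d - 1)) * (C2 * r ^ d)"
        unfolding norm_scaleR using n1 p by (intro mult_mono) auto
      also have "(1 / r ^ (d - 1)) * (C2 * r ^ d) = C2 * r" using d r by (cases d) auto
      also have "C2 * r \<le> \<epsilon> / 2" using mult_left_mono[of r \<delta> C2] r C2(1) dC2 by linarith
      finally have n3: "norm ((1 / r ^ (d - 1)) *\<^sub>R vel (chain w) r ?u (?A r s z) - nest w (?A r s z)) \<le> \<epsilon> / 2"
        using p r(1) by (simp add: scaleR_diff_right)
      have n4: "norm ((1 / r ^ (d - 1)) *\<^sub>R vel (chain w) r ?u (?A r s z) - nest w x0) \<le> \<epsilon>"
        using norm_triangle_le[OF add_mono[OF n3 n2]] by simp
      show "onorm (\<lambda>h. h *\<^sub>R ((1 / r ^ (d - 1)) *\<^sub>R vel (chain w) r ?u (?A r s z) - nest w x0)) \<le> \<epsilon>"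
        using n4 by (intro onorm_le) (auto simp: mult.commute[of \<epsilon>] intro!: mult_left_mono)
    qed (use s in auto)
    then have a1: "norm ((?A r s z - s *\<^sub>R nest w x0) - (?A r s' z - s' *\<^sub>R nest w x0)) \<le> \<epsilon> * \<bar>s - s'\<bar>"
      by simp
    have u': "\<bar>s' / r ^ (d - 1)\<bar> \<le> r" by (rule scaled_time[OF r(1) s(2) d])
    have "norm (?A r s' z - ?A r s' z' - (z - z')) \<le> C1 * r * norm (z - z')"
      using C1(2)[OF u'] r le(1) by simp
    also have "\<dots> \<le> \<epsilon> * norm (z - z')"
      using mult_left_mono[of r \<delta> C1] r C1(1) dC1 by (intro mult_right_mono) auto
    finally have a2: "norm (?A r s' z - ?A r s' z' - (z - z')) \<le> \<epsilon> * norm (z - z')" .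
    show ?thesis using norm_triangle_le[OF add_mono[OF a1 a2]] by (simp add: algebra_simps)
  qed
  show ?thesis
    by (intro exI[of _ \<delta>] conjI \<delta> allI impI) (use main in \<open>simp add: d_def\<close>)
qed

text \<open>Strict derivatives compose, which is why two base points \<open>y\<close> and
  \<open>y'\<close> appear: the end points of the tail become the base points of the head.\<close>

lemma multi_strict:
  assumes w: "\<And>k. w k \<noteq> []" and "\<epsilon> > 0"
  shows "\<exists>\<delta>>0. \<forall>r s s' y y'. 0 < r \<longrightarrow> r < \<delta> \<longrightarrow> (\<forall>k. \<bar>s k\<bar> \<le> r ^ length (w k)) \<longrightarrow>
    (\<forall>k. \<bar>s' k\<bar> \<le> r ^ length (w k)) \<longrightarrow> norm (y - x0) < \<delta> \<longrightarrow> norm (y' - x0) < \<delta> \<longrightarrow>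
    norm (multi w ks r s y - multi w ks r s' y' - (y - y') - (\<Sum>k\<leftarrow>ks. (s k - s' k) *\<^sub>R nest (w k) x0))
      \<le> \<epsilon> * (norm (y - y') + (\<Sum>k\<leftarrow>ks. \<bar>s k - s' k\<bar>))"
  using assms(2)
proof (induction ks arbitrary: \<epsilon>)
  case Nil
  then show ?case by (auto intro!: exI[of _ 1])
next
  case (Cons k ks)
  note \<epsilon> = \<open>\<epsilon> > 0\<close>
  define L where "L = (\<Sum>k\<leftarrow>ks. norm (nest (w k) x0))"
  have L0: "L \<ge> 0" unfolding L_def by (intro sum_list_nonneg) auto
  have L: "norm (\<Sum>k\<leftarrow>ks. (s k - s' k) *\<^sub>R nest (w k) x0) \<le> L * (\<Sum>k\<leftarrow>ks. \<bar>s k - s' k\<bar>)" for s s' :: "'b \<Rightarrow> real"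
    unfolding L_def
  proof (induction ks)
    case (Cons k ks)
    have nn: "0 \<le> (\<Sum>k\<leftarrow>ks. norm (nest (w k) x0))" "0 \<le> (\<Sum>k\<leftarrow>ks. \<bar>s k - s' k\<bar>)"
      by (intro sum_list_nonneg; auto)+
    have "norm ((s k - s' k) *\<^sub>R nest (w k) x0 + (\<Sum>k\<leftarrow>ks. (s k - s' k) *\<^sub>R nest (w k) x0)) \<le>
        \<bar>s k - s' k\<bar> * norm (nest (w k) x0) + (\<Sum>k\<leftarrow>ks. norm (nest (w k) x0)) * (\<Sum>k\<leftarrow>ks. \<bar>s k - s' k\<bar>)"
      using Cons by (intro norm_triangle_le add_mono) auto
    also have "\<dots> \<le> (norm (nest (w k) x0) + (\<Sum>k\<leftarrow>ks. norm (nest (w k) x0))) * (\<bar>s k - s' k\<bar> + (\<Sum>k\<leftarrow>ks. \<bar>s k - s' k\<bar>))"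
      using nn by (simp add: algebra_simps)
    finally show ?case by simp
  qed simp
  \<comment> \<open>The error of the head is \<open>\<epsilon>1\<close> times the Lipschitz constant
    \<open>2 + L\<close> of the tail, that of the tail is \<open>\<epsilon>2\<close>; each is to
    cost at most \<open>\<epsilon> / 2\<close>. The 2 in \<open>2 + L\<close> comes from
    \<open>\<epsilon>2 \<le> 1\<close> and from the identity part.\<close>
  define \<epsilon>1 where "\<epsilon>1 = \<epsilon> / (2 * (2 + L))"
  define \<epsilon>2 where "\<epsilon>2 = min 1 (\<epsilon> / 2)"
  have e12: "\<epsilon>1 > 0" "\<epsilon>2 > 0" "\<epsilon>2 \<le> 1" "\<epsilon>2 \<le> \<epsilon> / 2" "\<epsilon>1 * (2 + L) = \<epsilon> / 2" "\<epsilon>1 \<le> \<epsilon> / 2"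
    using \<epsilon> L0 by (auto simp: \<epsilon>1_def \<epsilon>2_def field_simps)
  obtain \<delta>1 where \<delta>1_pos: "\<delta>1 > 0" and d1: "\<forall>r s s' z z'. 0 < r \<longrightarrow> r < \<delta>1 \<longrightarrow> \<bar>s\<bar> \<le> r ^ length (w k) \<longrightarrow>
    \<bar>s'\<bar> \<le> r ^ length (w k) \<longrightarrow> norm (z - x0) < \<delta>1 \<longrightarrow> norm (z' - x0) < \<delta>1 \<longrightarrow>
    norm (app (chain (w k)) r (s / r ^ (length (w k) - 1)) z - app (chain (w k)) r (s' / r ^ (length (w k) - 1)) z'
      - (z - z') - (s - s') *\<^sub>R nest (w k) x0) \<le> \<epsilon>1 * (norm (z - z') + \<bar>s - s'\<bar>)"
    using chain_strict[OF w e12(1), of k] by (elim exE conjE)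
  obtain \<delta>2 where \<delta>2_pos: "\<delta>2 > 0" and d2: "\<forall>r s s' y y'. 0 < r \<longrightarrow> r < \<delta>2 \<longrightarrow> (\<forall>k. \<bar>s k\<bar> \<le> r ^ length (w k)) \<longrightarrow>
    (\<forall>k. \<bar>s' k\<bar> \<le> r ^ length (w k)) \<longrightarrow> norm (y - x0) < \<delta>2 \<longrightarrow> norm (y' - x0) < \<delta>2 \<longrightarrow>
    norm (multi w ks r s y - multi w ks r s' y' - (y - y') - (\<Sum>k\<leftarrow>ks. (s k - s' k) *\<^sub>R nest (w k) x0))
      \<le> \<epsilon>2 * (norm (y - y') + (\<Sum>k\<leftarrow>ks. \<bar>s k - s' k\<bar>))"
    using Cons.IH[OF e12(2)] by (elim exE conjE)
  define N where "N = real (steps_number w ks)"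
  have NB: "N * B \<ge> 0" using B_nonneg by (simp add: N_def)
  define \<delta> where "\<delta> = min \<delta>2 (\<delta>1 / (1 + N * B))"
  have "\<delta> \<le> \<delta>1 / (1 + N * B)" by (simp add: \<delta>_def)
  then have "\<delta> * (1 + N * B) \<le> \<delta>1" using NB by (simp only: pos_le_divide_eq)
  then have \<delta>: "\<delta> > 0" "\<delta> \<le> \<delta>2" "\<delta> * (1 + N * B) \<le> \<delta>1"
    using \<delta>1_pos \<delta>2_pos NB by (auto simp: \<delta>_def)
  have \<delta>1: "\<delta> \<le> \<delta>1" using \<delta>(1,3) NB mult_left_mono[of 1 "1 + N * B" \<delta>] by linarith
  have "norm (multi w (k # ks) r s y - multi w (k # ks) r s' y' - (y - y') - (\<Sum>k\<leftarrow>k # ks. (s k - s' k) *\<^sub>R nest (w k) x0))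
      \<le> \<epsilon> * (norm (y - y') + (\<Sum>k\<leftarrow>k # ks. \<bar>s k - s' k\<bar>))"
    if r: "0 < r" "r < \<delta>" and s: "\<forall>k. \<bar>s k\<bar> \<le> r ^ length (w k)" "\<forall>k. \<bar>s' k\<bar> \<le> r ^ length (w k)"
      and y: "norm (y - x0) < \<delta>" "norm (y' - x0) < \<delta>" for r s s' y y'
  proof -
    let ?z = "multi w ks r s y" and ?z' = "multi w ks r s' y'"
    let ?S = "\<Sum>k\<leftarrow>ks. \<bar>s k - s' k\<bar>" and ?T = "\<Sum>k\<leftarrow>ks. (s k - s' k) *\<^sub>R nest (w k) x0"
    define Q where "Q = norm (y - y') + ?S"
    have S0: "?S \<ge> 0" by (intro sum_list_nonneg) auto
    have near: "norm (multi w ks r s y - x0) < \<delta>1" if "\<forall>k. \<bar>s k\<bar> \<le> r ^ length (w k)" "norm (y - x0) < \<delta>" for s y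
    proof -
      have "norm (multi w ks r s y - x0) \<le> norm (multi w ks r s y - y) + norm (y - x0)"
        using norm_triangle_ineq[of "multi w ks r s y - y" "y - x0"] by simp
      also have "\<dots> < N * (B * \<delta>) + \<delta>"
      proof (rule add_le_less_mono[OF order_trans[OF multi_near[OF w r(1)]] that(2)])
        show "steps_number w ks * (B * r) \<le> N * (B * \<delta>)"
          unfolding N_def using r B_nonneg by (intro mult_left_mono) auto
      qed (use that in auto)
      finally show ?thesis using \<delta>(3) by (simp add: algebra_simps)
    qed
    have A: "norm (?z - ?z' - (y - y') - ?T) \<le> \<epsilon>2 * Q"
      unfolding Q_def using r s y \<delta>(2) by (intro d2[rule_format]) auto
    have zz: "norm (?z - ?z') \<le> (2 + L) * Q"
    proof -
      have "norm ((?z - ?z' - (y - y') - ?T) + ((y - y') + ?T)) \<le> 1 * Q + (norm (y - y') + L * ?S)"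
        using A L e12(3) mult_right_mono[OF e12(3), of Q] S0
        by (intro norm_triangle_le add_mono) (auto simp: Q_def intro: order_trans)
      also have "\<dots> \<le> (2 + L) * Q" using S0 L0 by (simp add: Q_def algebra_simps)
      finally show ?thesis by simp
    qed
    let ?a = "app (chain (w k)) r (s k / r ^ (length (w k) - 1)) ?z"
      and ?a' = "app (chain (w k)) r (s' k / r ^ (length (w k) - 1)) ?z'"
    have "norm (?a - ?a' - (?z - ?z') - (s k - s' k) *\<^sub>R nest (w k) x0) \<le> \<epsilon>1 * (norm (?z - ?z') + \<bar>s k - s' k\<bar>)"
      using r s \<delta>1 y by (intro d1[rule_format] near) auto
    also have "\<dots> \<le> \<epsilon>1 * ((2 + L) * Q) + \<epsilon>1 * \<bar>s k - s' k\<bar>"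
      using zz e12(1) by (simp add: distrib_left)
    also have "\<dots> \<le> \<epsilon> / 2 * Q + \<epsilon> / 2 * \<bar>s k - s' k\<bar>"
      using mult_right_mono[OF e12(6), of "\<bar>s k - s' k\<bar>"]
      unfolding mult.assoc[symmetric] e12(5) by simp
    finally have Bd: "norm (?a - ?a' - (?z - ?z') - (s k - s' k) *\<^sub>R nest (w k) x0) \<le> \<epsilon> / 2 * Q + \<epsilon> / 2 * \<bar>s k - s' k\<bar>" .
    have "norm ((?z - ?z' - (y - y') - ?T) + (?a - ?a' - (?z - ?z') - (s k - s' k) *\<^sub>R nest (w k) x0)) \<le>
        \<epsilon>2 * Q + (\<epsilon> / 2 * Q + \<epsilon> / 2 * \<bar>s k - s' k\<bar>)"
      by (rule norm_triangle_le[OF add_mono[OF A Bd]])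
    also have "\<dots> \<le> \<epsilon> * (Q + \<bar>s k - s' k\<bar>)"
    proof -
      have "\<epsilon>2 * Q \<le> \<epsilon> / 2 * Q" using e12(4) S0 by (intro mult_right_mono) (auto simp: Q_def)
      moreover have "0 \<le> \<epsilon> / 2 * \<bar>s k - s' k\<bar>" using \<epsilon> by simp
      ultimately show ?thesis by (simp add: algebra_simps)
    qed
    finally show ?thesis by (simp add: Q_def algebra_simps)
  qed
  then show ?case using \<delta>(1) by blast
qed

text \<open>The linear map given by the brackets at \<open>x0\<close> is injective, hence bounded
  below by some \<open>c\<close>. A perturbation with Lipschitz constant \<open>c / 2\<close> leaves
  the lower bound \<open>c / 2\<close>.\<close>

lemma multi_bilipschitz:
  fixes w :: "'k::finite \<Rightarrow> 'm list"
  assumes w: "\<And>k. w k \<noteq> []" and ks: "distinct ks" "set ks = UNIV"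
    and inj: "\<And>a. (\<Sum>k\<in>UNIV. a k *\<^sub>R nest (w k) x0) = 0 \<Longrightarrow> a = (\<lambda>k. 0)"
  shows "\<exists>\<delta>>0. \<exists>c>0. \<forall>r (s::real^'k) s' y. 0 < r \<longrightarrow> r < \<delta> \<longrightarrow> (\<forall>k. \<bar>s $ k\<bar> \<le> r ^ length (w k)) \<longrightarrow>
    (\<forall>k. \<bar>s' $ k\<bar> \<le> r ^ length (w k)) \<longrightarrow> norm (y - x0) < \<delta> \<longrightarrow>
    c * norm (s - s') \<le> norm (multi w ks r (($) s) y - multi w ks r (($) s') y)"
proof -
  define f where "f a = (\<Sum>k\<in>UNIV. a $ k *\<^sub>R nest (w k) x0)" for a :: "real^'k"
  have lf: "linear f"
    unfolding f_def by (intro linearI) (simp_all add: scaleR_left_distrib sum.distrib scaleR_sum_right)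
  have "inj f"
    unfolding linear_injective_0[OF lf]
  proof (intro allI impI)
    fix a assume "f a = 0"
    then have "($) a = (\<lambda>k. 0)" using inj[of "($) a"] by (simp add: f_def)
    then show "a = 0" by (simp add: vec_eq_iff fun_eq_iff)
  qed
  then obtain c where c: "c > 0" "\<And>a. c * norm a \<le> norm (f a)"
    using linear_inj_bounded_below_pos[OF lf] by blast
  \<comment> \<open>\<open>multi_strict\<close> measures parameters by the sum of their components;
    comparison with the Euclidean norm costs \<open>CARD('k)\<close>.\<close>
  define \<epsilon> where "\<epsilon> = c / (2 * CARD('k))"
  have \<epsilon>: "\<epsilon> > 0" using c(1) by (simp add: \<epsilon>_def)
  obtain \<delta> where \<delta>_pos: "\<delta> > 0" and \<delta>: "\<forall>r s s' y y'. 0 < r \<longrightarrow> r < \<delta> \<longrightarrow> (\<forall>k. \<bar>s k\<bar> \<le> r ^ length (w k)) \<longrightarrow>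
    (\<forall>k. \<bar>s' k\<bar> \<le> r ^ length (w k)) \<longrightarrow> norm (y - x0) < \<delta> \<longrightarrow> norm (y' - x0) < \<delta> \<longrightarrow>
    norm (multi w ks r s y - multi w ks r s' y' - (y - y') - (\<Sum>k\<leftarrow>ks. (s k - s' k) *\<^sub>R nest (w k) x0))
      \<le> \<epsilon> * (norm (y - y') + (\<Sum>k\<leftarrow>ks. \<bar>s k - s' k\<bar>))"
    using multi_strict[where w = w and ks = ks, OF w \<epsilon>] by (elim exE conjE)
  have "c / 2 * norm (s - s') \<le> norm (multi w ks r (($) s) y - multi w ks r (($) s') y)"
    if r: "0 < r" "r < \<delta>" and s: "\<forall>k. \<bar>s $ k\<bar> \<le> r ^ length (w k)" "\<forall>k. \<bar>s' $ k\<bar> \<le> r ^ length (w k)"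
      and y: "norm (y - x0) < \<delta>" for r y and s s' :: "real^'k"
  proof -
    have 1: "(\<Sum>k\<leftarrow>ks. (s $ k - s' $ k) *\<^sub>R nest (w k) x0) = f (s - s')"
      unfolding f_def using sum_list_distinct_conv_sum_set[OF ks(1)] ks(2) by simp
    have "(\<Sum>k\<leftarrow>ks. \<bar>s $ k - s' $ k\<bar>) = (\<Sum>k\<in>UNIV. \<bar>(s - s') $ k\<bar>)"
      using sum_list_distinct_conv_sum_set[OF ks(1)] ks(2) by simp
    also have "\<dots> \<le> (\<Sum>k\<in>(UNIV::'k set). norm (s - s'))" by (intro sum_mono component_le_norm_cart)
    finally have 2: "(\<Sum>k\<leftarrow>ks. \<bar>s $ k - s' $ k\<bar>) \<le> CARD('k) * norm (s - s')" by simp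
    let ?m = "multi w ks r (($) s) y - multi w ks r (($) s') y"
    have "norm (?m - f (s - s')) \<le> \<epsilon> * (\<Sum>k\<leftarrow>ks. \<bar>s $ k - s' $ k\<bar>)"
      using \<delta>[rule_format, OF r, of "($) s" "($) s'" y y] s y 1 by simp
    also have "\<dots> \<le> \<epsilon> * (CARD('k) * norm (s - s'))" using 2 \<epsilon> by (intro mult_left_mono) auto
    also have "\<dots> = c / 2 * norm (s - s')" by (simp add: \<epsilon>_def)
    finally have "norm (f (s - s')) - norm ?m \<le> c / 2 * norm (s - s')"
      using norm_triangle_ineq2[of "f (s - s')" ?m] by (simp add: norm_minus_commute)
    then show ?thesis using c(2)[of "s - s'"] by simp
  qed
  then show ?thesis using \<delta>_pos c(1) by (intro exI[of _ \<delta>] conjI exI[of _ "c / 2"]) auto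
qed

end

section \<open>The perimeter along flows\<close>

lemma compactly_contained_subset:
  fixes A B S :: "'a::heine_borel set"
  assumes "A \<subseteq> B" "B \<subset>\<subset> S"
  shows "A \<subset>\<subset> S"
  using assms(2) bounded_subset[OF _ assms(1)] closure_mono[OF assms(1)]
  by (auto simp: compactly_contained_def)

lemma set_integrable_continuous:
  fixes f :: "real^'n \<Rightarrow> real"
  assumes "open E" "bounded E" "continuous_on UNIV f"
  shows "set_integrable lebesgue E f"
proof -
  have lm: "E \<in> lmeasurable" using assms by (simp add: lmeasurable_open)
  have "compact (closure E)" using assms(2) by simp
  then have "bounded (f ` closure E)"
    using assms(3) compact_continuous_image compact_imp_bounded continuous_on_subset by (metis subset_UNIV)
  then obtain M where "\<And>x. x \<in> closure E \<Longrightarrow> norm (f x) \<le> M" by (auto simp: bounded_iff)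
  then have M: "\<And>x. x \<in> E \<Longrightarrow> \<bar>f x\<bar> \<le> M" using closure_subset by fastforce
  have int: "integrable lebesgue (\<lambda>x. M * indicat_real E x)"
    using lm by (intro integrable_mult_right integrable_real_indicator) (auto simp: fmeasurable_def)
  have "f \<in> borel_measurable lebesgue"
    using borel_measurable_continuous_onI[OF assms(3)] by (intro measurable_completion) simp
  then have "(\<lambda>x. indicat_real E x *\<^sub>R f x) \<in> borel_measurable lebesgue"
    using lm by (intro borel_measurable_scaleR borel_measurable_indicator) auto
  then show ?thesis unfolding set_integrable_def
    by (rule Bochner_Integration.integrable_bound[OF int]) (auto simp: indicator_def intro!: AE_I2 order_trans[OF M abs_ge_self])
qed

lemma set_integral_abs_bound:
  fixes f g :: "real^'n \<Rightarrow> real"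
  assumes "set_integrable lebesgue E f" "set_integrable lebesgue E g" "\<And>x. x \<in> E \<Longrightarrow> \<bar>f x\<bar> \<le> g x"
  shows "\<bar>LINT x:E|lebesgue. f x\<bar> \<le> (LINT x:E|lebesgue. g x)"
proof -
  have "(LINT x:E|lebesgue. f x) \<le> (LINT x:E|lebesgue. g x)"
    by (rule set_integral_mono[OF assms(1,2)]) (use assms(3) in fastforce)
  moreover have "(LINT x:E|lebesgue. - f x) \<le> (LINT x:E|lebesgue. g x)"
  proof (rule set_integral_mono[OF _ assms(2)])
    show "set_integrable lebesgue E (\<lambda>x. - f x)" using assms(1) unfolding set_integrable_def by simp
  qed (use assms(3) in fastforce)
  ultimately show ?thesis using set_integral_uminus[OF assms(1)] by simp
qed

text \<open>With the integrating factor \<open>exp (\<Lambda> * s)\<close>, the forcing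
  \<open>p\<close> lowers the product at a rate of at most \<open>p * exp (\<Lambda> * t)\<close> on
  \<open>[0, t]\<close>; the added linear term compensates exactly this rate.\<close>

lemma exp_growth_lower:
  fixes k :: "real \<Rightarrow> real"
  assumes "\<And>s. (k has_real_derivative k' s) (at s)" "\<And>s. - k' s \<le> p + \<Lambda> * k s"
    and "p \<ge> 0" "\<Lambda> \<ge> 0" "t \<ge> 0"
  shows "exp (- \<Lambda> * t) * k 0 - t * p \<le> k t"
proof -
  have "exp (\<Lambda> * 0) * k 0 + p * exp (\<Lambda> * t) * 0 \<le> exp (\<Lambda> * t) * k t + p * exp (\<Lambda> * t) * t"
  proof (rule DERIV_nonneg_imp_nondecreasing[OF assms(5)])
    fix s assume s: "0 \<le> s" "s \<le> t"
    have d: "((\<lambda>s. exp (\<Lambda> * s) * k s + p * exp (\<Lambda> * t) * s) has_real_derivative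
        exp (\<Lambda> * s) * (\<Lambda> * k s + k' s) + p * exp (\<Lambda> * t)) (at s)"
      by (auto intro!: derivative_eq_intros assms(1) simp: algebra_simps)
    have "exp (\<Lambda> * s) * (- p) \<le> exp (\<Lambda> * s) * (\<Lambda> * k s + k' s)"
      using assms(2)[of s] by (intro mult_left_mono) auto
    moreover have "p * exp (\<Lambda> * s) \<le> p * exp (\<Lambda> * t)"
      using s assms(3,4) by (intro mult_left_mono) (auto intro: mult_left_mono)
    ultimately have "exp (\<Lambda> * s) * (\<Lambda> * k s + k' s) + p * exp (\<Lambda> * t) \<ge> 0" by (simp add: mult.commute)
    with d show "\<exists>y. ((\<lambda>s. exp (\<Lambda> * s) * k s + p * exp (\<Lambda> * t) * s) has_real_derivative y) (at s) \<and> 0 \<le> y"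
      by blast
  qed
  then show ?thesis by (simp add: exp_minus field_simps)
qed

lemma X_perimeter_nonneg:
  fixes X :: "'m::finite \<Rightarrow> real^'n \<Rightarrow> real^'n"
  shows "0 \<le> X_perimeter X E \<Omega>"
proof -
  have "(\<lambda>x. 0) \<in> (test_fields \<Omega> :: (real^'n \<Rightarrow> real^'m) set)"
    by (auto simp: test_fields_def C01_def compactly_contained_def)
  from SUP_upper[OF this, of "\<lambda>\<phi>. ereal (LINT x:E|lebesgue. (\<Sum>j\<in>UNIV. vf_adjoint (X j) (\<lambda>y. \<phi> y $ j) x))"]
  show ?thesis by (simp add: X_perimeter_def vf_adjoint_def vf_apply_def zero_ereal_def)
qed

text \<open>The real number \<open>p\<close> bounds the perimeter, which leaves the infinite case
  outside. As \<open>Y\<close> and \<open>X\<close> agree on a set containing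
  \<open>\<Omega>\<close>, the perimeter defined by \<open>X\<close> can be tested along the global
  flows of \<open>Y\<close>.\<close>

locale perimeter_flows = C11_fields Y B
  for Y :: "'m::finite \<Rightarrow> real^'n \<Rightarrow> real^'n" and B +
  fixes X :: "'m \<Rightarrow> real^'n \<Rightarrow> real^'n" and E \<Omega> V :: "(real^'n) set" and p :: real
  assumes open_E: "open E" and E_in: "E \<subset>\<subset> \<Omega>" and open_\<Omega>: "open \<Omega>"
    and V: "\<Omega> \<subseteq> V" "\<And>i x. x \<in> V \<Longrightarrow> Y i x = X i x"
    and perimeter_le: "X_perimeter X E \<Omega> \<le> ereal p"
begin

abbreviation IE :: "(real^'n \<Rightarrow> real) \<Rightarrow> real" where
  "IE f \<equiv> (LINT x:E|lebesgue. f x)"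

lemma bounded_E: "bounded E"
  using E_in closure_subset compact_imp_bounded bounded_subset by (auto simp: compactly_contained_def)

lemma E_sub: "E \<subseteq> \<Omega>"
  using E_in closure_subset by (auto simp: compactly_contained_def)

lemma p_nonneg: "p \<ge> 0"
  using order_trans[OF X_perimeter_nonneg perimeter_le] by simp

lemma set_integrable_E: "continuous_on UNIV (f :: real^'n \<Rightarrow> real) \<Longrightarrow> set_integrable lebesgue E f"
  by (rule set_integrable_continuous[OF open_E bounded_E])

definition dv :: "'m \<Rightarrow> real^'n \<Rightarrow> real" where
  "dv i x = (\<Sum>k\<in>UNIV. frechet_derivative (Y i) (at x) (axis k 1) $ k)"

lemma dv_continuous: "continuous_on UNIV (dv i)"
  unfolding dv_def by (intro continuous_intros F.X'_continuous)

lemma divergence_eq: "x \<in> E \<Longrightarrow> divergence (X i) x = dv i x"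
proof -
  assume x: "x \<in> E"
  have "frechet_derivative (\<lambda>y. X i y $ k) (at x) = frechet_derivative (\<lambda>y. Y i y $ k) (at x)" for k
    using x E_sub V by (intro frechet_derivative_cong_open(1)[OF open_E]) (auto simp: subset_eq)
  then show ?thesis
    unfolding divergence_def dv_def by (simp add: frechet_derivative_component[OF F.differentiable])
qed

definition \<Lambda> :: real where "\<Lambda> = CARD('n) * B"

lemma \<Lambda>_nonneg: "\<Lambda> \<ge> 0"
  using B_nonneg by (simp add: \<Lambda>_def)

lemma dv_bound: "\<bar>dv i x\<bar> \<le> \<Lambda>"
proof -
  have "\<bar>dv i x\<bar> \<le> (\<Sum>k\<in>(UNIV::'n set). B)"
    unfolding dv_def
  proof (rule order_trans[OF sum_abs sum_mono])
    fix k :: 'n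
    have "\<bar>frechet_derivative (Y i) (at x) (axis k 1) $ k\<bar> \<le> norm (frechet_derivative (Y i) (at x) (axis k 1))"
      by (rule component_le_norm_cart)
    also have "\<dots> \<le> B * norm (axis k (1::real))" by (rule F.deriv_bound)
    finally show "\<bar>frechet_derivative (Y i) (at x) (axis k 1) $ k\<bar> \<le> B" by simp
  qed
  then show ?thesis by (simp add: \<Lambda>_def)
qed

text \<open>Testing the perimeter with \<open>\<plusminus>\<phi>\<close>, cut off near \<open>closure E\<close>, in the \<open>i\<close>-th slot.\<close>

lemma test_bound:
  assumes \<phi>: "Ck_on 1 UNIV \<phi>" "\<And>x. 0 \<le> \<phi> x" "\<And>x. \<phi> x \<le> 1"
  shows "\<bar>IE (\<lambda>x. frechet_derivative \<phi> (at x) (Y i x) + dv i x * \<phi> x)\<bar> \<le> p"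
proof -
  have cE: "compact (closure E)" "closure E \<subseteq> \<Omega>" using E_in by (auto simp: compactly_contained_def)
  obtain \<eta> :: "real^'n \<Rightarrow> real" and W where \<eta>: "Ck_on 1 UNIV \<eta>" "\<And>x. 0 \<le> \<eta> x" "\<And>x. \<eta> x \<le> 1"
    "open W" "closure E \<subseteq> W" "W \<subseteq> \<Omega>" "\<And>x. x \<in> W \<Longrightarrow> \<eta> x = 1" "{x. \<eta> x \<noteq> 0} \<subset>\<subset> \<Omega>"
    by (rule Ck_on_cutoff[OF cE(1) open_\<Omega> cE(2), where k = 1]) (rule that)
  have \<eta>1: "\<eta> x = 1" if "x \<in> E" for x using that \<eta>(5,7) closure_subset by blast
  have main: "\<sigma> * IE (\<lambda>x. frechet_derivative \<phi> (at x) (Y i x) + dv i x * \<phi> x) \<le> p" if \<sigma>: "\<bar>\<sigma>\<bar> = 1" for \<sigma>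
  proof -
    \<comment> \<open>The minus sign compensates that of the formal adjoint; the two values of
      \<open>\<sigma>\<close> yield the two halves of the absolute value.\<close>
    define f :: "real^'n \<Rightarrow> real^'m" where "f y = (\<chi> j. if j = i then - \<sigma> * (\<eta> y * \<phi> y) else 0)" for y
    have fc: "(\<lambda>x. f x $ j) = (if j = i then (\<lambda>x. - \<sigma> * (\<eta> x * \<phi> x)) else (\<lambda>x. 0))" for j
      by (auto simp: f_def)
    have "(\<lambda>x. f x $ j) \<in> C01 \<Omega>" for j
    proof -
      have "Ck_on 1 \<Omega> (\<lambda>x. - \<sigma> * (\<eta> x * \<phi> x))"
        using \<eta>(1) \<phi>(1) by (intro Ck_on_mult Ck_on_const open_\<Omega>) (auto intro: Ck_on_subset simp del: Ck_on.simps One_nat_def)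
      moreover have "{x. - \<sigma> * (\<eta> x * \<phi> x) \<noteq> 0} \<subset>\<subset> \<Omega>"
        by (rule compactly_contained_subset[OF _ \<eta>(8)]) auto
      ultimately show ?thesis unfolding fc by (auto simp: C01_def compactly_contained_def)
    qed
    moreover have "sqrt (\<Sum>j\<in>UNIV. \<bar>f x $ j\<bar>\<^sup>2) \<le> 1" for x
    proof -
      have "(\<Sum>j\<in>UNIV. \<bar>f x $ j\<bar>\<^sup>2) = (\<Sum>j\<in>UNIV. if j = i then (\<eta> x * \<phi> x)\<^sup>2 else 0)"
        using \<sigma> by (intro sum.cong) (auto simp: f_def power_mult_distrib abs_square_eq_1)
      also have "\<dots> = (\<eta> x * \<phi> x)\<^sup>2" by simp
      finally have "sqrt (\<Sum>j\<in>UNIV. \<bar>f x $ j\<bar>\<^sup>2) = \<eta> x * \<phi> x" using \<eta>(2)[of x] \<phi>(2)[of x] by simp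
      then show ?thesis using mult_mono[OF \<eta>(3)[of x] \<phi>(3)[of x]] \<phi>(2)[of x] by simp
    qed
    ultimately have "f \<in> test_fields \<Omega>" by (simp add: test_fields_def)
    from SUP_upper[OF this, of "\<lambda>\<phi>. ereal (LINT x:E|lebesgue. (\<Sum>j\<in>UNIV. vf_adjoint (X j) (\<lambda>y. \<phi> y $ j) x))"]
    have "ereal (IE (\<lambda>x. \<Sum>j\<in>UNIV. vf_adjoint (X j) (\<lambda>y. f y $ j) x)) \<le> X_perimeter X E \<Omega>"
      unfolding X_perimeter_def .
    from order_trans[OF this perimeter_le]
    have le: "IE (\<lambda>x. \<Sum>j\<in>UNIV. vf_adjoint (X j) (\<lambda>y. f y $ j) x) \<le> p"
      by (simp only: ereal_less_eq(3))
    have "(\<Sum>j\<in>UNIV. vf_adjoint (X j) (\<lambda>y. f y $ j) x) = \<sigma> * (frechet_derivative \<phi> (at x) (Y i x) + dv i x * \<phi> x)"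
      if x: "x \<in> E" for x
    proof -
      have "vf_adjoint (X j) (\<lambda>y. f y $ j) x = (if j = i then \<sigma> * (frechet_derivative \<phi> (at x) (Y i x) + dv i x * \<phi> x) else 0)" for j
      proof (cases "j = i")
        case True
        have "frechet_derivative (\<lambda>x. - \<sigma> * (\<eta> x * \<phi> x)) (at x) = frechet_derivative (\<lambda>x. - \<sigma> * \<phi> x) (at x)"
          by (rule frechet_derivative_cong_open(1)[OF open_E x]) (simp add: \<eta>1)
        also have "\<dots> = (\<lambda>h. - \<sigma> * frechet_derivative \<phi> (at x) h)"
          using \<phi>(1) by (intro frechet_derivative_eqI has_derivative_mult_right has_derivative_frechet) auto
        finally have "frechet_derivative (\<lambda>x. - \<sigma> * (\<eta> x * \<phi> x)) (at x) (X i x) = - \<sigma> * frechet_derivative \<phi> (at x) (Y i x)"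
          using x E_sub V by auto
        then show ?thesis using True
          by (simp add: fc vf_adjoint_def vf_apply_def divergence_eq[OF x] \<eta>1[OF x] algebra_simps)
      qed (simp add: fc vf_adjoint_def vf_apply_def)
      then show ?thesis by simp
    qed
    then have "IE (\<lambda>x. \<Sum>j\<in>UNIV. vf_adjoint (X j) (\<lambda>y. f y $ j) x) =
        IE (\<lambda>x. \<sigma> * (frechet_derivative \<phi> (at x) (Y i x) + dv i x * \<phi> x))"
      using open_E by (intro set_lebesgue_integral_cong) auto
    then show ?thesis using le by simp
  qed
  show ?thesis using main[of 1] main[of "-1"] by (simp add: abs_le_iff)
qed

lemma IE_const: "IE (\<lambda>x. c) = c * measure lebesgue E"
  using open_E bounded_E lmeasurable_open[of E]
  by (simp add: set_lebesgue_integral_def mult.commute)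

text \<open>Differentiation under the integral: the time derivative of the integrand is uniformly
  continuous on \<open>cball t 1 \<times> closure E\<close>, so the difference quotients converge
  uniformly on \<open>E\<close>, which has finite measure.\<close>

lemma IE_flow_derivative:
  assumes \<psi>: "Ck_on 1 UNIV \<psi>"
  shows "((\<lambda>t. IE (\<lambda>y. \<psi> (\<Phi> i t y))) has_real_derivative
    IE (\<lambda>y. frechet_derivative \<psi> (at (\<Phi> i t y)) (Y i (\<Phi> i t y)))) (at t)"
proof -
  define g where "g t y = frechet_derivative \<psi> (at (\<Phi> i t y)) (Y i (\<Phi> i t y))" for t y
  have Yc: "continuous_on UNIV (Y i)"
    by (intro continuous_at_imp_continuous_on ballI has_derivative_continuous[OF F.X'_deriv])
  have "Ck_on 0 UNIV (\<lambda>x. frechet_derivative \<psi> (at x) (Y i x))"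
    by (rule Ck_on_frechet_derivative) (use \<psi> Yc in auto)
  then have gc0: "continuous_on UNIV (\<lambda>x. frechet_derivative \<psi> (at x) (Y i x))" by simp
  have gc: "continuous_on S (\<lambda>q. g (fst q) (snd q))" for S
    unfolding g_def by (rule continuous_on_compose2[OF gc0 continuous_on_subset[OF F.\<phi>_continuous]]) auto
  have gy: "continuous_on UNIV (g t)" for t
    using continuous_on_compose2[OF gc0 F.\<phi>_continuous_x] unfolding g_def by auto
  have \<psi>c: "continuous_on UNIV (\<lambda>y. \<psi> (\<Phi> i t y))" for t
    using continuous_on_compose2[OF Ck_on_continuous_on[OF \<psi>] F.\<phi>_continuous_x] by auto
  have gd: "((\<lambda>t. \<psi> (\<Phi> i t y)) has_vector_derivative g t y) (at t)" for t y
  proof -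
    have "\<psi> differentiable (at (\<Phi> i t y))" using \<psi> by simp
    from has_derivative_compose[OF F.\<phi>_deriv[unfolded has_vector_derivative_def] has_derivative_frechet[OF this]]
    show ?thesis
      using linear_cmul[OF linear_frechet_derivative[OF \<open>\<psi> differentiable _\<close>]]
      by (simp add: has_vector_derivative_def g_def)
  qed
  define k where "k t = IE (\<lambda>y. \<psi> (\<Phi> i t y))" for t
  have cE: "compact (closure E)" using bounded_E by simp
  define m where "m = measure lebesgue E"
  have m: "m \<ge> 0" by (simp add: m_def)
  have "(k has_derivative (\<lambda>h. IE (g t) * h)) (at t)"
    unfolding has_derivative_at_alt
  proof (intro conjI allI impI)
    show "bounded_linear (\<lambda>h. IE (g t) * h)" by (rule bounded_linear_mult_right)
    fix e :: real assume e: "e > 0"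
    define \<epsilon> where "\<epsilon> = e / (m + 1)"
    have \<epsilon>: "\<epsilon> > 0" using e m by (simp add: \<epsilon>_def)
    have "uniformly_continuous_on (cball t 1 \<times> closure E) (\<lambda>q. g (fst q) (snd q))"
      by (intro compact_uniformly_continuous gc compact_Times cE compact_cball)
    then obtain d where d: "d > 0" "\<And>q q'. q \<in> cball t 1 \<times> closure E \<Longrightarrow> q' \<in> cball t 1 \<times> closure E \<Longrightarrow>
        dist q' q < d \<Longrightarrow> dist (g (fst q') (snd q')) (g (fst q) (snd q)) < \<epsilon>"
      using \<epsilon> unfolding uniformly_continuous_on_def by blast
    have gclose: "\<bar>g s y - g t y\<bar> \<le> \<epsilon>" if "\<bar>s - t\<bar> < min d 1" "y \<in> E" for s y
    proof -
      have "y \<in> closure E" using that(2) closure_subset by blast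
      then have "(t, y) \<in> cball t 1 \<times> closure E" "(s, y) \<in> cball t 1 \<times> closure E" "dist (s, y) (t, y) < d"
        using that(1) by (auto simp: dist_Pair_Pair dist_real_def abs_minus_commute)
      from d(2)[OF this] show ?thesis by (simp add: dist_real_def)
    qed
    have "\<bar>k s - k t - IE (g t) * (s - t)\<bar> \<le> e * \<bar>s - t\<bar>" if s: "\<bar>s - t\<bar> < min d 1" for s
    proof -
      let ?R = "\<lambda>y. \<psi> (\<Phi> i s y) - \<psi> (\<Phi> i t y) - (s - t) * g t y"
      have R: "\<bar>?R y\<bar> \<le> \<epsilon> * \<bar>s - t\<bar>" if y: "y \<in> E" for y
      proof -
        have "norm ((\<lambda>s. \<psi> (\<Phi> i s y) - s * g t y) s - (\<lambda>s. \<psi> (\<Phi> i s y) - s * g t y) t) \<le> \<epsilon> * norm (s - t)"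
        proof (rule differentiable_bound[where S = "ball t (min d 1)" and f' = "\<lambda>s h. h *\<^sub>R (g s y - g t y)"])
          fix s assume s: "s \<in> ball t (min d 1)"
          have "((\<lambda>s. s * g t y) has_vector_derivative g t y) (at s)"
            unfolding has_real_derivative_iff_has_vector_derivative[symmetric]
            by (auto intro!: derivative_eq_intros)
          from has_vector_derivative_diff[OF gd this]
          show "((\<lambda>s. \<psi> (\<Phi> i s y) - s * g t y) has_derivative (\<lambda>h. h *\<^sub>R (g s y - g t y))) (at s within ball t (min d 1))"
            unfolding has_vector_derivative_def by (rule has_derivative_at_withinI)
          have "\<bar>g s y - g t y\<bar> \<le> \<epsilon>" using s y by (intro gclose) (auto simp: dist_real_def)
          then show "onorm (\<lambda>h. h *\<^sub>R (g s y - g t y)) \<le> \<epsilon>"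
            by (intro onorm_le) (auto simp: abs_mult mult.commute[of \<epsilon>] intro!: mult_left_mono)
        qed (use s d in \<open>auto simp: dist_real_def\<close>)
        then show ?thesis by (simp add: algebra_simps)
      qed
      have i1: "set_integrable lebesgue E (\<lambda>y. \<psi> (\<Phi> i s y) - \<psi> (\<Phi> i t y))"
        by (intro set_integrable_E continuous_on_diff \<psi>c)
      have i2: "set_integrable lebesgue E (\<lambda>y. (s - t) * g t y)"
        by (intro set_integrable_E continuous_on_mult continuous_on_const gy)
      have "IE ?R = k s - k t - IE (g t) * (s - t)"
        using set_integral_diff(2)[OF i1 i2] set_integral_diff(2)[OF set_integrable_E[OF \<psi>c] set_integrable_E[OF \<psi>c], of s t]
        by (simp add: k_def)
      moreover have "\<bar>IE ?R\<bar> \<le> IE (\<lambda>y. \<epsilon> * \<bar>s - t\<bar>)"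
        by (rule set_integral_abs_bound[OF set_integral_diff(1)[OF i1 i2] set_integrable_E R]) auto
      moreover have "IE (\<lambda>y. \<epsilon> * \<bar>s - t\<bar>) \<le> e * \<bar>s - t\<bar>"
      proof -
        have "\<epsilon> * m \<le> e" using e m by (simp add: \<epsilon>_def divide_simps)
        from mult_right_mono[OF this, of "\<bar>s - t\<bar>"] show ?thesis
          by (simp add: IE_const m_def mult_ac)
      qed
      ultimately show ?thesis by simp
    qed
    then show "\<exists>d>0. \<forall>y. norm (y - t) < d \<longrightarrow> norm (k y - k t - IE (g t) * (y - t)) \<le> e * norm (y - t)"
      using d(1) by (intro exI[of _ "min d 1"]) auto
  qed
  then show ?thesis unfolding has_field_derivative_def k_def g_def .
qed

text \<open>The composition of \<open>\<psi>\<close> with the flow is again an admissible test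
  function, and its derivative along \<open>Y i\<close> is its time derivative. So the perimeter
  bounds the time derivative of the integral up to the divergence term, which is at most
  \<open>\<Lambda>\<close> times the integral itself. Negative times follow by reflection.\<close>

lemma flow_cost:
  assumes \<psi>: "Ck_on 1 UNIV \<psi>" "\<And>x. 0 \<le> \<psi> x" "\<And>x. \<psi> x \<le> 1"
  shows "exp (- \<Lambda> * \<bar>t\<bar>) * IE \<psi> - \<bar>t\<bar> * p \<le> IE (\<lambda>y. \<psi> (\<Phi> i t y))"
proof -
  define k where "k t = IE (\<lambda>y. \<psi> (\<Phi> i t y))" for t
  define k' where "k' t = IE (\<lambda>y. frechet_derivative \<psi> (at (\<Phi> i t y)) (Y i (\<Phi> i t y)))" for t
  have d: "(k has_real_derivative k' t) (at t)" for t
    unfolding k_def k'_def by (rule IE_flow_derivative[OF \<psi>(1)])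
  have b: "\<bar>k' t\<bar> \<le> p + \<Lambda> * k t" for t
  proof -
    let ?\<phi> = "\<lambda>y. \<psi> (\<Phi> i t y)"
    have C1: "Ck_on 1 UNIV ?\<phi>" by (rule F.C1_comp_\<phi>[OF \<psi>(1)])
    have c: "continuous_on UNIV ?\<phi>" by (rule Ck_on_continuous_on[OF C1])
    have e: "frechet_derivative ?\<phi> (at y) (Y i y) = frechet_derivative \<psi> (at (\<Phi> i t y)) (Y i (\<Phi> i t y))" for y
    proof -
      have "\<psi> differentiable (at (\<Phi> i t y))" using \<psi>(1) by simp
      from frechet_derivative_eqI[OF has_derivative_compose[OF F.\<phi>_has_derivative has_derivative_frechet[OF this]]]
      show ?thesis by (simp add: F.X_along)
    qed
    have Yc: "continuous_on UNIV (Y i)"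
      by (intro continuous_at_imp_continuous_on ballI has_derivative_continuous[OF F.X'_deriv])
    have "Ck_on 0 UNIV (\<lambda>x. frechet_derivative ?\<phi> (at x) (Y i x))"
      by (rule Ck_on_frechet_derivative) (use C1 Yc in auto)
    then have i1: "set_integrable lebesgue E (\<lambda>x. frechet_derivative ?\<phi> (at x) (Y i x))" by (intro set_integrable_E) simp
    have i2: "set_integrable lebesgue E (\<lambda>x. dv i x * ?\<phi> x)"
      by (intro set_integrable_E continuous_on_mult dv_continuous c)
    have "\<bar>k' t + IE (\<lambda>x. dv i x * ?\<phi> x)\<bar> \<le> p"
      using test_bound[OF C1 \<psi>(2,3), of i] set_integral_add(2)[OF i1 i2] by (simp add: k'_def e)
    moreover have "\<bar>IE (\<lambda>x. dv i x * ?\<phi> x)\<bar> \<le> IE (\<lambda>x. \<Lambda> * ?\<phi> x)"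
      using dv_bound \<psi>(2)
      by (intro set_integral_abs_bound[OF i2] set_integrable_E continuous_on_mult continuous_on_const c)
        (auto simp: abs_mult intro!: mult_right_mono)
    moreover have "IE (\<lambda>x. \<Lambda> * ?\<phi> x) = \<Lambda> * k t" by (simp add: k_def)
    ultimately show ?thesis by linarith
  qed
  have k0: "k 0 = IE \<psi>" by (simp add: k_def)
  show ?thesis
  proof (cases "t \<ge> 0")
    case True
    have "- k' s \<le> p + \<Lambda> * k s" for s using b[of s] by linarith
    from exp_growth_lower[OF d this p_nonneg \<Lambda>_nonneg True] show ?thesis
      using True k0 by (simp add: k_def)
  next
    case False
    have "((\<lambda>s. k (- s)) has_real_derivative - k' (- s)) (at s)" for s
      using DERIV_mirror[of k "k' (- s)" s] d[of "- s"] by simp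
    moreover have "- (- k' (- s)) \<le> p + \<Lambda> * k (- s)" for s using b[of "- s"] by linarith
    ultimately have "exp (- \<Lambda> * (- t)) * k (- 0) - (- t) * p \<le> k (- (- t))"
      using False by (intro exp_growth_lower[of "\<lambda>s. k (- s)" "\<lambda>s. - k' (- s)", OF _ _ p_nonneg \<Lambda>_nonneg]) auto
    then show ?thesis using False k0 by (simp add: k_def)
  qed
qed

text \<open>After the outermost flow is absorbed into the test function, the rest of the chain
  applies to it. The damping factors multiply, and the loss already incurred is only damped, so
  losses add.\<close>

lemma flows_cost:
  assumes \<psi>: "Ck_on 1 UNIV \<psi>" "\<And>x. 0 \<le> \<psi> x" "\<And>x. \<psi> x \<le> 1"
  shows "exp (- \<Lambda> * total_time ts) * IE \<psi> - total_time ts * p \<le> IE (\<lambda>y. \<psi> (flows ts y))"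
  using \<psi>
proof (induction ts arbitrary: \<psi>)
  case Nil
  then show ?case by simp
next
  case (Cons q ts)
  obtain i t where q: "q = (i, t)" by (cases q)
  let ?T = "total_time ts" and ?\<phi> = "\<lambda>y. \<psi> (\<Phi> i t y)"
  have IH: "exp (- \<Lambda> * ?T) * IE ?\<phi> - ?T * p \<le> IE (\<lambda>y. ?\<phi> (flows ts y))"
    by (rule Cons.IH) (use F.C1_comp_\<phi>[OF Cons.prems(1)] Cons.prems in auto)
  have "exp (- \<Lambda> * ?T) * (exp (- \<Lambda> * \<bar>t\<bar>) * IE \<psi> - \<bar>t\<bar> * p) \<le> exp (- \<Lambda> * ?T) * IE ?\<phi>"
    using flow_cost[OF Cons.prems] by (intro mult_left_mono) auto
  moreover have "exp (- \<Lambda> * ?T) * (\<bar>t\<bar> * p) \<le> 1 * (\<bar>t\<bar> * p)"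
    using p_nonneg \<Lambda>_nonneg total_time_nonneg[of ts] by (intro mult_right_mono) auto
  moreover have "exp (- \<Lambda> * ?T) * (exp (- \<Lambda> * \<bar>t\<bar>) * IE \<psi>) = exp (- \<Lambda> * (\<bar>t\<bar> + ?T)) * IE \<psi>"
  proof -
    have "- \<Lambda> * (\<bar>t\<bar> + ?T) = - \<Lambda> * ?T + - \<Lambda> * \<bar>t\<bar>" by (simp add: distrib_left)
    then show ?thesis by (simp only: exp_add mult.assoc)
  qed
  ultimately have "exp (- \<Lambda> * (\<bar>t\<bar> + ?T)) * IE \<psi> - \<bar>t\<bar> * p - ?T * p \<le> IE (\<lambda>y. ?\<phi> (flows ts y))"
    using IH unfolding right_diff_distrib by linarith
  then show ?case unfolding q flows_simps total_time_simps by (simp only: distrib_right)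
qed

end

section \<open>Measure estimates\<close>

text \<open>Cover \<open>E\<close> by cubes without interior overlap and of almost the same total
  volume. If a cube has side \<open>l\<close>, two of its points are at most
  \<open>CARD('n) * l\<close> apart, so the part of \<open>S\<close> mapped into it lies in a cube
  of side \<open>2 * CARD('n) * l / c\<close>. Only the expansion inequality for \<open>f\<close>
  enters.\<close>

lemma measure_expanding_preimage:
  fixes f :: "real^'n \<Rightarrow> real^'n"
  assumes E: "open E" "bounded E" and c: "c > 0"
    and S: "S \<in> lmeasurable" "f ` S \<subseteq> E"
    and exp: "\<And>s s'. s \<in> S \<Longrightarrow> s' \<in> S \<Longrightarrow> c * norm (s - s') \<le> norm (f s - f s')"
  shows "measure lebesgue S \<le> (2 * CARD('n) / c) ^ CARD('n) * measure lebesgue E"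
proof (rule field_le_epsilon)
  let ?n = "CARD('n)" and ?\<mu> = "measure lebesgue"
  define K0 where "K0 = (2 * ?n / c) ^ ?n"
  have K0: "K0 > 0" using c by (simp add: K0_def)
  fix e :: real assume e: "e > 0"
  have E': "E \<in> lmeasurable" using E by (simp add: lmeasurable_open)
  obtain R where R: "R > 0" "\<And>x. x \<in> E \<Longrightarrow> norm x \<le> R" using E(2) bounded_pos by metis
  have sub: "E \<subseteq> cbox (\<chi> i. - R) (\<chi> i. R)"
  proof
    fix x assume "x \<in> E"
    then have "\<bar>x $ i\<bar> \<le> R" for i using R(2) component_le_norm_cart order_trans by blast
    then show "x \<in> cbox (\<chi> i. - R) (\<chi> i. R)" by (auto simp: mem_box_cart abs_le_iff minus_le_iff)
  qed
  have ek: "e / K0 > 0" using e K0 by simp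
  obtain D where D: "countable D"
    "\<And>K. K \<in> D \<Longrightarrow> K \<subseteq> cbox (\<chi> i. - R) (\<chi> i. R) \<and> K \<noteq> {} \<and> (\<exists>c d. K = cbox c d)"
    "pairwise (\<lambda>A B. interior A \<inter> interior B = {}) D"
    "\<And>u v. cbox u v \<in> D \<Longrightarrow> \<exists>n. \<forall>i \<in> Basis. v \<bullet> i - u \<bullet> i = ((\<chi> i. R) \<bullet> i - (\<chi> i. - R) \<bullet> i)/2^n"
    "\<And>K. \<lbrakk>K \<in> D; box (\<chi> i. - R) (\<chi> i. R) \<noteq> ({} :: (real^'n) set)\<rbrakk> \<Longrightarrow> interior K \<noteq> {}"
    "E \<subseteq> \<Union>D" "\<Union>D \<in> lmeasurable" "?\<mu> (\<Union>D) \<le> ?\<mu> E + e / K0"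
    by (rule measurable_outer_intervals_bounded[OF E' sub ek]) (rule that)
  have lD: "K \<in> lmeasurable" if "K \<in> D" for K using D(2)[OF that] by auto
  have "\<exists>B. B \<in> lmeasurable \<and> S \<inter> f -` K \<subseteq> B \<and> ?\<mu> B \<le> K0 * ?\<mu> K" if K: "K \<in> D" for K
  proof (cases "S \<inter> f -` K = {}")
    case True
    then show ?thesis using K0 by (intro exI[of _ "{}"]) auto
  next
    case False
    then obtain s0 where s0: "s0 \<in> S" "f s0 \<in> K" by auto
    obtain u v where uv: "K = cbox u v" using D(2)[OF K] by blast
    then obtain m where m: "\<And>i. i \<in> Basis \<Longrightarrow> v \<bullet> i - u \<bullet> i = ((\<chi> i. R) \<bullet> i - (\<chi> i. - R) \<bullet> i)/2^m"
      using D(4) K by blast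
    \<comment> \<open>Dyadic subdivision of a cube: all edges of \<open>K\<close> have this same
      length.\<close>
    define l where "l = 2 * R / 2 ^ m"
    have l: "v $ i - u $ i = l" for i
      using m[of "axis i 1"] by (simp add: cart_eq_inner_axis[symmetric] l_def axis_in_Basis_iff)
    have l0: "l \<ge> 0" using R(1) by (simp add: l_def)
    have "cbox u v \<noteq> {}" using s0(2) uv by auto
    then have \<mu>K: "?\<mu> K = l ^ ?n" unfolding uv by (simp add: content_cbox_cart l)
    define a where "a = ?n * l / c"
    let ?B = "cbox (s0 - (\<chi> i. a)) (s0 + (\<chi> i. a))"
    have "S \<inter> f -` K \<subseteq> ?B"
    proof
      fix s assume s: "s \<in> S \<inter> f -` K"
      have "c * norm (s - s0) \<le> norm (f s - f s0)" using exp s s0 by auto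
      also have "\<dots> \<le> (\<Sum>i\<in>UNIV. \<bar>(f s - f s0) $ i\<bar>)" by (rule norm_le_l1_cart)
      also have "\<dots> \<le> (\<Sum>i\<in>(UNIV::'n set). l)"
      proof (rule sum_mono)
        fix i
        have "u $ i \<le> f s $ i" "f s $ i \<le> v $ i" "u $ i \<le> f s0 $ i" "f s0 $ i \<le> v $ i"
          using s s0 uv by (auto simp: mem_box_cart)
        then show "\<bar>(f s - f s0) $ i\<bar> \<le> l" using l[of i] by simp
      qed
      finally have "norm (s - s0) \<le> a" using c by (simp add: a_def field_simps)
      then have "\<bar>(s - s0) $ i\<bar> \<le> a" for i using component_le_norm_cart order_trans by blast
      then have "\<bar>s $ i - s0 $ i\<bar> \<le> a" for i by simp
      then show "s \<in> ?B" by (auto simp: mem_box_cart abs_le_iff algebra_simps)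
    qed
    moreover have "?\<mu> ?B = K0 * ?\<mu> K"
    proof -
      have "a \<ge> 0" using l0 c by (simp add: a_def)
      then have "s0 \<in> ?B" by (auto simp: mem_box_cart)
      then have "?\<mu> ?B = (\<Prod>i\<in>(UNIV::'n set). 2 * a)"
        by (subst measure_completion, simp) (subst content_cbox_cart, auto)
      also have "\<dots> = ((2 * ?n / c) * l) ^ ?n" by (simp add: a_def mult.assoc)
      finally show ?thesis unfolding \<mu>K K0_def power_mult_distrib .
    qed
    ultimately show ?thesis by (intro exI[of _ ?B]) auto
  qed
  then obtain g where g: "\<And>K. K \<in> D \<Longrightarrow> g K \<in> lmeasurable" "\<And>K. K \<in> D \<Longrightarrow> S \<inter> f -` K \<subseteq> g K"
    "\<And>K. K \<in> D \<Longrightarrow> ?\<mu> (g K) \<le> K0 * ?\<mu> K" by metis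
  have fin: "?\<mu> (\<Union>K\<in>F. g K) \<le> K0 * ?\<mu> (\<Union>D)" if F: "F \<subseteq> D" "finite F" for F
  proof -
    have "?\<mu> (\<Union>K\<in>F. g K) \<le> (\<Sum>K\<in>F. ?\<mu> (g K))" using g(1) F by (intro measure_UNION_le) auto
    also have "\<dots> \<le> (\<Sum>K\<in>F. K0 * ?\<mu> K)" using g(3) F by (intro sum_mono) auto
    also have "\<dots> = K0 * (\<Sum>K\<in>F. ?\<mu> K)" by (simp add: sum_distrib_left)
    also have "(\<Sum>K\<in>F. ?\<mu> K) = ?\<mu> (\<Union>F)"
    proof (rule measure_negligible_finite_Union[symmetric, OF F(2)])
      show "pairwise (\<lambda>S T. negligible (S \<inter> T)) F"
      proof (rule pairwiseI)
        fix A B assume AB: "A \<in> F" "B \<in> F" "A \<noteq> B"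
        then have i: "interior A \<inter> interior B = {}" using D(3) F(1) by (auto simp: pairwise_def)
        have "A \<inter> B \<subseteq> frontier A \<union> frontier B"
          using i AB F(1) D(2) closure_subset unfolding frontier_def by fastforce
        moreover have "negligible (frontier A)" "negligible (frontier B)"
          using AB F(1) D(2) by (metis convex_box(1) negligible_convex_frontier subsetD)+
        ultimately show "negligible (A \<inter> B)" using negligible_Un negligible_subset by blast
      qed
    qed (use F lD in auto)
    also have "K0 * ?\<mu> (\<Union>F) \<le> K0 * ?\<mu> (\<Union>D)"
    proof (intro mult_left_mono measure_mono_fmeasurable)
      show "\<Union>F \<in> sets lebesgue" using F lD by (intro sets.finite_Union) (auto dest: fmeasurableD)
    qed (use F D(7) K0 in auto)
    finally show ?thesis .
  qed
  have "S \<subseteq> (\<Union>K\<in>D. g K)"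
  proof
    fix s assume s: "s \<in> S"
    then obtain K where "K \<in> D" "f s \<in> K" using S(2) D(6) by blast
    then show "s \<in> (\<Union>K\<in>D. g K)" using g(2)[of K] s by blast
  qed
  then have "?\<mu> S \<le> ?\<mu> (\<Union>K\<in>D. g K)"
    using S(1) fmeasurable_UN_bound[OF D(1) g(1) fin] by (intro measure_mono_fmeasurable) auto
  also have "\<dots> \<le> K0 * ?\<mu> (\<Union>D)" by (rule measure_UN_bound[OF D(1) g(1) fin])
  also have "\<dots> \<le> K0 * (?\<mu> E + e / K0)" using D(8) K0 by (intro mult_left_mono) auto
  also have "\<dots> = K0 * ?\<mu> E + e" using K0 by (simp add: distrib_left)
  finally show "?\<mu> S \<le> (2 * CARD('n) / c) ^ CARD('n) * ?\<mu> E + e" by (simp add: K0_def)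
qed

text \<open>Integrate \<open>G\<close> over \<open>A \<times> E\<close> in both orders. Integrating
  first over \<open>y\<close> gives at least \<open>\<alpha>\<close> for each parameter; integrating
  first over \<open>s\<close> gives at most the measure of the support, since
  \<open>G \<le> 1\<close>.\<close>

lemma average_bound:
  fixes G :: "real^'n \<Rightarrow> real^'n \<Rightarrow> real"
  assumes G: "continuous_on UNIV (\<lambda>q. G (fst q) (snd q))" "\<And>s y. 0 \<le> G s y" "\<And>s y. G s y \<le> 1"
    and E: "open E" "bounded E" and A: "compact A"
    and \<alpha>: "\<alpha> \<ge> 0" and \<beta>: "\<beta> \<ge> 0" and lower: "\<And>s. s \<in> A \<Longrightarrow> \<alpha> \<le> (LINT y:E|lebesgue. G s y)"
    and upper: "\<And>y. y \<in> E \<Longrightarrow> measure lebesgue {s \<in> A. G s y \<noteq> 0} \<le> \<beta>"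
  shows "measure lebesgue A * \<alpha> \<le> \<beta> * measure lebesgue E"
proof -
  have Am: "A \<in> sets borel" "A \<in> lmeasurable" using A by (auto simp: borel_compact lmeasurable_compact)
  have Em: "E \<in> sets borel" "E \<in> lmeasurable" using E by (auto simp: lmeasurable_open)
  have Gs: "continuous_on UNIV (G s)" for s
    using continuous_on_compose2[OF G(1), of UNIV "\<lambda>y. (s, y)"] by (simp add: continuous_on_Pair)
  have Gy: "continuous_on UNIV (\<lambda>s. G s y)" for y
    using continuous_on_compose2[OF G(1), of UNIV "\<lambda>s. (s, y)"] by (simp add: continuous_on_Pair)
  define H where "H s y = ennreal (indicat_real A s * (indicat_real E y * G s y))" for s y
  have Hm: "case_prod H \<in> borel_measurable (lborel \<Otimes>\<^sub>M lborel)"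
  proof -
    have [measurable]: "(\<lambda>q. G (fst q) (snd q)) \<in> borel_measurable (borel \<Otimes>\<^sub>M borel)"
      unfolding borel_prod by (rule borel_measurable_continuous_onI[OF G(1)])
    note [measurable] = Am(1) Em(1)
    have "(\<lambda>q. indicat_real A (fst q) * (indicat_real E (snd q) * G (fst q) (snd q)))
        \<in> borel_measurable (borel \<Otimes>\<^sub>M borel)"
      by measurable
    then have "(\<lambda>q. indicat_real A (fst q) * (indicat_real E (snd q) * G (fst q) (snd q))) \<in> borel_measurable lborel"
      by (simp add: borel_prod)
    then show ?thesis unfolding H_def case_prod_unfold lborel_prod by measurable
  qed
  have "ennreal (measure lebesgue A * \<alpha>) = (\<integral>\<^sup>+ s. ennreal \<alpha> * indicator A s \<partial>lborel)"
    using Am \<alpha> by (simp add: nn_integral_cmult emeasure_eq_measure2 ennreal_mult mult.commute)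
      (simp add: fmeasurable_def emeasure_eq_ennreal_measure)
  also have "\<dots> \<le> (\<integral>\<^sup>+ s. (\<integral>\<^sup>+ y. H s y \<partial>lborel) \<partial>lborel)"
  proof (rule nn_integral_mono)
    fix s
    show "ennreal \<alpha> * indicator A s \<le> (\<integral>\<^sup>+ y. H s y \<partial>lborel)"
    proof (cases "s \<in> A")
      case True
      have int: "integrable lebesgue (\<lambda>y. indicat_real E y * G s y)"
        using set_integrable_continuous[OF E Gs[of s]] by (simp add: set_integrable_def)
      have "(\<integral>\<^sup>+ y. H s y \<partial>lborel) = (\<integral>\<^sup>+ y. ennreal (indicat_real E y * G s y) \<partial>lebesgue)"
        using True by (simp add: H_def nn_integral_completion)
      also have "\<dots> = ennreal (LINT y:E|lebesgue. G s y)"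
        using int G(2) by (subst nn_integral_eq_integral) (auto simp: set_lebesgue_integral_def)
      finally show ?thesis using lower[OF True] True by (simp add: ennreal_leI)
    qed simp
  qed
  also have "\<dots> = (\<integral>\<^sup>+ y. (\<integral>\<^sup>+ s. H s y \<partial>lborel) \<partial>lborel)"
    using lborel_pair.Fubini'[OF Hm] by simp
  also have "\<dots> \<le> (\<integral>\<^sup>+ y. ennreal \<beta> * indicator E y \<partial>lborel)"
  proof (rule nn_integral_mono)
    fix y
    show "(\<integral>\<^sup>+ s. H s y \<partial>lborel) \<le> ennreal \<beta> * indicator E y"
    proof (cases "y \<in> E")
      case True
      let ?S = "{s \<in> A. G s y \<noteq> 0}"
      have [measurable]: "(\<lambda>s. G s y) \<in> borel_measurable borel"
        by (rule borel_measurable_continuous_onI[OF Gy])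
      note [measurable] = Am(1)
      have "{s \<in> space borel. s \<in> A \<and> G s y \<noteq> 0} \<in> sets borel" by measurable
      then have Sm: "?S \<in> sets borel" by simp
      have Sf: "?S \<in> lmeasurable" by (rule fmeasurableI2[OF Am(2)]) (use Sm in auto)
      have "(\<integral>\<^sup>+ s. H s y \<partial>lborel) \<le> (\<integral>\<^sup>+ s. indicator ?S s \<partial>lborel)"
        using G(2,3) True by (intro nn_integral_mono) (auto simp: H_def indicator_def)
      also have "\<dots> = emeasure lebesgue ?S" using Sm by simp
      also have "\<dots> = ennreal (measure lebesgue ?S)" using Sf by (rule emeasure_eq_measure2)
      also have "\<dots> \<le> ennreal \<beta>" using upper[OF True] by (rule ennreal_leI)
      finally show ?thesis using True by simp
    qed (simp add: H_def)
  qed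
  also have "\<dots> = ennreal (\<beta> * measure lebesgue E)"
    using Em \<beta> by (simp add: nn_integral_cmult ennreal_mult)
      (simp add: fmeasurable_def emeasure_eq_ennreal_measure)
  finally show ?thesis using \<beta> by simp
qed

text \<open>A basis adapted to the flag of the spaces \<open>comm_span\<close>. When the basis at
  level \<open>j\<close> is extended, a new word has length exactly \<open>Suc j\<close>, for
  otherwise its value would already lie in the previous span. Hence the lengths add up to the sum
  defining the homogeneous dimension.\<close>

lemma comm_span_basis:
  fixes X :: "'m \<Rightarrow> real^'n \<Rightarrow> real^'n"
  defines "ev \<equiv> \<lambda>w x. iter_commutator X w x"
  shows "\<exists>B. finite B \<and> (\<forall>w\<in>B. w \<noteq> [] \<and> length w \<le> j) \<and> inj_on (\<lambda>w. ev w x) B \<and>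
    independent ((\<lambda>w. ev w x) ` B) \<and> span ((\<lambda>w. ev w x) ` B) = comm_span X j x \<and>
    (\<Sum>w\<in>B. length w) = (\<Sum>i = 1..j. i * (comm_dim X i x - comm_dim X (i - 1) x))"
proof (induction j)
  case 0
  show ?case by (intro exI[of _ "{}"]) (auto simp: comm_span_def independent_empty)
next
  case (Suc j)
  let ?e = "\<lambda>w. ev w x"
  obtain B where B: "finite B" "\<And>w. w \<in> B \<Longrightarrow> w \<noteq> [] \<and> length w \<le> j" "inj_on ?e B"
    "independent (?e ` B)" "span (?e ` B) = comm_span X j x"
    "(\<Sum>w\<in>B. length w) = (\<Sum>i = 1..j. i * (comm_dim X i x - comm_dim X (i - 1) x))"
    using Suc by blast
  define Gen where "Gen = {?e w | w. w \<noteq> [] \<and> length w \<le> Suc j}"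
  have cs: "comm_span X (Suc j) x = span Gen" by (simp add: comm_span_def Gen_def ev_def)
  have "?e ` B \<subseteq> Gen" using B(2) le_SucI unfolding Gen_def by blast
  then obtain C where C: "?e ` B \<subseteq> C" "C \<subseteq> Gen" "independent C" "Gen \<subseteq> span C"
    using maximal_independent_subset_extend[OF _ B(4)] by metis
  have spC: "span C = span Gen" using C(2,4) by (metis span_mono span_span subset_antisym)
  have fC: "finite C" using C(3) independent_imp_finite by blast
  define W where "W v = (SOME w. w \<noteq> [] \<and> length w \<le> Suc j \<and> ?e w = v)" for v
  have W: "W v \<noteq> []" "length (W v) \<le> Suc j" "?e (W v) = v" if "v \<in> C" for v
  proof -
    have "\<exists>w. w \<noteq> [] \<and> length w \<le> Suc j \<and> ?e w = v" using that C(2) by (auto simp: Gen_def)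
    from someI_ex[OF this] show "W v \<noteq> []" "length (W v) \<le> Suc j" "?e (W v) = v" by (auto simp: W_def)
  qed
  have len: "length (W v) = Suc j" if v: "v \<in> C - ?e ` B" for v
  proof (rule ccontr)
    assume "length (W v) \<noteq> Suc j"
    then have "length (W v) \<le> j" using W(2)[of v] v by auto
    then have "v \<in> comm_span X j x"
      unfolding comm_span_def using W(1,3)[of v] v by (intro span_base) (auto simp: ev_def intro!: exI[of _ "W v"])
    then have "v \<in> span (?e ` B)" using B(5) by simp
    moreover have "?e ` B \<subseteq> C - {v}" using C(1) v by auto
    ultimately have "v \<in> span (C - {v})" using span_mono by blast
    then show False using C(3) v by (auto simp: dependent_def)
  qed
  define B' where "B' = B \<union> W ` (C - ?e ` B)"
  have eB': "?e ` B' = C" using C(1) W(3) by (auto simp: B'_def image_Un image_image)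
  have injW: "inj_on W (C - ?e ` B)" by (rule inj_on_inverseI[of _ "?e"]) (use W(3) in auto)
  have disj: "B \<inter> W ` (C - ?e ` B) = {}" using W(3) by force
  have inj: "inj_on ?e B'"
    unfolding B'_def
  proof (rule inj_on_Un[THEN iffD2], intro conjI)
    show "inj_on ?e (W ` (C - ?e ` B))" by (rule inj_onI) (use W(3) in auto)
    show "?e ` (B - W ` (C - ?e ` B)) \<inter> ?e ` (W ` (C - ?e ` B) - B) = {}" using W(3) by auto
  qed (rule B(3))
  have dimS: "comm_dim X (Suc j) x = card C"
    unfolding comm_dim_def cs spC[symmetric] using C(3) by (simp add: dim_eq_card_independent)
  have dimj: "comm_dim X j x = card (?e ` B)"
    unfolding comm_dim_def B(5)[symmetric] using B(4) by (simp add: dim_eq_card_independent)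
  have "(\<Sum>w\<in>B'. length w) = (\<Sum>w\<in>B. length w) + (\<Sum>w\<in>W ` (C - ?e ` B). length w)"
    unfolding B'_def using B(1) fC disj by (intro sum.union_disjoint) auto
  also have "(\<Sum>w\<in>W ` (C - ?e ` B). length w) = Suc j * card (C - ?e ` B)"
    using len by (simp add: sum.reindex[OF injW])
  also have "card (C - ?e ` B) = comm_dim X (Suc j) x - comm_dim X j x"
    using C(1) B(1) by (simp add: dimS dimj card_Diff_subset)
  finally have "(\<Sum>w\<in>B'. length w) = (\<Sum>i = 1..Suc j. i * (comm_dim X i x - comm_dim X (i - 1) x))"
    using B(6) by simp
  moreover have "finite B'" using B(1) fC by (simp add: B'_def)
  moreover have "\<forall>w\<in>B'. w \<noteq> [] \<and> length w \<le> Suc j" using B(2) W(1,2) by (auto simp: B'_def intro: le_SucI)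
  ultimately show ?case using inj eB' C(3) cs spC by (intro exI[of _ B']) auto
qed

text \<open>The adapted basis at level \<open>comm_step\<close>, indexed by the coordinate type
  itself, so that its parameters form a vector in a space of the same dimension.\<close>

lemma comm_words:
  fixes X :: "'m \<Rightarrow> real^'n \<Rightarrow> real^'n"
  assumes "comm_span X s x = UNIV"
  shows "\<exists>w :: 'n \<Rightarrow> 'm list. (\<forall>k. w k \<noteq> [] \<and> length (w k) \<le> s) \<and> (\<Sum>k\<in>UNIV. length (w k)) = pointwise_hom_dim X x \<and>
    (\<forall>a. (\<Sum>k\<in>UNIV. a k *\<^sub>R iter_commutator X (w k) x) = 0 \<longrightarrow> a = (\<lambda>k. 0))"
proof -
  let ?e = "\<lambda>w. iter_commutator X w x"
  have "comm_span X (comm_step X x) x = UNIV" unfolding comm_step_def using assms by (rule LeastI)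
  then obtain B where B: "finite B" "\<And>w. w \<in> B \<Longrightarrow> w \<noteq> [] \<and> length w \<le> comm_step X x" "inj_on ?e B" "independent (?e ` B)"
    "span (?e ` B) = UNIV" "(\<Sum>w\<in>B. length w) = pointwise_hom_dim X x"
    using comm_span_basis[where X = X and j = "comm_step X x" and x = x] unfolding pointwise_hom_dim_def by auto
  have "card (?e ` B) = dim (UNIV :: (real^'n) set)"
    using B(4,5) by (metis dim_eq_card_independent dim_span)
  then have "card B = CARD('n)" using card_image[OF B(3)] by simp
  then obtain w where w: "bij_betw w (UNIV :: 'n set) B"
    using finite_same_card_bij[of "UNIV :: 'n set" B] B(1) by auto
  have wB: "w k \<in> B" for k using w by (auto simp: bij_betw_def)
  have "(\<Sum>k\<in>UNIV. length (w k)) = pointwise_hom_dim X x"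
    using sum.reindex_bij_betw[OF w, of length] B(6) by simp
  moreover have "a = (\<lambda>k. 0)" if a: "(\<Sum>k\<in>UNIV. a k *\<^sub>R ?e (w k)) = 0" for a
  proof -
    have inj: "inj (\<lambda>k. ?e (w k))"
      using comp_inj_on[of w UNIV ?e] w B(3) by (auto simp: bij_betw_def o_def)
    have "(\<Sum>v\<in>range (\<lambda>k. ?e (w k)). a (inv (\<lambda>k. ?e (w k)) v) *\<^sub>R v) = 0"
      unfolding sum.reindex[OF inj] using a inv_f_f[OF inj] by (simp add: o_def)
    moreover have "range (\<lambda>k. ?e (w k)) \<subseteq> ?e ` B" using wB by auto
    ultimately have "a (inv (\<lambda>k. ?e (w k)) v) = 0" if "v \<in> range (\<lambda>k. ?e (w k))" for v
      using independentD[OF B(4), of "range (\<lambda>k. ?e (w k))" "\<lambda>v. a (inv (\<lambda>k. ?e (w k)) v)" v] that by simp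
    then show ?thesis using inv_f_f[OF inj] by (metis (no_types, lifting) rangeI ext)
  qed
  moreover have "comm_step X x \<le> s" unfolding comm_step_def using assms by (rule Least_le)
  ultimately show ?thesis using B(2) wB order_trans by blast
qed

section \<open>The isoperimetric inequality\<close>

context C11_fields
begin

text \<open>What both scales use of the brackets: for each small \<open>r\<close> the end point
  expands distances in the parameters, with a constant independent of \<open>r\<close> and of the
  starting point.\<close>

definition local_chart :: "'a \<Rightarrow> ('k::finite \<Rightarrow> 'm list) \<Rightarrow> 'k list \<Rightarrow> real \<Rightarrow> real \<Rightarrow> bool" where
  "local_chart x0 w ks \<delta> c \<longleftrightarrow> \<delta> > 0 \<and> c > 0 \<and> (\<forall>k. w k \<noteq> []) \<and>
    (\<forall>r (s::real^'k) s' y. 0 < r \<longrightarrow> r < \<delta> \<longrightarrow> (\<forall>k. \<bar>s $ k\<bar> \<le> r ^ length (w k)) \<longrightarrow>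
      (\<forall>k. \<bar>s' $ k\<bar> \<le> r ^ length (w k)) \<longrightarrow> norm (y - x0) < \<delta> \<longrightarrow>
      c * norm (s - s') \<le> norm (multi w ks r (($) s) y - multi w ks r (($) s') y))"

lemma local_chartD:
  fixes s s' :: "real^'k::finite"
  assumes "local_chart x0 w ks \<delta> c" "0 < r" "r < \<delta>" "\<And>k. \<bar>s $ k\<bar> \<le> r ^ length (w k)"
    "\<And>k. \<bar>s' $ k\<bar> \<le> r ^ length (w k)" "norm (y - x0) < \<delta>"
  shows "c * norm (s - s') \<le> norm (multi w ks r (($) s) y - multi w ks r (($) s') y)"
  using assms unfolding local_chart_def by blast

lemma multi_continuous_joint:
  "continuous_on UNIV (\<lambda>q :: (real^'k) \<times> 'a. multi w ks r (($) (fst q)) (snd q))"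
  by (rule multi_continuous) (intro continuous_intros)+

lemma multi_continuous_s: "continuous_on S (\<lambda>s :: real^'k. multi w ks r (($) s) y)"
  by (rule continuous_on_subset[OF multi_continuous]) (auto intro!: continuous_intros)

lemma total_time_rev_flows [simp]: "total_time (rev_flows ts) = total_time ts"
  by (induction ts) auto

end

lemma C11_fields_local_chart:
  fixes Y X :: "'m \<Rightarrow> real^'n \<Rightarrow> real^'n"
  assumes "C11_fields Y B" and V: "open V" "x0 \<in> V" "\<And>i. smooth_on V (Y i)" "\<And>i x. x \<in> V \<Longrightarrow> Y i x = X i x"
    and span: "comm_span X s x0 = UNIV"
  shows "\<exists>(w :: 'n \<Rightarrow> 'm list) ks \<delta> c. C11_fields.local_chart Y x0 w ks \<delta> c \<and>
    (\<Sum>k\<in>UNIV. length (w k)) = pointwise_hom_dim X x0"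
proof -
  interpret C11_fields Y B by fact
  interpret smooth_near Y B V x0 using V by unfold_locales auto
  have sX: "smooth_on V (X i)" for i
    using V(3)[of i] V(4) by (auto intro: smooth_on_cong_open[OF V(1)])
  \<comment> \<open>Equality at \<open>x0\<close> alone would not pass through a bracket, which
    differentiates; so it is shown on the open set \<open>V\<close>.\<close>
  have nest: "nest w x = iter_commutator X w x" if "x \<in> V" for w x
    using that
  proof (induction w arbitrary: x)
    case (Cons i w)
    show ?case
    proof (cases "w = []")
      case False
      have "commutator (X i) (iter_commutator X w) x = lie_bracket (X i) (iter_commutator X w) x"
        using sX smooth_on_iter_commutator[OF V(1) sX] Cons.prems
        by (intro commutator_eq_lie_bracket smooth_on_differentiable[of V]) auto
      also have "\<dots> = lie_bracket (Y i) (nest w) x"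
        using Cons V(4) by (intro lie_bracket_cong_open[OF V(1)]) auto
      finally show ?thesis using False by (simp add: nest_Cons iter_commutator_Cons)
    qed (use V(4) Cons.prems in simp)
  qed simp
  obtain w :: "'n \<Rightarrow> 'm list" where w: "\<And>k. w k \<noteq> []" "(\<Sum>k\<in>UNIV. length (w k)) = pointwise_hom_dim X x0"
    "\<And>a. (\<Sum>k\<in>UNIV. a k *\<^sub>R iter_commutator X (w k) x0) = 0 \<Longrightarrow> a = (\<lambda>k. 0)"
    using comm_words[OF span] by blast
  obtain ks :: "'n list" where ks: "set ks = UNIV" "distinct ks"
    using finite_distinct_list[of "UNIV :: 'n set"] by auto
  have "a = (\<lambda>k. 0)" if "(\<Sum>k\<in>UNIV. a k *\<^sub>R nest (w k) x0) = 0" for a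
    using that w(3) nest[OF V(2)] by simp
  from multi_bilipschitz[where w = w and ks = ks, OF w(1) ks(2,1) this] obtain \<delta> c where "local_chart x0 w ks \<delta> c"
    using w(1) unfolding local_chart_def by blast
  with w(2) show ?thesis by blast
qed

text \<open>The points from which no chain of flows leaves \<open>K\<close> form a compact set; by invariance of domain
  it is open, hence empty.\<close>

lemma C11_fields_leave_compact:
  fixes Y :: "'m \<Rightarrow> real^'n \<Rightarrow> real^'n"
  assumes "C11_fields Y B" and K: "compact K" "x \<in> K"
    and chart: "\<And>x. x \<in> K \<Longrightarrow> \<exists>(w :: 'n \<Rightarrow> 'm list) ks \<delta> c. C11_fields.local_chart Y x w ks \<delta> c"
  shows "\<exists>ts. C11_fields.flows Y ts x \<notin> K"
proof (rule ccontr)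
  interpret C11_fields Y B by fact
  assume stay: "\<nexists>ts. flows ts x \<notin> K"
  define T where "T = (\<Inter>ts. flows ts -` K)"
  have xT: "x \<in> T" using stay by (auto simp: T_def)
  have TK: "T \<subseteq> K"
  proof
    fix z assume "z \<in> T"
    then have "flows [] z \<in> K" unfolding T_def by blast
    then show "z \<in> K" by simp
  qed
  have "closed T"
    unfolding T_def using flows_continuous compact_imp_closed[OF K(1)]
    by (intro closed_INT ballI closed_vimage) (auto simp: continuous_on_eq_continuous_at)
  moreover have "open T"
    unfolding open_subopen[of T]
  proof
    fix x0 assume x0: "x0 \<in> T"
    then obtain w :: "'n \<Rightarrow> 'm list" and ks \<delta> c where ch: "local_chart x0 w ks \<delta> c" using chart TK by blast
    then have \<delta>: "\<delta> > 0" "c > 0" "\<And>k. w k \<noteq> []" by (auto simp: local_chart_def)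
    define r where "r = \<delta> / 2"
    have r: "0 < r" "r < \<delta>" using \<delta> by (auto simp: r_def)
    define Bx where "Bx = box (\<chi> k. - (r ^ length (w k))) (\<chi> k. r ^ length (w k))"
    have Bxs: "\<bar>s $ k\<bar> \<le> r ^ length (w k)" if "s \<in> Bx" for s k
    proof -
      have "- (r ^ length (w k)) < s $ k" "s $ k < r ^ length (w k)"
        using that by (auto simp: Bx_def mem_box_cart)
      then show ?thesis by linarith
    qed
    have 0: "0 \<in> Bx" using r by (auto simp: Bx_def mem_box_cart)
    let ?F = "\<lambda>s :: real^'n. multi w ks r (($) s) x0"
    have "inj_on ?F Bx"
    proof (rule inj_onI)
      fix s s' assume s: "s \<in> Bx" "s' \<in> Bx" and eq: "?F s = ?F s'"
      have "c * norm (s - s') \<le> norm (?F s - ?F s')"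
        by (rule local_chartD[OF ch r]) (use Bxs s \<delta>(1) in auto)
      then show "s = s'" using eq \<delta>(2) by (simp add: mult_le_0_iff)
    qed
    then have oF: "open (?F ` Bx)"
      using multi_continuous_s by (intro invariance_of_domain) (auto simp: Bx_def)
    obtain ts0 where ts0: "multi w ks r (($) (0 :: real^'n)) = flows ts0"
      using multi_flows[of w r "($) (0 :: real^'n)" ks] \<delta>(3) r(1) by auto
    \<comment> \<open>The chain \<open>ts0\<close> with parameter 0 sends \<open>x0\<close> into the
      open image, hence also a neighbourhood of \<open>x0\<close>. A point sent there by
      \<open>ts0\<close> is reached from \<open>x0\<close> by some chain \<open>ts1\<close> followed
      by \<open>ts0\<close> reversed; whatever leaves \<open>K\<close> from that point would
      therefore leave \<open>K\<close> from \<open>x0\<close>.\<close>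
    let ?W = "flows ts0 -` (?F ` Bx)"
    have "open ?W"
      using oF flows_continuous by (intro open_vimage) auto
    moreover have "x0 \<in> ?W"
    proof -
      have "flows ts0 x0 = ?F 0" using ts0 by simp
      then show ?thesis using 0 by blast
    qed
    moreover have "?W \<subseteq> T"
    proof
      fix y assume "y \<in> ?W"
      then obtain s where s: "s \<in> Bx" "flows ts0 y = ?F s" by auto
      obtain ts1 where "multi w ks r (($) s) = flows ts1"
        using multi_flows[of w r "($) s" ks] \<delta>(3) r(1) Bxs[OF s(1)] by auto
      then have "y = flows (rev_flows ts0) (flows ts1 x0)"
        using s(2) flows_rev_flows[of ts0 y] by simp
      then have "flows ts y = flows (ts @ rev_flows ts0 @ ts1) x0" for ts by simp
      moreover have "flows (ts @ rev_flows ts0 @ ts1) x0 \<in> K" for ts using x0 unfolding T_def by blast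
      ultimately show "y \<in> T" by (auto simp: T_def)
    qed
    ultimately show "\<exists>T'. open T' \<and> x0 \<in> T' \<and> T' \<subseteq> T" by blast
  qed
  ultimately have "T = {} \<or> T = UNIV" using clopen by blast
  moreover have "T \<noteq> UNIV"
  proof
    assume "T = UNIV"
    then have "bounded (UNIV :: (real^'n) set)" using TK bounded_subset compact_imp_bounded[OF K(1)] by blast
    then show False using not_bounded_UNIV by blast
  qed
  ultimately show False using xT by auto
qed

section \<open>Volume estimates for one set at a fixed chain and at a small scale\<close>

context perimeter_flows
begin

lemma E_measurable: "E \<in> lmeasurable"
  using open_E bounded_E by (simp add: lmeasurable_open)

lemma IE_approx:
  assumes "open O'" "O' \<subseteq> E" "\<epsilon> > 0"
  obtains \<psi> :: "real^'n \<Rightarrow> real" where "Ck_on 1 UNIV \<psi>" "\<And>x. 0 \<le> \<psi> x" "\<And>x. \<psi> x \<le> 1" "\<And>x. x \<notin> O' \<Longrightarrow> \<psi> x = 0"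
    "measure lebesgue O' - \<epsilon> \<le> IE \<psi>" "0 \<le> IE \<psi>"
proof -
  have bO: "bounded O'" using bounded_subset[OF bounded_E assms(2)] .
  obtain \<psi> :: "real^'n \<Rightarrow> real" where \<psi>: "Ck_on 1 UNIV \<psi>" "\<And>x. 0 \<le> \<psi> x" "\<And>x. \<psi> x \<le> 1" "\<And>x. x \<notin> O' \<Longrightarrow> \<psi> x = 0"
    "measure lebesgue O' - \<epsilon> \<le> (LINT x:O'|lebesgue. \<psi> x)"
    by (rule C1_approx_indicator[OF assms(1) bO assms(3)]) (rule that)
  have "(LINT x:O'|lebesgue. \<psi> x) = IE \<psi>"
    unfolding set_lebesgue_integral_def using \<psi>(4) assms(2)
    by (intro Bochner_Integration.integral_cong) (auto simp: indicator_def)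
  moreover have "0 \<le> IE \<psi>"
    unfolding set_lebesgue_integral_def using \<psi>(2) by (intro Bochner_Integration.integral_nonneg) auto
  ultimately show ?thesis using that \<psi> by auto
qed

text \<open>A test function supported in \<open>E \<inter> W\<close>, composed with the reversed
  chain, vanishes on \<open>E\<close>, because the chain moves \<open>W\<close> off
  \<open>E\<close>. So in \<open>flows_cost\<close> nothing remains on the right and the cost has to
  pay for the whole integral.\<close>

lemma large_scale:
  assumes W: "open W" "\<And>x. x \<in> W \<Longrightarrow> flows ts x \<notin> E"
  shows "measure lebesgue (E \<inter> W) \<le> exp (\<Lambda> * total_time ts) * total_time ts * p"
proof (rule field_le_epsilon)
  fix e :: real assume e: "e > 0"
  obtain \<psi> :: "real^'n \<Rightarrow> real" where \<psi>: "Ck_on 1 UNIV \<psi>" "\<And>x. 0 \<le> \<psi> x" "\<And>x. \<psi> x \<le> 1"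
    "\<And>x. x \<notin> E \<inter> W \<Longrightarrow> \<psi> x = 0" "measure lebesgue (E \<inter> W) - e \<le> IE \<psi>" "0 \<le> IE \<psi>"
    by (rule IE_approx[OF open_Int[OF open_E W(1)] Int_lower1 e]) (rule that)
  let ?T = "total_time ts"
  have "\<psi> (flows (rev_flows ts) y) = 0" if "y \<in> E" for y
    using W(2)[of "flows (rev_flows ts) y"] flows_flows_rev[of ts y] that by (intro \<psi>(4)) auto
  then have "IE (\<lambda>y. \<psi> (flows (rev_flows ts) y)) = IE (\<lambda>y. 0)"
    using open_E by (intro set_lebesgue_integral_cong) auto
  then have "exp (- \<Lambda> * ?T) * IE \<psi> - ?T * p \<le> 0"
    using flows_cost[OF \<psi>(1-3), of "rev_flows ts"] by simp
  then have "exp (\<Lambda> * ?T) * (exp (- \<Lambda> * ?T) * IE \<psi>) \<le> exp (\<Lambda> * ?T) * (?T * p)"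
    by (intro mult_left_mono) auto
  then have "IE \<psi> \<le> exp (\<Lambda> * ?T) * ?T * p"
    by (simp add: exp_minus mult.assoc[symmetric])
  then show "measure lebesgue (E \<inter> W) \<le> exp (\<Lambda> * ?T) * ?T * p + e" using \<psi>(5) by simp
qed

text \<open>\<open>average_bound\<close> over the parameter box: \<open>flows_cost\<close> gives the
  lower bound \<open>\<alpha>\<close> for each parameter, and the expansion of the chart bounds the
  parameters that carry a given point into the support of \<open>\<psi>\<close>. The box has volume
  at least r^Q.\<close>

lemma small_scale:
  fixes w :: "'n \<Rightarrow> 'm list"
  assumes chart: "local_chart x0 w ks \<delta> c" and Q: "(\<Sum>k\<in>UNIV. length (w k)) \<le> Q"
    and N: "N = real (steps_number w ks)"
    and r: "0 < r" "r < \<delta>" "r \<le> 1" "r \<le> \<delta> / (2 * (N * B + 1))"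
  shows "measure lebesgue (E \<inter> ball x0 (\<delta> / 2)) \<le>
    exp (\<Lambda> * N) * (N + (2 * CARD('n) / c) ^ CARD('n)) * (r * p + (measure lebesgue E)\<^sup>2 / r ^ Q)"
proof (rule field_le_epsilon)
  fix e :: real assume e: "e > 0"
  define K where "K = (2 * CARD('n) / c) ^ CARD('n)"
  define m where "m = measure lebesgue E"
  have \<delta>: "\<delta> > 0" "c > 0" "\<And>k. w k \<noteq> []" using chart by (auto simp: local_chart_def)
  have K: "K > 0" using \<delta>(2) by (simp add: K_def)
  have N0: "N \<ge> 0" "N * B \<ge> 0" using B_nonneg by (simp_all add: N)
  let ?O = "E \<inter> ball x0 (\<delta> / 2)"
  obtain \<psi> :: "real^'n \<Rightarrow> real" where \<psi>: "Ck_on 1 UNIV \<psi>" "\<And>x. 0 \<le> \<psi> x" "\<And>x. \<psi> x \<le> 1"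
    "\<And>x. x \<notin> ?O \<Longrightarrow> \<psi> x = 0" "measure lebesgue ?O - e \<le> IE \<psi>" "0 \<le> IE \<psi>"
    by (rule IE_approx[OF open_Int[OF open_E open_ball] Int_lower1 e]) (rule that)
  let ?F = "\<lambda>(s :: real^'n) y. multi w ks r (($) s) y"
  define A :: "(real^'n) set" where "A = cbox (\<chi> k. - (r ^ length (w k))) (\<chi> k. r ^ length (w k))"
  have As: "\<bar>s $ k\<bar> \<le> r ^ length (w k)" if "s \<in> A" for s k
  proof -
    have "- (r ^ length (w k)) \<le> s $ k" "s $ k \<le> r ^ length (w k)" using that by (auto simp: A_def mem_box_cart)
    then show ?thesis by linarith
  qed
  have "0 \<in> A" using r(1) by (auto simp: A_def mem_box_cart)
  then have ne: "cbox (\<chi> k. - (r ^ length (w k))) (\<chi> k. r ^ length (w k)) \<noteq> ({} :: (real^'n) set)"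
    unfolding A_def by blast
  have "measure lebesgue A = (\<Prod>k\<in>UNIV. 2 * r ^ length (w k))"
    unfolding A_def by (simp add: content_cbox_cart[OF ne])
  also have "\<dots> \<ge> (\<Prod>k\<in>UNIV. r ^ length (w k))" using r(1) by (intro prod_mono) auto
  finally have "measure lebesgue A \<ge> r ^ (\<Sum>k\<in>UNIV. length (w k))" by (simp add: power_sum)
  \<comment> \<open>Here \<open>r \<le> 1\<close> allows the exponent of the point to be replaced by
    the larger \<open>Q\<close>, common to all points.\<close>
  moreover have "r ^ (\<Sum>k\<in>UNIV. length (w k)) \<ge> r ^ Q" using Q r by (intro power_decreasing) auto
  ultimately have Am: "measure lebesgue A \<ge> r ^ Q" by linarith
  define \<alpha> where "\<alpha> = exp (- \<Lambda> * N) * IE \<psi> - N * r * p"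
  have avg: "measure lebesgue A * \<alpha> \<le> (K * m) * measure lebesgue E" if "\<alpha> \<ge> 0"
  proof (rule average_bound[where G = "\<lambda>s y. \<psi> (?F s y)", OF _ _ _ open_E bounded_E])
    show "continuous_on UNIV (\<lambda>q. \<psi> (?F (fst q) (snd q)))"
      by (rule continuous_on_compose2[OF Ck_on_continuous_on[OF \<psi>(1)] multi_continuous_joint]) auto
    show "compact A" by (simp add: A_def)
    show "\<alpha> \<le> IE (\<lambda>y. \<psi> (?F s y))" if s: "s \<in> A" for s
    proof -
      obtain ts where ts: "multi w ks r (($) s) = flows ts" "total_time ts \<le> N * r"
        using multi_flows[of w r "($) s" ks] \<delta>(3) r(1) As[OF s] N by auto
      have "N * r \<le> N * 1" using N0 r by (intro mult_left_mono) auto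
      then have T: "total_time ts \<le> N" using ts(2) by simp
      have "exp (- \<Lambda> * N) \<le> exp (- \<Lambda> * total_time ts)"
        using mult_left_mono[OF T \<Lambda>_nonneg] by simp
      then have "exp (- \<Lambda> * N) * IE \<psi> \<le> exp (- \<Lambda> * total_time ts) * IE \<psi>"
        using \<psi>(6) by (rule mult_right_mono)
      moreover have "total_time ts * p \<le> N * r * p" using ts(2) p_nonneg by (rule mult_right_mono)
      ultimately show ?thesis
        using flows_cost[OF \<psi>(1-3), of ts] unfolding \<alpha>_def ts(1) by linarith
    qed
    show "measure lebesgue {s \<in> A. \<psi> (?F s y) \<noteq> 0} \<le> K * m" if "y \<in> E" for y
    proof (cases "norm (y - x0) < \<delta>")
      case True
      let ?S = "{s \<in> A. \<psi> (?F s y) \<noteq> 0}"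
      have cont: "continuous_on UNIV (\<lambda>s. \<psi> (?F s y))"
        by (rule continuous_on_compose2[OF Ck_on_continuous_on[OF \<psi>(1)] multi_continuous_s]) auto
      then have "open ((\<lambda>s. \<psi> (?F s y)) -` (- {0}))" by (intro open_vimage) auto
      moreover have "?S = A \<inter> (\<lambda>s. \<psi> (?F s y)) -` (- {0})" by auto
      ultimately have Sb: "?S \<in> sets borel" by (simp add: A_def)
      have "?S \<in> lmeasurable"
        by (rule fmeasurableI2[of A]) (use Sb in \<open>auto simp: A_def\<close>)
      moreover have "(\<lambda>s. ?F s y) ` ?S \<subseteq> E" using \<psi>(4) by blast
      moreover have "c * norm (s - s') \<le> norm (?F s y - ?F s' y)" if "s \<in> ?S" "s' \<in> ?S" for s s'
        by (rule local_chartD[OF chart r(1,2) _ _ True]) (use As that in auto)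
      ultimately show ?thesis
        unfolding K_def m_def by (intro measure_expanding_preimage[OF open_E bounded_E \<delta>(2)]) auto
    next
      case False
      \<comment> \<open>Outside the range of the chart nothing is to be counted: a chain displaces
        \<open>y\<close> by at most \<open>N * B * r\<close>, which is too little to reach the ball
        of radius \<open>\<delta> / 2\<close>. The last bound on \<open>r\<close> serves this
        purpose.\<close>
      have "\<psi> (?F s y) = 0" if s: "s \<in> A" for s
      proof (rule \<psi>(4))
        have "norm (?F s y - y) \<le> N * (B * r)"
          unfolding N by (rule multi_near[OF \<delta>(3) r(1) As[OF s]])
        moreover have "(N * B + 1) * r \<le> \<delta> / 2"
          using r(4) N0(2) by (simp add: field_simps)
        moreover have "norm (y - x0) \<le> norm (?F s y - y) + norm (?F s y - x0)"
          using norm_triangle_ineq4[of "?F s y - x0" "?F s y - y"] by simp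
        ultimately have "norm (?F s y - x0) \<ge> \<delta> / 2" using False r(1) by (simp add: algebra_simps)
        then show "?F s y \<notin> ?O" by (simp add: dist_norm norm_minus_commute)
      qed
      then have emp: "{s \<in> A. \<psi> (?F s y) \<noteq> 0} = {}" by auto
      show ?thesis unfolding emp using K by (simp add: m_def)
    qed
    show "0 \<le> K * m" using K by (simp add: m_def)
  qed (use \<psi> that in auto)
  have "\<alpha> \<le> K * m\<^sup>2 / r ^ Q"
  proof (cases "\<alpha> \<le> 0")
    case True
    have "0 \<le> K * m\<^sup>2 / r ^ Q" using K r(1) by simp
    then show ?thesis using True by simp
  next
    case False
    then have "r ^ Q * \<alpha> \<le> measure lebesgue A * \<alpha>" using Am by (intro mult_right_mono) auto
    also have "\<dots> \<le> K * m\<^sup>2" using avg False by (simp add: m_def power2_eq_square mult.assoc)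
    finally show ?thesis using r(1) by (simp add: field_simps)
  qed
  then have "exp (- \<Lambda> * N) * IE \<psi> \<le> N * (r * p) + K * (m\<^sup>2 / r ^ Q)" by (simp add: \<alpha>_def)
  also have "\<dots> \<le> (N + K) * (r * p + m\<^sup>2 / r ^ Q)"
  proof -
    have "0 \<le> N * (m\<^sup>2 / r ^ Q)" "0 \<le> K * (r * p)" using N0(1) K r(1) p_nonneg by auto
    then show ?thesis unfolding distrib_left distrib_right by linarith
  qed
  finally have "exp (\<Lambda> * N) * (exp (- \<Lambda> * N) * IE \<psi>) \<le> exp (\<Lambda> * N) * ((N + K) * (r * p + m\<^sup>2 / r ^ Q))"
    by (intro mult_left_mono) auto
  then have "IE \<psi> \<le> exp (\<Lambda> * N) * (N + K) * (r * p + m\<^sup>2 / r ^ Q)"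
    by (simp add: exp_minus mult.assoc[symmetric])
  then show "measure lebesgue ?O \<le> exp (\<Lambda> * N) * (N + (2 * CARD('n) / c) ^ CARD('n)) *
      (r * p + (measure lebesgue E)\<^sup>2 / r ^ Q) + e"
    using \<psi>(5) by (simp add: K_def m_def)
qed

end

text \<open>The local constants are chosen before \<open>z\<close>, which will be a set together
  with a bound of its perimeter. A finite subcover then gives one constant, the sum, and one radius,
  the minimum, valid for all \<open>z\<close>.\<close>

lemma cover_bound:
  fixes S :: "'z \<Rightarrow> (real^'n) set" and q :: "real \<Rightarrow> 'z \<Rightarrow> real"
  assumes K: "compact K"
    and loc: "\<And>x. x \<in> K \<Longrightarrow> \<exists>W M \<rho>. open W \<and> x \<in> W \<and> 0 \<le> M \<and> 0 < \<rho> \<and>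
      (\<forall>r z. 0 < r \<longrightarrow> r < \<rho> \<longrightarrow> P z \<longrightarrow> measure lebesgue (S z \<inter> W) \<le> M * q r z)"
    and S: "\<And>z. P z \<Longrightarrow> S z \<subseteq> K \<and> S z \<in> lmeasurable"
  shows "\<exists>M \<rho>. 0 \<le> M \<and> 0 < \<rho> \<and>
    (\<forall>r z. 0 < r \<longrightarrow> r < \<rho> \<longrightarrow> P z \<longrightarrow> measure lebesgue (S z) \<le> M * q r z)"
proof -
  have "\<forall>x\<in>K. \<exists>t. open (fst t) \<and> x \<in> fst t \<and> 0 \<le> fst (snd t) \<and> 0 < snd (snd t) \<and>
      (\<forall>r z. 0 < r \<longrightarrow> r < snd (snd t) \<longrightarrow> P z \<longrightarrow> measure lebesgue (S z \<inter> fst t) \<le> fst (snd t) * q r z)"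
    using loc by (simp add: split_paired_Ex)
  from bchoice[OF this] obtain t where t: "\<forall>x\<in>K. open (fst (t x)) \<and> x \<in> fst (t x) \<and> 0 \<le> fst (snd (t x)) \<and> 0 < snd (snd (t x)) \<and>
      (\<forall>r z. 0 < r \<longrightarrow> r < snd (snd (t x)) \<longrightarrow> P z \<longrightarrow> measure lebesgue (S z \<inter> fst (t x)) \<le> fst (snd (t x)) * q r z)" ..
  define W M \<rho> where "W x = fst (t x)" and "M x = fst (snd (t x))" and "\<rho> x = snd (snd (t x))" for x
  have W: "open (W x)" "x \<in> W x" "0 \<le> M x" "0 < \<rho> x"
    "\<And>r z. 0 < r \<Longrightarrow> r < \<rho> x \<Longrightarrow> P z \<Longrightarrow> measure lebesgue (S z \<inter> W x) \<le> M x * q r z" if "x \<in> K" for x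
    using bspec[OF t that] unfolding W_def M_def \<rho>_def by blast+
  obtain F where F: "F \<subseteq> K" "finite F" "K \<subseteq> (\<Union>x\<in>F. W x)"
    using compactE_image[OF K, of K W] W(1,2) by blast
  define \<rho>' where "\<rho>' = Min (insert 1 (\<rho> ` F))"
  have "0 < \<rho>'" unfolding \<rho>'_def using F W(4) by (subst Min_gr_iff) auto
  moreover have "0 \<le> (\<Sum>x\<in>F. M x)" using F W(3) by (intro sum_nonneg) auto
  moreover have "measure lebesgue (S z) \<le> (\<Sum>x\<in>F. M x) * q r z" if r: "0 < r" "r < \<rho>'" and P: "P z" for r z
  proof -
    have SW: "S z \<inter> W x \<in> lmeasurable" if "x \<in> F" for x
      using S[OF P] W(1) F(1) that by (intro fmeasurable_Int_fmeasurable) auto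
    have "S z = (\<Union>x\<in>F. S z \<inter> W x)" using S[OF P] F(3) by blast
    then have "measure lebesgue (S z) \<le> (\<Sum>x\<in>F. measure lebesgue (S z \<inter> W x))"
      using measure_UNION_le[OF F(2), of "\<lambda>x. S z \<inter> W x" lebesgue] SW by (metis fmeasurableD)
    also have "\<dots> \<le> (\<Sum>x\<in>F. M x * q r z)"
    proof (rule sum_mono)
      fix x assume x: "x \<in> F"
      have "\<rho>' \<le> \<rho> x" unfolding \<rho>'_def using F(2) x by (intro Min_le) auto
      then show "measure lebesgue (S z \<inter> W x) \<le> M x * q r z"
        using x F(1) r P by (intro W(5)) auto
    qed
    finally show ?thesis by (simp add: sum_distrib_right)
  qed
  ultimately show ?thesis by blast
qed

lemma combine_scales:
  fixes m p M M2 \<rho> :: real and Q :: nat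
  assumes m: "m > 0" and p: "p \<ge> 0" and M: "M > 0" "M2 \<ge> 0" "\<rho> > 0" and Q: "Q > 0"
    and small: "\<And>r. 0 < r \<Longrightarrow> r < \<rho> \<Longrightarrow> m \<le> M * (r * p + m\<^sup>2 / r ^ Q)"
    and large: "m \<le> M2 * p"
  shows "m powr ((real Q - 1) / real Q) \<le> (2 * M + M2 / \<rho>) * (2 * M) powr (1 / real Q) * p"
proof -
  \<comment> \<open>The choice \<open>r = a b\<close> makes the quadratic term equal to \<open>m / 2\<close>.\<close>
  define a where "a = (2 * M) powr (1 / real Q)"
  define b where "b = m powr (1 / real Q)"
  have ab: "a > 0" "b > 0" using M m by (simp_all add: a_def b_def)
  have split: "m powr ((real Q - 1) / real Q) = m / b"
  proof -
    have "(real Q - 1) / real Q = 1 - 1 / real Q" using Q by (simp add: field_simps)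
    then show ?thesis using m by (simp add: b_def powr_diff)
  qed
  have pw: "(a * b) ^ Q = 2 * M * m"
    using M m Q unfolding a_def b_def powr_mult[symmetric]
    by (simp add: powr_powr flip: powr_realpow powr_mult)
  have "m \<le> (2 * M + M2 / \<rho>) * a * b * p"
  proof (cases "a * b < \<rho>")
    case True
    have "m \<le> M * (a * b * p + m\<^sup>2 / (a * b) ^ Q)" using ab True by (intro small) auto
    also have "\<dots> = M * (a * b * p) + m / 2"
      unfolding pw using M m by (simp add: field_simps power2_eq_square)
    finally have "m \<le> 2 * M * (a * b) * p" by simp
    moreover have "0 \<le> M2 / \<rho> * (a * b) * p" using M ab p by simp
    ultimately show ?thesis by (simp add: algebra_simps)
  next
    case False
    \<comment> \<open>The balancing radius is too large to be admissible. But then the factor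
      \<open>a * b / \<rho>\<close> is at least 1, and inserting it into the large-scale estimate
      produces the same power of \<open>m\<close>.\<close>
    then have "1 \<le> a * b / \<rho>" using M by simp
    then have "M2 * p * 1 \<le> M2 * p * (a * b / \<rho>)" using M p by (intro mult_left_mono) auto
    then have "m \<le> M2 / \<rho> * (a * b) * p" using large by (simp add: mult_ac)
    moreover have "0 \<le> 2 * M * (a * b) * p" using M ab p by simp
    ultimately show ?thesis by (simp add: algebra_simps)
  qed
  then show ?thesis using ab unfolding split a_def[symmetric] by (simp add: divide_le_eq mult_ac)
qed

text \<open>The upper bound makes the set of dimensions over \<open>closure \<Omega>\<close> finite,
  so that \<open>Max\<close> dominates each of them; positivity allows division by the
  index.\<close>

lemma pointwise_hom_dim_bounds:
  fixes X :: "'m \<Rightarrow> real^'n \<Rightarrow> real^'n"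
  assumes "comm_span X s x = UNIV"
  shows "pointwise_hom_dim X x \<le> CARD('n) * s" "0 < pointwise_hom_dim X x"
proof -
  obtain w :: "'n \<Rightarrow> 'm list" where w: "\<And>k. w k \<noteq> [] \<and> length (w k) \<le> s"
    "(\<Sum>k\<in>UNIV. length (w k)) = pointwise_hom_dim X x"
    using comm_words[OF assms] by blast
  have "(\<Sum>k\<in>UNIV. length (w k)) \<le> (\<Sum>k\<in>(UNIV::'n set). s)" using w(1) by (intro sum_mono) auto
  then show "pointwise_hom_dim X x \<le> CARD('n) * s" by (simp add: w(2))
  show "0 < pointwise_hom_dim X x"
    unfolding w(2)[symmetric] using w(1) by (intro sum_pos) auto
qed

text \<open>Multiplication by a cutoff function of class C^2 gives a C^2 field with compact support:
  one derivative bounds the field as Lipschitz, the second makes its derivative Lipschitz.\<close>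

lemma cutoff_field:
  fixes X :: "'a::euclidean_space \<Rightarrow> 'a"
  assumes "compact K" "open U" "K \<subseteq> U" "smooth_on U X"
  obtains Y V B where "open V" "K \<subseteq> V" "V \<subseteq> U" "\<And>x. x \<in> V \<Longrightarrow> Y x = X x" "C11_field Y B"
proof -
  obtain \<rho> :: "'a \<Rightarrow> real" and V where \<rho>: "Ck_on 2 UNIV \<rho>" "\<And>x. 0 \<le> \<rho> x" "\<And>x. \<rho> x \<le> 1"
    "open V" "K \<subseteq> V" "V \<subseteq> U" "\<And>x. x \<in> V \<Longrightarrow> \<rho> x = 1" "{x. \<rho> x \<noteq> 0} \<subset>\<subset> U"
    by (rule Ck_on_cutoff[OF assms(1-3), where k = 2]) (rule that)
  define M where "M = closure {x. \<rho> x \<noteq> 0}"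
  have M: "compact M" "M \<subseteq> U" "\<And>x. x \<notin> M \<Longrightarrow> \<rho> x = 0"
    using \<rho>(8) eq_0_off_closure unfolding M_def compactly_contained_def by blast+
  define Y where "Y x = \<rho> x *\<^sub>R X x" for x
  have Y0: "Y x = 0" if "x \<notin> M" for x using M(3) that by (simp add: Y_def)
  have "Ck_on 2 U Y"
    unfolding Y_def using assms by (intro Ck_on_scaleR Ck_on_subset[OF \<rho>(1)]) (auto simp: smooth_on_def)
  moreover have "Ck_on 2 (-M) Y"
    using Y0 M(1) compact_imp_closed by (intro Ck_on_cong_open[of "-M" "\<lambda>x. 0" Y]) auto
  ultimately have "Ck_on 2 (U \<union> -M) Y"
    using assms(2) M(1) compact_imp_closed by (intro Ck_on_Un) auto
  moreover have "U \<union> -M = UNIV" using M(2) by auto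
  ultimately have C2: "Ck_on 2 UNIV Y" by simp
  then have C1: "Ck_on 1 UNIV Y" by (rule Ck_on_antimono) simp
  have C1d: "Ck_on 1 UNIV (\<lambda>x. frechet_derivative Y (at x) b)" for b
    using C2 by (simp add: numeral_2_eq_2)
  have diff: "Y differentiable (at x)" for x using C1 by simp
  obtain L where L: "L \<ge> 0" "\<And>x. norm (Y x) \<le> L" "\<And>x h. norm (frechet_derivative Y (at x) h) \<le> L * norm h"
    by (rule C1_compact_support_bounds[OF C1 M(1) Y0], assumption) (rule that)
  have z: "frechet_derivative Y (at x) h = 0" if "x \<notin> M" for x h
    using frechet_derivative_cong_open(1)[of "-M" x Y "\<lambda>x. 0"] that M Y0 by (simp add: open_Compl compact_imp_closed)
  have "\<forall>b. \<exists>B\<ge>0. \<forall>x y. norm (frechet_derivative Y (at x) b - frechet_derivative Y (at y) b) \<le> B * norm (x - y)"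
  proof
    fix b
    obtain B where "B \<ge> 0" "\<And>x y. norm (frechet_derivative Y (at x) b - frechet_derivative Y (at y) b) \<le> B * norm (x - y)"
      by (rule C1_compact_support_bounds[OF C1d[of b] M(1) z], assumption) (rule that)
    then show "\<exists>B\<ge>0. \<forall>x y. norm (frechet_derivative Y (at x) b - frechet_derivative Y (at y) b) \<le> B * norm (x - y)"
      by auto
  qed
  then obtain B where B: "\<And>b. B b \<ge> 0"
    "\<And>b x y. norm (frechet_derivative Y (at x) b - frechet_derivative Y (at y) b) \<le> B b * norm (x - y)" by metis
  have s: "(\<Sum>b\<in>Basis. B b) \<ge> 0" using B by (intro sum_nonneg) auto
  have d2: "norm (frechet_derivative Y (at x) h - frechet_derivative Y (at y) h) \<le> (\<Sum>b\<in>Basis. B b) * norm (x - y) * norm h" for x y h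
  proof -
    have "norm (frechet_derivative Y (at x) h - frechet_derivative Y (at y) h) =
        norm (\<Sum>b\<in>Basis. (h \<bullet> b) *\<^sub>R (frechet_derivative Y (at x) b - frechet_derivative Y (at y) b))"
      by (subst (1 2) frechet_derivative_basis_sum[OF diff]) (simp add: sum_subtractf scaleR_diff_right)
    also have "\<dots> \<le> (\<Sum>b\<in>Basis. norm h * (B b * norm (x - y)))"
      using B Basis_le_norm[of _ h] by (intro sum_norm_le) (auto intro!: mult_mono)
    also have "\<dots> = (\<Sum>b\<in>Basis. B b) * norm (x - y) * norm h"
      by (simp add: sum_distrib_left[symmetric] sum_distrib_right[symmetric] algebra_simps)
    finally show ?thesis .
  qed
  let ?B = "L + (\<Sum>b\<in>Basis. B b) + 1"
  have "C11_field Y ?B"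
  proof
    fix x y h
    show "norm (frechet_derivative Y (at x) h) \<le> ?B * norm h"
      by (rule order_trans[OF L(3)]) (use s in \<open>auto intro!: mult_right_mono\<close>)
    show "norm (frechet_derivative Y (at x) h - frechet_derivative Y (at y) h) \<le> ?B * norm (x - y) * norm h"
      by (rule order_trans[OF d2]) (use L(1) in \<open>auto intro!: mult_right_mono\<close>)
    show "norm (Y x) \<le> ?B" using L(2)[of x] s by simp
  qed (use diff L(1) s in auto)
  moreover have "Y x = X x" if "x \<in> V" for x using \<rho>(7)[OF that] by (simp add: Y_def)
  ultimately show ?thesis by (intro that[OF \<rho>(4,5,6)])
qed

lemma C11_field_mono:
  assumes "C11_field X B" "B \<le> B'"
  shows "C11_field X B'"
proof -
  interpret C11_field X B by fact
  show ?thesis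
  proof
    fix x y h
    show "norm (X x) \<le> B'" using bound[of x] assms(2) by simp
    show "norm (frechet_derivative X (at x) h) \<le> B' * norm h"
      by (rule order_trans[OF deriv_bound]) (use assms(2) in \<open>auto intro!: mult_right_mono\<close>)
    show "norm (frechet_derivative X (at x) h - frechet_derivative X (at y) h) \<le> B' * norm (x - y) * norm h"
      by (rule order_trans[OF deriv_lipschitz]) (use assms(2) in \<open>auto intro!: mult_right_mono\<close>)
  qed (use differentiable B_pos assms(2) in auto)
qed

lemma smooth_fields_cutoff:
  fixes X :: "'m::finite \<Rightarrow> real^'n \<Rightarrow> real^'n"
  assumes "compact K" "open U" "K \<subseteq> U" "\<And>j. smooth_on U (X j)"
  shows "\<exists>Y V B. C11_fields Y B \<and> open V \<and> K \<subseteq> V \<and> V \<subseteq> U \<and> (\<forall>i. \<forall>x\<in>V. Y i x = X i x)"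
proof -
  define R where "R j Y V B \<longleftrightarrow> open V \<and> K \<subseteq> V \<and> V \<subseteq> U \<and> (\<forall>x\<in>V. Y x = X j x) \<and> C11_field Y B"
    for j Y V B
  have "\<exists>Y V B. R j Y V B" for j
    by (rule cutoff_field[OF assms(1-3) assms(4)[of j]]) (unfold R_def, blast)
  then obtain Y V B where YVB: "\<And>j. R j (Y j) (V j) (B j)" by metis
  define L where "L = (\<Sum>j\<in>UNIV. B j)"
  have B: "C11_field (Y j) (B j)" for j using YVB[of j] by (simp add: R_def)
  then have "B j \<ge> 0" for j using C11_field.B_pos less_imp_le by blast
  then have "B j \<le> L" for j unfolding L_def by (intro member_le_sum) auto
  from C11_field_mono[OF B this] have "C11_field (Y j) L" for j .
  then have F: "C11_fields Y L" by unfold_locales (auto simp: C11_field_def)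
  have V: "open (V j)" "K \<subseteq> V j" "V j \<subseteq> U" "\<And>x. x \<in> V j \<Longrightarrow> Y j x = X j x" for j
    using YVB[of j] by (simp_all add: R_def)
  show ?thesis
  proof (intro exI conjI allI ballI)
    show "open (\<Inter>j. V j)" using V(1) by (intro open_INT) auto
    show "K \<subseteq> (\<Inter>j. V j)" using V(2) by (rule INT_greatest)
    show "(\<Inter>j. V j) \<subseteq> U" using V(3) by (rule INF_lower2[OF UNIV_I])
    show "Y i x = X i x" if "x \<in> (\<Inter>j. V j)" for i x using that by (intro V(4)) simp
  qed (rule F)
qed

theorem theorem1p3:
  fixes U \<Omega> :: "(real^'n) set"
    and X :: "'m::finite \<Rightarrow> real^'n \<Rightarrow> real^'n"
  assumes "CARD('n) \<ge> 2"
    and "open U" and "connected U"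
    and "\<And>j. smooth_on U (X j)"
    and "hormander_condition X U"
    and "open \<Omega>" and "bounded \<Omega>" and "\<Omega> \<subset>\<subset> U"
  shows "\<exists>C::real. C > 0 \<and>
           (\<forall>E. open E \<and> bounded E \<and> E \<subset>\<subset> \<Omega> \<and> C1_boundary E \<longrightarrow>
              ereal (measure lebesgue E powr
                       ((real (metivier_index X \<Omega>) - 1) / real (metivier_index X \<Omega>)))
                \<le> ereal C * X_perimeter X E \<Omega>)"
proof -
  define K where "K = closure \<Omega>"
  have K: "compact K" "K \<subseteq> U" using assms(8) by (auto simp: K_def compactly_contained_def)
  obtain s0 where s0: "\<And>x. x \<in> U \<Longrightarrow> comm_span X s0 x = UNIV"
    using assms(5) by (auto simp: hormander_condition_def)
  define Q where "Q = metivier_index X \<Omega>"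
  have fin: "finite (pointwise_hom_dim X ` K)"
    by (rule finite_subset[of _ "{..CARD('n) * s0}"]) (use pointwise_hom_dim_bounds(1)[OF s0] K(2) in auto)
  have Q: "pointwise_hom_dim X x \<le> Q" if "x \<in> K" for x
    unfolding Q_def metivier_index_def using fin that by (auto simp: K_def intro: Max_ge)
  from smooth_fields_cutoff[where X = X, OF K(1) assms(2) K(2) assms(4)]
  obtain Y V B where YVB: "C11_fields Y B \<and> open V \<and> K \<subseteq> V \<and> V \<subseteq> U \<and> (\<forall>i. \<forall>x\<in>V. Y i x = X i x)"
    by (elim exE)
  then have YB: "C11_fields Y B" and V: "open V" "K \<subseteq> V" "V \<subseteq> U" "\<And>i x. x \<in> V \<Longrightarrow> Y i x = X i x"
    by simp_all
  interpret C11_fields Y B by (rule YB)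
  have sV: "smooth_on V (Y i)" for i
    by (rule smooth_on_cong_open[OF V(1) _ smooth_on_subset[OF assms(4)[of i] V(3)]]) (simp add: V(4))
  have charts: "\<exists>(w :: 'n \<Rightarrow> 'm list) ks \<delta> c. local_chart x w ks \<delta> c \<and> (\<Sum>k\<in>UNIV. length (w k)) = pointwise_hom_dim X x"
    if "x \<in> K" for x
  proof -
    have "x \<in> V" "x \<in> U" using that V(2) K(2) by auto
    then show ?thesis
      by (intro C11_fields_local_chart[where X = X and V = V and s = s0, OF YB V(1)]) (simp_all add: sV V(4) s0)
  qed
  \<comment> \<open>Pairing the set with a real bound of its perimeter lets
    \<open>cover_bound\<close> produce constants that depend on neither.\<close>
  define P where "P z \<longleftrightarrow> open (fst z) \<and> fst z \<subset>\<subset> \<Omega> \<and> X_perimeter X (fst z) \<Omega> \<le> ereal (snd z)"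
    for z :: "(real^'n) set \<times> real"
  have pf: "perimeter_flows Y B X E \<Omega> V p" if "P (E, p)" for E p
  proof -
    have "\<Omega> \<subseteq> V" using V(2) closure_subset by (auto simp: K_def)
    then show ?thesis using that assms(6) V(4) by unfold_locales (auto simp: P_def)
  qed
  have PK: "fst z \<subseteq> K \<and> fst z \<in> lmeasurable" if "P z" for z
  proof -
    interpret perimeter_flows Y B X "fst z" \<Omega> V "snd z" using pf[of "fst z" "snd z"] that by simp
    show ?thesis using E_sub closure_subset E_measurable by (auto simp: K_def)
  qed
  have "\<exists>W M \<rho>. open W \<and> x \<in> W \<and> 0 \<le> M \<and> 0 < \<rho> \<and>
      (\<forall>r z. 0 < r \<longrightarrow> r < \<rho> \<longrightarrow> P z \<longrightarrow> measure lebesgue (fst z \<inter> W) \<le> M * (r * snd z + (measure lebesgue (fst z))\<^sup>2 / r ^ Q))"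
    if x: "x \<in> K" for x
  proof -
    obtain w :: "'n \<Rightarrow> 'm list" and ks \<delta> c where ch: "local_chart x w ks \<delta> c"
      and len: "(\<Sum>k\<in>UNIV. length (w k)) \<le> Q"
      using charts[OF x] Q[OF x] by metis
    have \<delta>: "\<delta> > 0" "c > 0" using ch by (auto simp: local_chart_def)
    define N where "N = real (steps_number w ks)"
    have N: "N \<ge> 0" "N * B \<ge> 0" using B_nonneg by (auto simp: N_def)
    \<comment> \<open>The value of \<open>\<Lambda>\<close> is spelled out because
      \<open>\<Lambda>\<close> belongs to a context that fixes the set \<open>E\<close>; in this
      form the constant visibly precedes the choice of \<open>E\<close>.\<close>
    define M where "M = exp ((CARD('n) * B) * N) * (N + (2 * CARD('n) / c) ^ CARD('n))"
    define \<rho> where "\<rho> = min (min \<delta> 1) (\<delta> / (2 * (N * B + 1)))"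
    have "measure lebesgue (fst z \<inter> ball x (\<delta> / 2)) \<le> M * (r * snd z + (measure lebesgue (fst z))\<^sup>2 / r ^ Q)"
      if r: "0 < r" "r < \<rho>" and P: "P z" for r z
    proof -
      interpret perimeter_flows Y B X "fst z" \<Omega> V "snd z" using pf[of "fst z" "snd z"] P by simp
      show ?thesis
        using small_scale[OF ch len N_def r(1)] r(2) by (simp add: \<rho>_def M_def \<Lambda>_def)
    qed
    moreover have "0 \<le> M" using N \<delta> by (simp add: M_def)
    moreover have "0 < \<rho>" using N \<delta> by (simp add: \<rho>_def add_nonneg_pos)
    ultimately show ?thesis using \<delta>(1) by (intro exI[of _ "ball x (\<delta> / 2)"] exI[of _ M] exI[of _ \<rho>]) auto
  qed
  from cover_bound[OF K(1) this PK] obtain M \<rho> where small: "0 \<le> M" "0 < \<rho>"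
    "\<And>r z. 0 < r \<Longrightarrow> r < \<rho> \<Longrightarrow> P z \<Longrightarrow> measure lebesgue (fst z) \<le> M * (r * snd z + (measure lebesgue (fst z))\<^sup>2 / r ^ Q)"
    by blast
  \<comment> \<open>The same covering argument with a bound free of \<open>r\<close>: the radius is
    a dummy, set to 1 here and to half of \<open>\<rho>2\<close> afterwards.\<close>
  have "\<exists>W M \<rho>. open W \<and> x \<in> W \<and> 0 \<le> M \<and> 0 < (\<rho>::real) \<and>
      (\<forall>r z. 0 < r \<longrightarrow> r < \<rho> \<longrightarrow> P z \<longrightarrow> measure lebesgue (fst z \<inter> W) \<le> M * snd z)" if x: "x \<in> K" for x
  proof -
    have "\<exists>(w :: 'n \<Rightarrow> 'm list) ks \<delta> c. local_chart y w ks \<delta> c" if "y \<in> K" for y using charts[OF that] by blast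
    from C11_fields_leave_compact[OF YB K(1) x this] obtain ts where ts: "flows ts x \<notin> K" by blast
    define W where "W = flows ts -` (- K)"
    have "open W" unfolding W_def using flows_continuous compact_imp_closed[OF K(1)]
      by (intro open_vimage) auto
    moreover have "measure lebesgue (fst z \<inter> W) \<le> (exp ((CARD('n) * B) * total_time ts) * total_time ts) * snd z"
      if P: "P z" for z
    proof -
      interpret perimeter_flows Y B X "fst z" \<Omega> V "snd z" using pf[of "fst z" "snd z"] P by simp
      have "flows ts y \<notin> fst z" if "y \<in> W" for y using that PK[OF P] by (auto simp: W_def)
      from large_scale[OF \<open>open W\<close> this] show ?thesis by (simp add: \<Lambda>_def)
    qed
    moreover have "x \<in> W" using ts by (simp add: W_def)
    ultimately show ?thesis using total_time_nonneg[of ts]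
      by (intro exI[of _ W] exI[of _ "exp ((CARD('n) * B) * total_time ts) * total_time ts"] exI[of _ 1]) auto
  qed
  from cover_bound[OF K(1) this PK] obtain M2 and \<rho>2 :: real where large0: "0 \<le> M2" "0 < \<rho>2"
    "\<And>r z. 0 < r \<Longrightarrow> r < \<rho>2 \<Longrightarrow> P z \<Longrightarrow> measure lebesgue (fst z) \<le> M2 * snd z"
    by blast
  have large: "measure lebesgue (fst z) \<le> M2 * snd z" if "P z" for z
    using large0(3)[of "\<rho>2 / 2" z] large0(2) that by simp
  \<comment> \<open>The constant of \<open>combine_scales\<close> with \<open>M + 1\<close> in place
    of \<open>M\<close>, which is only known to be nonnegative.\<close>
  define C where "C = (2 * (M + 1) + M2 / \<rho>) * (2 * (M + 1)) powr (1 / real Q)"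
  have C: "C > 0"
  proof -
    have "2 * (M + 1) > 0" "M2 / \<rho> \<ge> 0" using small(1,2) large0(1) by auto
    then show ?thesis unfolding C_def by (rule mult_pos_pos[OF add_pos_nonneg]) (use small(1) in simp)
  qed
  have "ereal (measure lebesgue E powr ((real Q - 1) / real Q)) \<le> ereal C * X_perimeter X E \<Omega>"
    if E: "open E" "E \<subset>\<subset> \<Omega>" for E
  proof (cases "measure lebesgue E = 0")
    \<comment> \<open>\<open>0 powr a\<close> is 0 for every \<open>a\<close>. This case also takes
      care of an empty \<open>\<Omega>\<close>, for which the index is the maximum of an empty
      set.\<close>
    case True
    then show ?thesis using X_perimeter_nonneg[of X E \<Omega>] C by (simp add: zero_ereal_def[symmetric])
  next
    case False
    then have m: "measure lebesgue E > 0" by (simp add: zero_less_measure_iff)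
    then have "E \<noteq> {}" by auto
    then obtain x where "x \<in> K" using E(2) closure_subset by (fastforce simp: K_def compactly_contained_def)
    then have Q0: "Q > 0" using Q pointwise_hom_dim_bounds(2)[OF s0] K(2) by (metis le_zero_eq neq0_conv subsetD)
    show ?thesis
    proof (cases "X_perimeter X E \<Omega>")
      case (real p)
      have p: "p \<ge> 0" using X_perimeter_nonneg[of X E \<Omega>] real by simp
      have Pz: "P (E, p)" using E real by (simp add: P_def)
      have "measure lebesgue E \<le> (M + 1) * (r * p + (measure lebesgue E)\<^sup>2 / r ^ Q)" if r: "0 < r" "r < \<rho>" for r
      proof -
        have "0 \<le> r * p + (measure lebesgue E)\<^sup>2 / r ^ Q" using r p by simp
        then show ?thesis using small(3)[OF r Pz] by (simp add: distrib_right)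
      qed
      from combine_scales[OF m p _ large0(1) small(2) Q0 this] small(1) large[OF Pz]
      have "measure lebesgue E powr ((real Q - 1) / real Q) \<le> C * p" by (simp add: C_def)
      then show ?thesis by (simp add: real)
    next
      case PInf
      then show ?thesis using C by simp
    next
      case MInf
      then show ?thesis using X_perimeter_nonneg[of X E \<Omega>] by simp
    qed
  qed
  then show ?thesis using C unfolding Q_def by blast
qed

end
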